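(* Let $\Gamma$ be a tropical curve of genus $2$. Then $\mathrm{Jac}(\Gamma)$ splits (i.e. $\mathrm{Jac}(\Gamma)$ is isogenous to the coproduct $\mathbb{T}E\oplus\mathbb{T}E'$ of two tropical elliptic curves) if and only if $\Gamma$ covers an elliptic curve (i.e. there exist a tropical curve $\mathbb{T}E$ of genus $1$ and a tropical cover $\varphi:\Gamma\to\mathbb{T}E$).
   Context: Integral tori. A real torus with integral structure is a triple $\Sigma=(\Lambda,\Lambda',[\cdot,\cdot])$ with $\Lambda,\Lambda'$ finitely generated free abelian groups of the same rank and $[\cdot,\cdot]:\Lambda\times\Lambda'\to\mathbb{R}$ a non-degenerate pairing (non-degenerate after extending scalars to $\mathbb{R}$, so $\lambda'\mapsto[\cdot,\lambda']$ makes $\Lambda'$ a lattice in $\mathrm{Hom}(\Lambda,\mathbb{R})$). Its underlying group is $\mathrm{Hom}(\Lambda,\mathbb{R})/\Lambda'$ and its dimension is $\mathrm{rk}\,\Lambda$. A morphism $f:\Sigma_1\to\Sigma_2$ is a pair of group homomorphisms $(f^\#:\Lambda_2\to\Lambda_1,\ f_\#:\Lambda_1'\to\Lambda_2')$ with $[f^\#(\lambda_2),\lambda_1']_1=[\lambda_2,f_\#(\lambda_1')]_2$ for all $\lambda_2,\lambda_1'$. It is surjective if $f^\#$ is injective, finite if $f_\#$ is injective, and an isogeny if it is both. The coproduct $\Sigma_1\oplus\Sigma_2$ is $(\Lambda_1\times\Lambda_2,\Lambda_1'\times\Lambda_2',[\cdot,\cdot]_1+[\cdot,\cdot]_2)$.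 Tropical curves and covers. A tropical curve is the geometric realization of a finite connected metric graph $(G,l)$, $l:E(G)\to\mathbb{R}_{>0}$, without legs/ends and without vertex weights; models are obtained by adding or deleting $2$-valent vertices; its genus is $|E(G)|-|V(G)|+1$. A harmonic morphism (= tropical cover) $\varphi:\Gamma\to\tilde\Gamma$ is a continuous surjective map such that for suitable models vertices map to vertices, preimages of edges are edges, $\varphi$ is affine on each edge $e$ with integer slope $d_e(\varphi)\ge 0$ (possibly $0$, the edge being then contracted), and for every $P\in\Gamma$ the number $d_P(\varphi)=\sum_{v\mapsto\tilde v}d_v(\varphi)$ (sum over tangent directions $v$ at $P$ mapping to $\tilde v$) is independent of the tangent direction $\tilde v$ at $\varphi(P)$. Jacobian. For an oriented model, $\Omega^1_\Gamma(\mathbb{Z})$ is the group of integral harmonic $1$-forms $\sum_e\omega_e\,de$ (at each vertex, sum of $\omega_e$ over incoming edges equals sum over outgoing edges), $H_1(\Gamma,\mathbb{Z})$ is the group of integral $1$-cycles, and $\int_e de'=l(e)$ if $e=e'$ and $0$ otherwise, extended bilinearly. $\mathrm{Jac}(\Gamma)=(\Omega^1_\Gamma(\mathbb{Z}),H_1(\Gamma,\mathbb{Z}),\int)$. A tropical elliptic curve $\mathbb{T}E$ is a tropical curve of genus $1$, identified with its Jacobian (a one-dimensional integral torus $\mathbb{R}/l\mathbb{Z}$). *)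

theory Defs
  imports "Graph_Theory.Digraph_Component" "HOL-Algebra.Free_Abelian_Groups" "HOL-Analysis.Analysis"
begin

section \<open>Real tori with integral structure\<close>

record ('a, 'b) torus =
  Lam :: "'a monoid"
  Lam' :: "'b monoid"
  pairing :: "'a \<Rightarrow> 'b \<Rightarrow> real"

definition nondegenerate :: "nat \<Rightarrow> (nat \<Rightarrow> nat \<Rightarrow> real) \<Rightarrow> bool" where
  "nondegenerate n P \<longleftrightarrow>
     (\<forall>x. (\<forall>j<n. (\<Sum>i<n. x i * P i j) = 0) \<longrightarrow> (\<forall>i<n. x i = 0)) \<and>
     (\<forall>y. (\<forall>i<n. (\<Sum>j<n. P i j * y j) = 0) \<longrightarrow> (\<forall>j<n. y j = 0))"

text \<open>The isomorphisms \<open>f\<close>, \<open>f'\<close> choose \<open>\<int>\<close>-bases of the two lattices, which are also bases of the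
  real vector spaces obtained by extending scalars.  Non-degeneracy of the extended pairing is the
  condition on its Gram matrix and does not depend on the choice.  The lattices are written
  multiplicatively, as groups are in \<^theory>\<open>HOL-Algebra.Group\<close>.\<close>

definition integral_torus :: "('a, 'b) torus \<Rightarrow> bool" where
  "integral_torus S \<longleftrightarrow>
     comm_group (Lam S) \<and> comm_group (Lam' S) \<and>
     (\<forall>x\<in>carrier (Lam S). \<forall>y\<in>carrier (Lam S). \<forall>z\<in>carrier (Lam' S).
        pairing S (x \<otimes>\<^bsub>Lam S\<^esub> y) z = pairing S x z + pairing S y z) \<and>
     (\<forall>x\<in>carrier (Lam S). \<forall>y\<in>carrier (Lam' S). \<forall>z\<in>carrier (Lam' S).
        pairing S x (y \<otimes>\<^bsub>Lam' S\<^esub> z) = pairing S x y + pairing S x z) \<and>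
     (\<exists>n. \<exists>f\<in>iso (free_Abelian_group {..<n}) (Lam S). \<exists>f'\<in>iso (free_Abelian_group {..<n}) (Lam' S).
        nondegenerate n (\<lambda>i j. pairing S (f (frag_of i)) (f' (frag_of j))))"

text \<open>A morphism from \<open>S\<close> to \<open>T\<close> is a pair \<open>(f, g)\<close> where \<open>f\<close> goes backwards on the first lattices
  and \<open>g\<close> goes forwards on the second ones.\<close>

definition torus_morphism ::
  "('a, 'b) torus \<Rightarrow> ('c, 'd) torus \<Rightarrow> ('c \<Rightarrow> 'a) \<times> ('b \<Rightarrow> 'd) \<Rightarrow> bool" where
  "torus_morphism S T = (\<lambda>(f, g).
     integral_torus S \<and> integral_torus T \<and>
     f \<in> hom (Lam T) (Lam S) \<and> g \<in> hom (Lam' S) (Lam' T) \<and>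
     (\<forall>x\<in>carrier (Lam T). \<forall>y\<in>carrier (Lam' S). pairing S (f x) y = pairing T x (g y)))"

definition surjective_morphism ::
  "('a, 'b) torus \<Rightarrow> ('c, 'd) torus \<Rightarrow> ('c \<Rightarrow> 'a) \<times> ('b \<Rightarrow> 'd) \<Rightarrow> bool" where
  "surjective_morphism S T = (\<lambda>(f, g). torus_morphism S T (f, g) \<and> inj_on f (carrier (Lam T)))"

definition finite_morphism ::
  "('a, 'b) torus \<Rightarrow> ('c, 'd) torus \<Rightarrow> ('c \<Rightarrow> 'a) \<times> ('b \<Rightarrow> 'd) \<Rightarrow> bool" where
  "finite_morphism S T = (\<lambda>(f, g). torus_morphism S T (f, g) \<and> inj_on g (carrier (Lam' S)))"

definition isogeny ::
  "('a, 'b) torus \<Rightarrow> ('c, 'd) torus \<Rightarrow> ('c \<Rightarrow> 'a) \<times> ('b \<Rightarrow> 'd) \<Rightarrow> bool" where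
  "isogeny S T h \<longleftrightarrow> surjective_morphism S T h \<and> finite_morphism S T h"

definition isogenous :: "('a, 'b) torus \<Rightarrow> ('c, 'd) torus \<Rightarrow> bool" where
  "isogenous S T \<longleftrightarrow> (\<exists>h. isogeny S T h)"

definition torus_coprod :: "('a, 'b) torus \<Rightarrow> ('c, 'd) torus \<Rightarrow> ('a \<times> 'c, 'b \<times> 'd) torus" where
  "torus_coprod S T =
     \<lparr> Lam = Lam S \<times>\<times> Lam T,
       Lam' = Lam' S \<times>\<times> Lam' T,
       pairing = (\<lambda>(x, y) (x', y'). pairing S x x' + pairing T y y') \<rparr>"


section \<open>Metric graphs and tropical curves\<close>

text \<open>Loops and multiple edges are allowed.  The orientation coming with the underlying digraph
  is auxiliary.\<close>

record ('v, 'e) metric_graph =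
  ograph :: "('v, 'e) pre_digraph"
  len :: "'e \<Rightarrow> real"

abbreviation mverts :: "('v, 'e) metric_graph \<Rightarrow> 'v set" where
  "mverts G \<equiv> verts (ograph G)"

abbreviation medges :: "('v, 'e) metric_graph \<Rightarrow> 'e set" where
  "medges G \<equiv> arcs (ograph G)"

text \<open>A tropical curve is given by one of its models.\<close>

definition tropical_curve :: "('v, 'e) metric_graph \<Rightarrow> bool" where
  "tropical_curve G \<longleftrightarrow>
     fin_digraph (ograph G) \<and> Digraph_Component.connected (ograph G) \<and> (\<forall>e\<in>medges G. 0 < len G e)"

definition genus :: "('v, 'e) metric_graph \<Rightarrow> int" where
  "genus G = int (card (medges G)) - int (card (mverts G)) + 1"


section \<open>Geometric realization\<close>

text \<open>\<open>Inner e t\<close> is the point in the interior of \<open>e\<close> at distance \<open>t\<close> from the tail.\<close>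

datatype ('v, 'e) point = Vertex 'v | Inner 'e real

definition points :: "('v, 'e) metric_graph \<Rightarrow> ('v, 'e) point set" where
  "points G = Vertex ` mverts G \<union> {Inner e t |e t. e \<in> medges G \<and> 0 < t \<and> t < len G e}"

text \<open>The characteristic map of the closed edge \<open>e\<close>, meant for \<open>0 \<le> t \<le> len G e\<close>.\<close>

definition edge_pt :: "('v, 'e) metric_graph \<Rightarrow> 'e \<Rightarrow> real \<Rightarrow> ('v, 'e) point" where
  "edge_pt G e t =
     (if t \<le> 0 then Vertex (tail (ograph G) e)
      else if len G e \<le> t then Vertex (head (ograph G) e)
      else Inner e t)"

definition open_edge :: "('v, 'e) metric_graph \<Rightarrow> 'e \<Rightarrow> ('v, 'e) point set" where
  "open_edge G e = {Inner e t |t. 0 < t \<and> t < len G e}"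

text \<open>The quotient topology of the disjoint union of the vertices and the closed edges.\<close>

definition realization :: "('v, 'e) metric_graph \<Rightarrow> ('v, 'e) point topology" where
  "realization G = topology (\<lambda>U. U \<subseteq> points G \<and>
     (\<forall>e\<in>medges G. openin (top_of_set {0..len G e}) {t\<in>{0..len G e}. edge_pt G e t \<in> U}))"

lemma openin_realization:
  "openin (realization G) U \<longleftrightarrow> U \<subseteq> points G \<and>
     (\<forall>e\<in>medges G. openin (top_of_set {0..len G e}) {t\<in>{0..len G e}. edge_pt G e t \<in> U})"
proof -
  let ?P = "\<lambda>U. U \<subseteq> points G \<and>
     (\<forall>e\<in>medges G. openin (top_of_set {0..len G e}) {t\<in>{0..len G e}. edge_pt G e t \<in> U})"
  have "?P (S \<inter> T)" if "?P S" "?P T" for S T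
  proof -
    have *: "{t\<in>{0..len G e}. edge_pt G e t \<in> S \<inter> T} =
        {t\<in>{0..len G e}. edge_pt G e t \<in> S} \<inter> {t\<in>{0..len G e}. edge_pt G e t \<in> T}" for e
      by auto
    show ?thesis
      using that unfolding * by blast
  qed
  moreover have "?P (\<Union>\<K>)" if "\<forall>K\<in>\<K>. ?P K" for \<K>
  proof -
    have *: "{t\<in>{0..len G e}. edge_pt G e t \<in> \<Union>\<K>} =
        \<Union>((\<lambda>K. {t\<in>{0..len G e}. edge_pt G e t \<in> K}) ` \<K>)" for e
      by auto
    show ?thesis
      using that unfolding * by blast
  qed
  ultimately have "istopology ?P"
    unfolding istopology_def by blast
  then show ?thesis
    unfolding realization_def by (simp add: topology_inverse')
qed


section \<open>Models\<close>

text \<open>On the edge \<open>e\<close>, parametrized by arc length, the map \<open>\<psi>\<close> is affine of slope \<open>d\<close>.  The sign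
  \<open>\<sigma>\<close> absorbs the orientations.\<close>

definition affine_on_edge ::
  "('v, 'e) metric_graph \<Rightarrow> ('w, 'f) metric_graph \<Rightarrow> (('v, 'e) point \<Rightarrow> ('w, 'f) point) \<Rightarrow> 'e \<Rightarrow> nat \<Rightarrow> bool"
where
  "affine_on_edge M N \<psi> e d \<longleftrightarrow>
     (if d = 0 then \<exists>q. \<forall>t\<in>{0..len M e}. \<psi> (edge_pt M e t) = q
      else \<exists>e'\<in>medges N. \<exists>a. \<exists>\<sigma>\<in>{1, -1}. \<forall>t\<in>{0..len M e}.
             a + \<sigma> * real d * t \<in> {0..len N e'} \<and>
             \<psi> (edge_pt M e t) = edge_pt N e' (a + \<sigma> * real d * t))"

text \<open>\<open>R\<close> is obtained from \<open>G\<close> by adding finitely many \<open>2\<close>-valent vertices; \<open>k\<close> identifies the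
  realizations.\<close>

definition refines ::
  "('v, 'e) metric_graph \<Rightarrow> (('v, 'e) point \<Rightarrow> ('w, 'f) point) \<Rightarrow> ('w, 'f) metric_graph \<Rightarrow> bool" where
  "refines R k G \<longleftrightarrow>
     tropical_curve R \<and> bij_betw k (points R) (points G) \<and>
     Vertex ` mverts G \<subseteq> k ` Vertex ` mverts R \<and>
     (\<forall>e\<in>medges R. affine_on_edge R G k e 1)"

text \<open>\<open>M\<close> arises from \<open>G\<close> by adding and deleting \<open>2\<close>-valent vertices, that is, they have a common
  refinement; \<open>h\<close> identifies the realization of \<open>M\<close> with that of \<open>G\<close>.  As graphs are finite,
  labelling \<open>R\<close> by natural numbers is no restriction.\<close>

definition model_of ::
  "('v, 'e) metric_graph \<Rightarrow> (('v, 'e) point \<Rightarrow> ('w, 'f) point) \<Rightarrow> ('w, 'f) metric_graph \<Rightarrow> bool" where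
  "model_of M h G \<longleftrightarrow> tropical_curve M \<and>
     (\<exists>(R :: (nat, nat) metric_graph) k. refines R k M \<and> refines R (h \<circ> k) G)"


section \<open>Tropical covers\<close>

text \<open>A tangent direction at \<open>p\<close> is a triple \<open>(e, t, \<sigma>)\<close>: start at the point with coordinate \<open>t\<close> on
  \<open>e\<close> and move towards the head (\<open>\<sigma> = 1\<close>) or the tail (\<open>\<sigma> = -1\<close>).  A loop gives two directions at
  its vertex.\<close>

definition tangents ::
  "('v, 'e) metric_graph \<Rightarrow> ('v, 'e) point \<Rightarrow> ('e \<times> real \<times> real) set" where
  "tangents G p = {(e, t, \<sigma>). e \<in> medges G \<and> t \<in> {0..len G e} \<and> edge_pt G e t = p \<and>
     (\<sigma> = 1 \<and> t < len G e \<or> \<sigma> = -1 \<and> 0 < t)}"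

definition germ :: "('v, 'e) metric_graph \<Rightarrow> 'e \<times> real \<times> real \<Rightarrow> real \<Rightarrow> ('v, 'e) point" where
  "germ G = (\<lambda>(e, t, \<sigma>) s. edge_pt G e (t + \<sigma> * s))"

definition maps_direction ::
  "('v, 'e) metric_graph \<Rightarrow> ('w, 'f) metric_graph \<Rightarrow> (('v, 'e) point \<Rightarrow> ('w, 'f) point) \<Rightarrow> ('e \<Rightarrow> nat)
    \<Rightarrow> 'e \<times> real \<times> real \<Rightarrow> 'f \<times> real \<times> real \<Rightarrow> bool" where
  "maps_direction M N \<psi> d v w \<longleftrightarrow> 0 < d (fst v) \<and>
     (\<exists>\<epsilon>>0. \<forall>s\<in>{0..\<epsilon>}. \<psi> (germ M v s) = germ N w (real (d (fst v)) * s))"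

definition local_degree ::
  "('v, 'e) metric_graph \<Rightarrow> ('w, 'f) metric_graph \<Rightarrow> (('v, 'e) point \<Rightarrow> ('w, 'f) point) \<Rightarrow> ('e \<Rightarrow> nat)
    \<Rightarrow> ('v, 'e) point \<Rightarrow> 'f \<times> real \<times> real \<Rightarrow> nat" where
  "local_degree M N \<psi> d p w = (\<Sum>v\<in>{v\<in>tangents M p. maps_direction M N \<psi> d v w}. d (fst v))"

definition harmonic_on_models ::
  "('v, 'e) metric_graph \<Rightarrow> ('w, 'f) metric_graph \<Rightarrow> (('v, 'e) point \<Rightarrow> ('w, 'f) point) \<Rightarrow> bool" where
  "harmonic_on_models M N \<psi> \<longleftrightarrow>
     (\<forall>v\<in>mverts M. \<psi> (Vertex v) \<in> Vertex ` mverts N) \<and>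
     (\<forall>e'\<in>medges N. \<exists>F\<subseteq>medges M. {p\<in>points M. \<psi> p \<in> open_edge N e'} = (\<Union>e\<in>F. open_edge M e)) \<and>
     (\<exists>d. (\<forall>e\<in>medges M. affine_on_edge M N \<psi> e (d e)) \<and>
          (\<forall>p\<in>points M. \<forall>w\<in>tangents N (\<psi> p). \<forall>w'\<in>tangents N (\<psi> p).
             local_degree M N \<psi> d p w = local_degree M N \<psi> d p w'))"

definition tropical_cover ::
  "('v, 'e) metric_graph \<Rightarrow> ('w, 'f) metric_graph \<Rightarrow> (('v, 'e) point \<Rightarrow> ('w, 'f) point) \<Rightarrow> bool" where
  "tropical_cover G H \<phi> \<longleftrightarrow>
     tropical_curve G \<and> tropical_curve H \<and>
     continuous_map (realization G) (realization H) \<phi> \<and> \<phi> ` points G = points H \<and>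
     (\<exists>(M :: (nat, nat) metric_graph) h (N :: (nat, nat) metric_graph) k \<psi>.
        model_of M h G \<and> model_of N k H \<and>
        (\<forall>p\<in>points M. \<psi> p \<in> points N \<and> k (\<psi> p) = \<phi> (h p)) \<and>
        harmonic_on_models M N \<psi>)"


section \<open>Jacobians\<close>

text \<open>The \<open>1\<close>-forms \<open>\<Sum> \<omega>\<^sub>e de\<close> and the \<open>1\<close>-chains are both formal integral sums over the edges.\<close>

definition harmonic_forms :: "('v, 'e) metric_graph \<Rightarrow> ('e \<Rightarrow>\<^sub>0 int) monoid" where
  "harmonic_forms G = free_Abelian_group (medges G) \<lparr> carrier :=
     {\<omega> \<in> carrier (free_Abelian_group (medges G)). \<forall>v\<in>mverts G.
        (\<Sum>e\<in>{e\<in>medges G. head (ograph G) e = v}. Poly_Mapping.lookup \<omega> e) =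
        (\<Sum>e\<in>{e\<in>medges G. tail (ograph G) e = v}. Poly_Mapping.lookup \<omega> e)} \<rparr>"

definition boundary :: "('v, 'e) metric_graph \<Rightarrow> ('e \<Rightarrow>\<^sub>0 int) \<Rightarrow> ('v \<Rightarrow>\<^sub>0 int)" where
  "boundary G = frag_extend (\<lambda>e. frag_of (head (ograph G) e) - frag_of (tail (ograph G) e))"

definition first_homology :: "('v, 'e) metric_graph \<Rightarrow> ('e \<Rightarrow>\<^sub>0 int) monoid" where
  "first_homology G = free_Abelian_group (medges G) \<lparr> carrier :=
     {c \<in> carrier (free_Abelian_group (medges G)). boundary G c = 0} \<rparr>"

definition integration :: "('v, 'e) metric_graph \<Rightarrow> ('e \<Rightarrow>\<^sub>0 int) \<Rightarrow> ('e \<Rightarrow>\<^sub>0 int) \<Rightarrow> real" where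
  "integration G \<omega> c = (\<Sum>e\<in>medges G. \<Sum>e'\<in>medges G.
     of_int (Poly_Mapping.lookup c e) * of_int (Poly_Mapping.lookup \<omega> e') * (if e = e' then len G e else 0))"

definition Jac :: "('v, 'e) metric_graph \<Rightarrow> ('e \<Rightarrow>\<^sub>0 int, 'e \<Rightarrow>\<^sub>0 int) torus" where
  "Jac G = \<lparr> Lam = harmonic_forms G, Lam' = first_homology G, pairing = integration G \<rparr>"


section \<open>Tropical elliptic curves\<close>

definition tropical_elliptic_curve :: "('v, 'e) metric_graph \<Rightarrow> bool" where
  "tropical_elliptic_curve E \<longleftrightarrow> tropical_curve E \<and> genus E = 1"

text \<open>Both existential statements range over curves labelled by natural numbers, which is no
  restriction as graphs are finite.\<close>

definition jacobian_splits :: "('v, 'e) metric_graph \<Rightarrow> bool" where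
  "jacobian_splits G \<longleftrightarrow>
     (\<exists>(E :: (nat, nat) metric_graph) (E' :: (nat, nat) metric_graph).
        tropical_elliptic_curve E \<and> tropical_elliptic_curve E' \<and>
        isogenous (Jac G) (torus_coprod (Jac E) (Jac E')))"

definition covers_elliptic_curve :: "('v, 'e) metric_graph \<Rightarrow> bool" where
  "covers_elliptic_curve G \<longleftrightarrow>
     (\<exists>(E :: (nat, nat) metric_graph) \<phi>. tropical_elliptic_curve E \<and> tropical_cover G E \<phi>)"

end

theory Submission
  imports Defs "HOL-Library.Real_Mod"
begin

text \<open>
  Both properties of \<open>\<Gamma>\<close> are equivalent to the existence of a nonzero integral cycle \<open>u\<close> and some
  \<open>l > 0\<close> such that the integration pairing of \<open>u\<close> with every cycle lies in \<open>l \<int>\<close>.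

  If the Jacobian splits, such a \<open>u\<close> is the image of a generator for one of the two elliptic
  curves.  Conversely, as the rank is two, the orthogonal complement of \<open>u\<close> is spanned by another
  cycle \<open>w\<close>, and \<open>u\<close>, \<open>w\<close> define an isogeny.

  The condition on \<open>u\<close> says that the harmonic form \<open>u\<close> has a potential \<open>F\<close> with values in
  \<open>\<real>/l\<int>\<close>.  That \<open>F\<close> is affine with integral slopes and harmonic can be expressed in terms of its
  slopes in the tangent directions at each point.  It is therefore independent of the model and
  stable under pulling back along covers, so a potential on an elliptic curve pulls back to one on
  every curve covering it.  Conversely \<open>F\<close> itself is a cover of the circle of length \<open>l\<close>.
\<close>

section \<open>Cycles\<close>

text \<open>Closed chains and harmonic forms obey the same balancing condition, so both lattices of
  the Jacobian are one group, on which integration is a symmetric positive definite form. This is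
  why one element \<open>u\<close> can act as a cycle, as a form and as the list of edge slopes of a
  function.

  The number \<open>l\<close> is the length of a circle: for an elliptic curve with generating cycle
  \<open>c\<close> it is the integral of \<open>c\<close> over itself.

  The obstacle is that a cover is given on arbitrary models of both curves, between which slopes on
  edges cannot be compared directly. Germs in tangent directions can be, because a refinement maps
  the directions at a point bijectively to those at its image.

  A function with values in R/lZ is represented by a real function of which only congruences modulo
  \<open>l\<close> are asserted. The representative may jump, but only by multiples of
  \<open>l\<close>; no quotient type is involved, and the continuity of the resulting map to the
  circle is proved separately.\<close>

lemma tropical_curveD:
  assumes "tropical_curve G"
  shows "finite (mverts G)" "finite (medges G)" "mverts G \<noteq> {}"
    and "e \<in> medges G \<Longrightarrow> tail (ograph G) e \<in> mverts G"
    and "e \<in> medges G \<Longrightarrow> head (ograph G) e \<in> mverts G"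
    and "e \<in> medges G \<Longrightarrow> 0 < len G e"
proof -
  interpret fin_digraph "ograph G"
    using assms by (simp add: tropical_curve_def)
  show "finite (mverts G)" "finite (medges G)" by auto
  show "mverts G \<noteq> {}"
    using assms by (auto simp: tropical_curve_def connected_def strongly_connected_def mk_symmetric_def)
  show "e \<in> medges G \<Longrightarrow> tail (ograph G) e \<in> mverts G" "e \<in> medges G \<Longrightarrow> head (ograph G) e \<in> mverts G"
    by auto
  show "e \<in> medges G \<Longrightarrow> 0 < len G e"
    using assms by (simp add: tropical_curve_def)
qed

text \<open>A vertex set that no edge leaves or enters is a union of components, and the vertices
  reachable from \<open>u\<close> form such a set. In this form connectedness is used and verified
  without handling paths.\<close>

lemma connected_iff_cut:
  assumes "wf_digraph G"
  shows "Digraph_Component.connected G \<longleftrightarrow> verts G \<noteq> {} \<and>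
    (\<forall>S. S \<subseteq> verts G \<and> S \<noteq> {} \<and> (\<forall>e\<in>arcs G. tail G e \<in> S \<longleftrightarrow> head G e \<in> S) \<longrightarrow> S = verts G)"
    (is "_ \<longleftrightarrow> _ \<and> ?cut")
proof -
  interpret wf_digraph G by fact
  let ?M = "with_proj (mk_symmetric G)"
  have V: "verts ?M = verts G" by (simp add: mk_symmetric_def)
  have ends: "(x, y) \<in> arcs_ends ?M \<longleftrightarrow>
      (\<exists>e\<in>arcs G. (x, y) = (tail G e, head G e) \<or> (x, y) = (head G e, tail G e))" for x y
    by (auto simp: arcs_ends_conv mk_symmetric_def image_iff)
  have reach_cut: "?cut" if c: "\<forall>u\<in>verts G. \<forall>v\<in>verts G. u \<rightarrow>\<^sup>*\<^bsub>?M\<^esub> v"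
  proof (intro allI impI, elim conjE)
    fix S assume S: "S \<subseteq> verts G" "S \<noteq> {}" "\<forall>e\<in>arcs G. tail G e \<in> S \<longleftrightarrow> head G e \<in> S"
    obtain s where s: "s \<in> S" using S by blast
    have "v \<in> S" if "v \<in> verts G" for v
    proof -
      have "(s, v) \<in> rtrancl_on (verts ?M) (arcs_ends ?M)"
        using c s S(1) that unfolding reachable_def by blast
      then show ?thesis
      proof (induction rule: rtrancl_on_induct)
        case (step y z)
        from step(2) obtain e where "e \<in> arcs G" "(y, z) = (tail G e, head G e) \<or> (y, z) = (head G e, tail G e)"
          unfolding ends by blast
        then show ?case using S(3) step(5) by blast
      qed (use s in auto)
    qed
    then show "S = verts G" using S(1) by blast
  qed
  have cut_reach: "u \<rightarrow>\<^sup>*\<^bsub>?M\<^esub> v" if cut: "?cut" and uv: "u \<in> verts G" "v \<in> verts G" for u v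
  proof -
    define S where "S = {w \<in> verts G. u \<rightarrow>\<^sup>*\<^bsub>?M\<^esub> w}"
    have u: "u \<in> S"
      using uv unfolding S_def unfolding reachable_def V by (simp add: rtrancl_on_refl)
    have "y \<in> S" if "x \<in> S" "(x, y) \<in> arcs_ends ?M" for x y
    proof -
      have "y \<in> verts G" using that(2) unfolding ends by auto
      moreover have "u \<rightarrow>\<^sup>*\<^bsub>?M\<^esub> y"
        using that \<open>y \<in> verts G\<close> unfolding reachable_def V S_def mem_Collect_eq
        by (blast intro: rtrancl_on_into_rtrancl_on)
      ultimately show ?thesis by (simp add: S_def)
    qed
    note step = this
    have "(tail G e, head G e) \<in> arcs_ends ?M" "(head G e, tail G e) \<in> arcs_ends ?M" if "e \<in> arcs G" for e
      unfolding ends using that by auto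
    then have "\<forall>e\<in>arcs G. tail G e \<in> S \<longleftrightarrow> head G e \<in> S"
      using step by (intro ballI iffI) (use step in \<open>blast+\<close>)
    moreover have "S \<subseteq> verts G" by (auto simp: S_def)
    ultimately have "S = verts G" using cut u by blast
    then show ?thesis using uv unfolding S_def by blast
  qed
  have "(\<forall>u\<in>verts G. \<forall>v\<in>verts G. u \<rightarrow>\<^sup>*\<^bsub>?M\<^esub> v) \<longleftrightarrow> ?cut"
    by (intro iffI ballI) (fact reach_cut, fact cut_reach)
  then show ?thesis
    unfolding connected_def strongly_connected_def V by (simp only:)
qed

lemma tropical_curve_cut:
  assumes "tropical_curve G" "S \<subseteq> mverts G" "S \<noteq> {}"
    and "\<And>e. e \<in> medges G \<Longrightarrow> tail (ograph G) e \<in> S \<longleftrightarrow> head (ograph G) e \<in> S"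
  shows "S = mverts G"
proof -
  have "wf_digraph (ograph G)"
    using assms(1) by (simp add: tropical_curve_def fin_digraph.axioms)
  from connected_iff_cut[OF this] assms show ?thesis
    by (auto simp: tropical_curve_def)
qed

lemma frag_extend_finite:
  assumes "finite A" "Poly_Mapping.keys c \<subseteq> A"
  shows "frag_extend b c = (\<Sum>e\<in>A. frag_cmul (Poly_Mapping.lookup c e) (b e))"
  unfolding frag_extend_def
  by (rule sum.mono_neutral_left) (use assms in \<open>auto simp: in_keys_iff\<close>)

lemma lookup_boundary:
  assumes "tropical_curve G" "Poly_Mapping.keys c \<subseteq> medges G"
  shows "Poly_Mapping.lookup (boundary G c) v =
    (\<Sum>e\<in>{e\<in>medges G. head (ograph G) e = v}. Poly_Mapping.lookup c e) -
    (\<Sum>e\<in>{e\<in>medges G. tail (ograph G) e = v}. Poly_Mapping.lookup c e)"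
proof -
  have fin: "finite (medges G)" using tropical_curveD[OF assms(1)] by blast
  have "Poly_Mapping.lookup (boundary G c) v =
    (\<Sum>e\<in>medges G. (if head (ograph G) e = v then Poly_Mapping.lookup c e else 0) -
       (if tail (ograph G) e = v then Poly_Mapping.lookup c e else 0))"
    unfolding boundary_def frag_extend_finite[OF fin assms(2)] lookup_sum
    by (intro sum.cong) (auto simp: lookup_minus)
  then show ?thesis
    by (simp add: sum_subtractf sum.If_cases[OF fin] Int_def)
qed

definition cycles :: "('v, 'e) metric_graph \<Rightarrow> ('e \<Rightarrow>\<^sub>0 int) set" where
  "cycles G = {c. Poly_Mapping.keys c \<subseteq> medges G \<and> boundary G c = 0}"

lemma first_homology_eq: "first_homology G = free_Abelian_group (medges G) \<lparr> carrier := cycles G \<rparr>"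
  by (simp add: first_homology_def cycles_def)

text \<open>The coefficient of the boundary at a vertex is inflow minus outflow. This identifies the
  lattice of harmonic forms with the lattice of cycles.\<close>

lemma cycles_iff_balanced:
  assumes "tropical_curve G"
  shows "c \<in> cycles G \<longleftrightarrow> Poly_Mapping.keys c \<subseteq> medges G \<and> (\<forall>v\<in>mverts G.
        (\<Sum>e\<in>{e\<in>medges G. head (ograph G) e = v}. Poly_Mapping.lookup c e) =
        (\<Sum>e\<in>{e\<in>medges G. tail (ograph G) e = v}. Poly_Mapping.lookup c e))" (is "_ \<longleftrightarrow> ?k \<and> ?b")
proof -
  have "boundary G c = 0 \<longleftrightarrow> ?b" if k: ?k
  proof
    assume 0: "boundary G c = 0"
    show ?b
    proof
      fix v
      show "(\<Sum>e\<in>{e\<in>medges G. head (ograph G) e = v}. Poly_Mapping.lookup c e) =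
        (\<Sum>e\<in>{e\<in>medges G. tail (ograph G) e = v}. Poly_Mapping.lookup c e)"
        using lookup_boundary[OF assms k, of v] unfolding 0 by simp
    qed
  next
    assume b: ?b
    have "Poly_Mapping.lookup (boundary G c) v = 0" for v
    proof (cases "v \<in> mverts G")
      case False
      then have "{e\<in>medges G. head (ograph G) e = v} = {}" "{e\<in>medges G. tail (ograph G) e = v} = {}"
        using tropical_curveD[OF assms] by blast+
      then show ?thesis by (simp only: lookup_boundary[OF assms k] sum.empty diff_self)
    qed (use b in \<open>simp add: lookup_boundary[OF assms k]\<close>)
    then show "boundary G c = 0" by (simp add: poly_mapping_eqI)
  qed
  then show ?thesis unfolding cycles_def by blast
qed

lemma harmonic_forms_eq:
  assumes "tropical_curve G"
  shows "harmonic_forms G = free_Abelian_group (medges G) \<lparr> carrier := cycles G \<rparr>"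
proof -
  have "{\<omega> \<in> carrier (free_Abelian_group (medges G)). \<forall>v\<in>mverts G.
        (\<Sum>e\<in>{e\<in>medges G. head (ograph G) e = v}. Poly_Mapping.lookup \<omega> e) =
        (\<Sum>e\<in>{e\<in>medges G. tail (ograph G) e = v}. Poly_Mapping.lookup \<omega> e)} = cycles G"
    by (rule Set.set_eqI) (simp only: cycles_iff_balanced[OF assms] mem_Collect_eq carrier_free_Abelian_group_iff)
  then show ?thesis
    by (simp only: harmonic_forms_def)
qed

lemma cycles_zero [simp]: "0 \<in> cycles G"
  and cycles_add: "c \<in> cycles G \<Longrightarrow> d \<in> cycles G \<Longrightarrow> c + d \<in> cycles G"
  and cycles_diff: "c \<in> cycles G \<Longrightarrow> d \<in> cycles G \<Longrightarrow> c - d \<in> cycles G"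
  and cycles_cmul: "c \<in> cycles G \<Longrightarrow> frag_cmul k c \<in> cycles G"
  using keys_add[of c d] keys_diff[of c d] keys_cmul[of k c]
  by (auto simp: cycles_def boundary_def frag_extend_add frag_extend_diff frag_extend_cmul)

lemma cycles_sum: "(\<And>i. i \<in> I \<Longrightarrow> f i \<in> cycles G) \<Longrightarrow> sum f I \<in> cycles G"
  by (induction I rule: infinite_finite_induct) (auto intro: cycles_add)

text \<open>Summation by parts: the total coefficient of \<open>f v\<close> is the balance of
  \<open>c\<close> at \<open>v\<close>. In other words, exact forms have no periods.\<close>

lemma cycle_stokes:
  fixes f :: "'v \<Rightarrow> real"
  assumes "tropical_curve G" "c \<in> cycles G"
  shows "(\<Sum>e\<in>medges G. of_int (Poly_Mapping.lookup c e) * (f (head (ograph G) e) - f (tail (ograph G) e))) = 0"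
proof -
  note D = tropical_curveD[OF assms(1)]
  have *: "(\<Sum>e\<in>medges G. of_int (Poly_Mapping.lookup c e) * f (h e)) =
      (\<Sum>v\<in>mverts G. f v * of_int (\<Sum>e\<in>{e\<in>medges G. h e = v}. Poly_Mapping.lookup c e))"
    if "h ` medges G \<subseteq> mverts G" for h
  proof -
    have "(\<Sum>e\<in>medges G. of_int (Poly_Mapping.lookup c e) * f (h e)) =
       (\<Sum>v\<in>mverts G. \<Sum>e\<in>{e\<in>medges G. h e = v}. of_int (Poly_Mapping.lookup c e) * f (h e))"
      by (rule sum.group[symmetric]) (use D that in auto)
    also have "\<dots> = (\<Sum>v\<in>mverts G. f v * of_int (\<Sum>e\<in>{e\<in>medges G. h e = v}. Poly_Mapping.lookup c e))"
      by (intro sum.cong refl) (simp add: sum_distrib_left mult.commute)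
    finally show ?thesis .
  qed
  have "h ` medges G \<subseteq> mverts G" if "h = head (ograph G) \<or> h = tail (ograph G)" for h
    using that D by auto
  then show ?thesis
    using assms(2) by (simp add: right_diff_distrib sum_subtractf * cycles_iff_balanced[OF assms(1)])
qed

text \<open>Grows a tree \<open>T\<close> from a root \<open>r\<close>; \<open>P v\<close> is a path in \<open>T\<close> from \<open>r\<close> to \<open>v\<close>.\<close>

lemma spanning_tree:
  assumes "tropical_curve G"
  obtains T r and P :: "'v \<Rightarrow> 'e \<Rightarrow>\<^sub>0 int" where
    "T \<subseteq> medges (G :: ('v, 'e) metric_graph)" "card T + 1 = card (mverts G)"
    "\<And>c. c \<in> cycles G \<Longrightarrow> Poly_Mapping.keys c \<subseteq> T \<Longrightarrow> c = 0"
    "\<And>v. v \<in> mverts G \<Longrightarrow> Poly_Mapping.keys (P v) \<subseteq> T \<and> boundary G (P v) = frag_of v - frag_of r"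
proof -
  note D = tropical_curveD[OF assms]
  obtain r where r: "r \<in> mverts G" using D(3) by blast
  let ?tl = "tail (ograph G)" and ?hd = "head (ograph G)"
  \<comment> \<open>The invariant of the growth. That \<open>T\<close> has no circuits is stated
    homologically: no nonzero cycle is supported in it.\<close>
  define good where "good = (\<lambda>n S T. S \<subseteq> mverts G \<and> T \<subseteq> medges G \<and> card S = Suc n \<and> card T = n \<and>
      (\<forall>e\<in>T. ?tl e \<in> S \<and> ?hd e \<in> S) \<and>
      (\<forall>c\<in>cycles G. Poly_Mapping.keys c \<subseteq> T \<longrightarrow> c = 0) \<and>
      (\<forall>v\<in>S. \<exists>p. Poly_Mapping.keys p \<subseteq> T \<and> boundary G p = frag_of v - frag_of r))"
  have "\<exists>S T. good n S T" if "n < card (mverts G)" for n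
    using that
  proof (induction n)
    case 0
    have "good 0 {r} {}"
      unfolding good_def using r by (auto intro!: exI[of _ 0] simp: boundary_def)
    then show ?case by blast
  next
    case (Suc n)
    then obtain S T where ST: "good n S T" by auto
    note fS = ST[unfolded good_def]
    from fS have fP: "\<forall>v\<in>S. \<exists>p. Poly_Mapping.keys p \<subseteq> T \<and> boundary G p = frag_of v - frag_of r"
      by (elim conjE)
    have fin: "finite S" "finite T" using fS D by (meson finite_subset)+
    have "S \<noteq> mverts G" using fS Suc.prems by auto
    moreover have "S \<noteq> {}" using fS by auto
    \<comment> \<open>By connectedness some edge has exactly one end in the proper nonempty set
      \<open>S\<close>.\<close>
    ultimately obtain e where e: "e \<in> medges G" "?tl e \<in> S \<longleftrightarrow> ?hd e \<notin> S"
      using tropical_curve_cut[OF assms, of S] fS by blast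
    then have eT: "e \<notin> T" using fS by blast
    \<comment> \<open>The edge is added from its old end \<open>w\<close> to its new end
      \<open>v\<close>; the sign \<open>s\<close> corrects its orientation accordingly.\<close>
    define v w where "v = (if ?tl e \<in> S then ?hd e else ?tl e)" and "w = (if ?tl e \<in> S then ?tl e else ?hd e)"
    define s :: int where "s = (if ?tl e \<in> S then 1 else -1)"
    have vw: "v \<notin> S" "w \<in> S" "v \<in> mverts G" using e D(4,5)[OF e(1)] by (auto simp: v_def w_def)
    have be: "boundary G (frag_cmul s (frag_of e)) = frag_of v - frag_of w"
      by (auto simp: boundary_def frag_extend_cmul s_def v_def w_def simp del: minus_frag_cmul)
    have "good (Suc n) (insert v S) (insert e T)"
      unfolding good_def
    proof (intro conjI ballI impI)
      show "insert v S \<subseteq> mverts G" "insert e T \<subseteq> medges G" using fS vw e by auto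
      show "card (insert v S) = Suc (Suc n)" "card (insert e T) = Suc n"
        using fS fin vw eT by auto
      show "?tl x \<in> insert v S" "?hd x \<in> insert v S" if "x \<in> insert e T" for x
        using that fS e by (auto simp: v_def)
      show "c = 0" if c: "c \<in> cycles G" "Poly_Mapping.keys c \<subseteq> insert e T" for c
      proof -
        have kc: "Poly_Mapping.keys c \<subseteq> medges G" and 0: "boundary G c = 0" using c by (auto simp: cycles_def)
        \<comment> \<open>The new vertex is a leaf: \<open>e\<close> is the only edge of the
          enlarged tree at \<open>v\<close> and is not a loop, so the balance of \<open>c\<close> at
          \<open>v\<close> kills the coefficient of \<open>e\<close>.\<close>
        have z: "Poly_Mapping.lookup c x = 0" if "x \<in> medges G - {e}" "?tl x = v \<or> ?hd x = v" for x
        proof -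
          have "x \<notin> T" using that vw fS by blast
          then have "x \<notin> Poly_Mapping.keys c" using that c(2) by blast
          then show ?thesis by (simp add: in_keys_iff)
        qed
        have sum1: "(\<Sum>x\<in>{x\<in>medges G. h x = v}. Poly_Mapping.lookup c x) = (if h e = v then Poly_Mapping.lookup c e else 0)"
          if h: "h = ?tl \<or> h = ?hd" for h
        proof -
          have "(\<Sum>x\<in>{x\<in>medges G. h x = v}. Poly_Mapping.lookup c x) =
             (\<Sum>x\<in>{x\<in>medges G. h x = v} \<inter> {e}. Poly_Mapping.lookup c x)"
            by (rule sum.mono_neutral_right) (use D z h in auto)
          also have "{x\<in>medges G. h x = v} \<inter> {e} = (if h e = v then {e} else {})" using e by auto
          finally show ?thesis by simp
        qed
        have "(if ?hd e = v then Poly_Mapping.lookup c e else 0) = (if ?tl e = v then Poly_Mapping.lookup c e else 0)"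
          using lookup_boundary[OF assms kc, of v] unfolding 0 by (simp add: sum1)
        moreover have "(?hd e = v) \<noteq> (?tl e = v)" using e by (auto simp: v_def)
        ultimately have "Poly_Mapping.lookup c e = 0" by (auto split: if_splits)
        then have "e \<notin> Poly_Mapping.keys c" by (simp add: in_keys_iff)
        then have "Poly_Mapping.keys c \<subseteq> T" using c(2) by blast
        then show ?thesis using fS c(1) by blast
      qed
      fix x assume "x \<in> insert v S"
      then consider "x = v" | "x \<in> S" by blast
      then show "\<exists>p. Poly_Mapping.keys p \<subseteq> insert e T \<and> boundary G p = frag_of x - frag_of r"
      proof cases
        case 1
        obtain p where p: "Poly_Mapping.keys p \<subseteq> T" "boundary G p = frag_of w - frag_of r"
          using bspec[OF fP vw(2)] by (elim exE conjE)
        have "Poly_Mapping.keys (frag_cmul s (frag_of e) + p) \<subseteq> insert e T"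
          using p(1) keys_add[of "frag_cmul s (frag_of e)" p] keys_cmul[of s "frag_of e"] by (auto simp: keys_frag_of)
        moreover have "boundary G (frag_cmul s (frag_of e) + p) = frag_of x - frag_of r"
          using be p(2) 1 by (simp add: boundary_def frag_extend_add)
        ultimately show ?thesis by (intro exI conjI)
      next
        case 2
        from bspec[OF fP this] obtain p where "Poly_Mapping.keys p \<subseteq> T" "boundary G p = frag_of x - frag_of r"
          by (elim exE conjE)
        then show ?thesis by (intro exI[of _ p] conjI) auto
      qed
    qed
    then show ?case by blast
  qed
  moreover have "0 < card (mverts G)" using D by (simp add: card_gt_0_iff)
  ultimately obtain S T where ST: "good (card (mverts G) - 1) S T" by (meson diff_less zero_less_one)
  then have "card S = card (mverts G)" using \<open>0 < card (mverts G)\<close> by (simp add: good_def)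
  then have S: "S = mverts G" using ST D(1) unfolding good_def by (metis card_subset_eq)
  then obtain P where "\<And>v. v \<in> mverts G \<Longrightarrow> Poly_Mapping.keys (P v) \<subseteq> T \<and> boundary G (P v) = frag_of v - frag_of r"
    using ST unfolding good_def by metis
  then show thesis
    using ST \<open>0 < card (mverts G)\<close> that[of T P r] unfolding good_def by auto
qed

text \<open>\<open>B\<close> consists of the edges outside a spanning tree: a cycle is determined by its restriction to
  them.\<close>

lemma cycle_basis:
  fixes G :: "('v, 'e) metric_graph"
  assumes "tropical_curve G"
  obtains B and \<gamma> :: "'e \<Rightarrow> 'e \<Rightarrow>\<^sub>0 int" where
    "B \<subseteq> medges G" "int (card B) = genus G"
    "\<And>b. b \<in> B \<Longrightarrow> \<gamma> b \<in> cycles G"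
    "\<And>b b'. b \<in> B \<Longrightarrow> b' \<in> B \<Longrightarrow> Poly_Mapping.lookup (\<gamma> b) b' = (if b = b' then 1 else 0)"
    "\<And>c. c \<in> cycles G \<Longrightarrow> (\<And>b. b \<in> B \<Longrightarrow> Poly_Mapping.lookup c b = 0) \<Longrightarrow> c = 0"
proof -
  note D = tropical_curveD[OF assms]
  obtain T r and P :: "'v \<Rightarrow> 'e \<Rightarrow>\<^sub>0 int" where T: "T \<subseteq> medges G" "card T + 1 = card (mverts G)"
    "\<And>c. c \<in> cycles G \<Longrightarrow> Poly_Mapping.keys c \<subseteq> T \<Longrightarrow> c = 0"
    and P: "\<And>v. v \<in> mverts G \<Longrightarrow> Poly_Mapping.keys (P v) \<subseteq> T \<and> boundary G (P v) = frag_of v - frag_of r"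
    using spanning_tree[OF assms] by metis
  define B where "B = medges G - T"
  \<comment> \<open>The fundamental cycle of \<open>b\<close>: the edge closed up by the tree path
    between its ends.\<close>
  define \<gamma> where "\<gamma> = (\<lambda>b. frag_of b - (P (head (ograph G) b) - P (tail (ograph G) b)))"
  have fT: "finite T" using T D by (meson finite_subset)
  have "int (card B) = genus G"
    using T fT card_mono[OF D(2) T(1)] by (simp add: B_def card_Diff_subset genus_def of_nat_diff)
  moreover have kP: "Poly_Mapping.keys (P (head (ograph G) b) - P (tail (ograph G) b)) \<subseteq> T" if "b \<in> B" for b
    using P[OF D(4)[of b]] P[OF D(5)[of b]] that keys_diff[of "P (head (ograph G) b)" "P (tail (ograph G) b)"]
    by (auto simp: B_def)
  moreover have "\<gamma> b \<in> cycles G" if b: "b \<in> B" for b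
  proof -
    have "Poly_Mapping.keys (\<gamma> b) \<subseteq> medges G"
      using keys_diff[of "frag_of b"] kP[OF b] b T(1) unfolding \<gamma>_def B_def by fastforce
    moreover have "boundary G (\<gamma> b) = 0"
      using P D(4,5)[of b] b by (simp add: \<gamma>_def B_def boundary_def frag_extend_diff)
    ultimately show ?thesis by (simp add: cycles_def)
  qed
  moreover have "Poly_Mapping.lookup (\<gamma> b) b' = (if b = b' then 1 else 0)" if "b \<in> B" "b' \<in> B" for b b'
  proof -
    have "b' \<notin> Poly_Mapping.keys (P (head (ograph G) b) - P (tail (ograph G) b))"
      using kP[OF that(1)] that by (auto simp: B_def)
    then have "Poly_Mapping.lookup (P (head (ograph G) b) - P (tail (ograph G) b)) b' = 0"
      by (simp only: in_keys_iff not_not)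
    then show ?thesis unfolding \<gamma>_def lookup_minus[of "frag_of b"] by simp
  qed
  moreover have "c = 0" if "c \<in> cycles G" "\<And>b. b \<in> B \<Longrightarrow> Poly_Mapping.lookup c b = 0" for c
    using T(3)[OF that(1)] that by (auto simp: cycles_def B_def in_keys_iff subset_iff)
  ultimately show thesis using that[of B \<gamma>] by (auto simp: B_def)
qed

section \<open>The Jacobian as an integral torus\<close>

lemma integration_eq:
  assumes "tropical_curve G"
  shows "integration G u c =
    (\<Sum>e\<in>medges G. len G e * of_int (Poly_Mapping.lookup u e) * of_int (Poly_Mapping.lookup c e))"
proof -
  have fin: "finite (medges G)" using tropical_curveD[OF assms] by blast
  show ?thesis
    unfolding integration_def
    by (intro sum.cong refl) (simp add: if_distrib[of "\<lambda>x. _ * x"] sum.delta'[OF fin] cong: if_cong)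
qed

lemma
  assumes "tropical_curve G"
  shows integration_add_left: "integration G (u + v) c = integration G u c + integration G v c"
    and integration_add_right: "integration G u (c + d) = integration G u c + integration G u d"
    and integration_cmul_left: "integration G (frag_cmul k u) c = of_int k * integration G u c"
    and integration_cmul_right: "integration G u (frag_cmul k c) = of_int k * integration G u c"
    and integration_commute: "integration G u c = integration G c u"
  by (simp_all add: integration_eq[OF assms] lookup_add algebra_simps sum.distrib sum_distrib_left)

lemma integration_pos:
  assumes "tropical_curve G" "u \<in> cycles G" "u \<noteq> 0"
  shows "0 < integration G u u"
proof -
  note D = tropical_curveD[OF assms(1)]
  obtain e where e: "Poly_Mapping.lookup u e \<noteq> 0"
    using assms(3) by (metis lookup_zero poly_mapping_eqI)
  then have "e \<in> medges G" using assms(2) by (auto simp: cycles_def in_keys_iff)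
  moreover have "0 \<le> len G x * of_int (Poly_Mapping.lookup u x) * of_int (Poly_Mapping.lookup u x)"
    if "x \<in> medges G" for x
    using D(6)[OF that] by (simp add: mult.assoc)
  moreover have "0 < len G e * of_int (Poly_Mapping.lookup u e) * of_int (Poly_Mapping.lookup u e)"
    using D(6)[OF \<open>e \<in> medges G\<close>] e by (auto simp: mult.assoc zero_less_mult_iff linorder_neq_iff)
  ultimately show ?thesis
    unfolding integration_eq[OF assms(1)] using D(2) by (intro sum_pos2[of _ e]) auto
qed

lemma cycles_comm_group: "comm_group (free_Abelian_group (medges G) \<lparr> carrier := cycles G \<rparr>)"
proof -
  have "subgroup (cycles G) (free_Abelian_group (medges G))"
  proof
    show "cycles G \<subseteq> carrier (free_Abelian_group (medges G))" by (auto simp: cycles_def)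
    show "inv\<^bsub>free_Abelian_group (medges G)\<^esub> x \<in> cycles G" if "x \<in> cycles G" for x
      using that cycles_cmul[of x G "-1"] by (simp add: cycles_def)
  qed (auto intro: cycles_add)
  then have "group (free_Abelian_group (medges G) \<lparr> carrier := cycles G \<rparr>)"
    by (rule group.subgroup_imp_group[OF group_free_Abelian_group])
  then show ?thesis
    by (rule group.group_comm_groupI) (simp add: add.commute)
qed

text \<open>Fundamental cycles form a basis of both lattices. Their Gram matrix is symmetric, so the
  two halves of non-degeneracy coincide, and positive definiteness over the reals gives one of
  them.\<close>

lemma integral_torus_Jac:
  fixes G :: "('v, 'e) metric_graph"
  assumes "tropical_curve G"
  shows "integral_torus (Jac G)"
proof -
  note D = tropical_curveD[OF assms]
  obtain B and \<gamma> :: "'e \<Rightarrow> 'e \<Rightarrow>\<^sub>0 int" where B: "B \<subseteq> medges G" "int (card B) = genus G"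
    "\<And>b. b \<in> B \<Longrightarrow> \<gamma> b \<in> cycles G"
    "\<And>b b'. b \<in> B \<Longrightarrow> b' \<in> B \<Longrightarrow> Poly_Mapping.lookup (\<gamma> b) b' = (if b = b' then 1 else 0)"
    "\<And>c. c \<in> cycles G \<Longrightarrow> (\<And>b. b \<in> B \<Longrightarrow> Poly_Mapping.lookup c b = 0) \<Longrightarrow> c = 0"
    using cycle_basis[OF assms] by metis
  define n where "n = card B"
  have "finite B" using B(1) D(2) finite_subset by blast
  then obtain enum where "bij_betw enum {0..<n} B"
    using ex_bij_betw_nat_finite n_def by blast
  then have enum: "bij_betw enum {..<n} B" by (simp add: atLeast0LessThan)
  then have eB: "enum i \<in> B" if "i < n" for i using that by (auto simp: bij_betw_def)
  have einj: "enum i = enum j \<longleftrightarrow> i = j" if "i < n" "j < n" for i j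
    using enum that by (auto simp: bij_betw_def inj_on_def)
  let ?H = "free_Abelian_group (medges G) \<lparr> carrier := cycles G \<rparr>"
  define f where "f = frag_extend (\<lambda>i. \<gamma> (enum i))"
  have f_eq: "f x = (\<Sum>i<n. frag_cmul (Poly_Mapping.lookup x i) (\<gamma> (enum i)))" if "Poly_Mapping.keys x \<subseteq> {..<n}" for x
    unfolding f_def using that by (rule frag_extend_finite[rotated]) simp
  have f_cyc: "f x \<in> cycles G" if "Poly_Mapping.keys x \<subseteq> {..<n}" for x
    unfolding f_eq[OF that] using B(3) eB by (intro cycles_sum cycles_cmul) auto
  have f_lookup: "Poly_Mapping.lookup (f x) (enum j) = Poly_Mapping.lookup x j"
    if "Poly_Mapping.keys x \<subseteq> {..<n}" "j < n" for x j
  proof -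
    have "Poly_Mapping.lookup (f x) (enum j) = (\<Sum>i<n. if i = j then Poly_Mapping.lookup x i else 0)"
      unfolding f_eq[OF that(1)] lookup_sum by (intro sum.cong refl) (use that(2) in \<open>simp add: B(4) eB einj\<close>)
    also have "\<dots> = Poly_Mapping.lookup x j" using that(2) by simp
    finally show ?thesis .
  qed
  have f_iso: "f \<in> iso (free_Abelian_group {..<n}) ?H"
  proof (rule isoI)
    show "f \<in> hom (free_Abelian_group {..<n}) ?H"
      using f_cyc by (auto simp: hom_def f_def frag_extend_add)
    show "bij_betw f (carrier (free_Abelian_group {..<n})) (carrier ?H)"
    proof (rule bij_betw_imageI)
      show "inj_on f (carrier (free_Abelian_group {..<n}))"
      proof (rule inj_onI)
        fix x y assume xy: "x \<in> carrier (free_Abelian_group {..<n})" "y \<in> carrier (free_Abelian_group {..<n})" "f x = f y"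
        have "Poly_Mapping.lookup x j = Poly_Mapping.lookup y j" for j
        proof (cases "j < n")
          case True
          then show ?thesis using f_lookup[of x j] f_lookup[of y j] xy by simp
        next
          case False
          then have "j \<notin> Poly_Mapping.keys x" "j \<notin> Poly_Mapping.keys y" using xy(1,2) by auto
          then show ?thesis by (simp add: in_keys_iff)
        qed
        then show "x = y" by (rule poly_mapping_eqI)
      qed
      have "c \<in> f ` carrier (free_Abelian_group {..<n})" if c: "c \<in> cycles G" for c
      proof
        \<comment> \<open>Coefficients outside the tree determine a cycle, so they are the
          coordinates of \<open>c\<close>.\<close>
        define x where "x = (\<Sum>i<n. frag_cmul (Poly_Mapping.lookup c (enum i)) (frag_of i))"
        have kx: "Poly_Mapping.keys x \<subseteq> {..<n}"
          using sum_closed_free_Abelian_group[of "{..<n}" "\<lambda>i. frag_cmul (Poly_Mapping.lookup c (enum i)) (frag_of i)" "{..<n}"]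
            keys_cmul by (fastforce simp: x_def keys_frag_of)
        then show "x \<in> carrier (free_Abelian_group {..<n})" by simp
        have "Poly_Mapping.lookup x j = Poly_Mapping.lookup c (enum j)" if "j < n" for j
          unfolding x_def lookup_sum using that by (simp add: if_distrib[of "\<lambda>z. _ * z"] cong: if_cong)
        then have "Poly_Mapping.lookup (c - f x) b = 0" if "b \<in> B" for b
          using that enum f_lookup[OF kx] by (auto simp: bij_betw_def lookup_minus)
        then have "c - f x = 0" using B(5) cycles_diff[OF c f_cyc[OF kx]] by blast
        then show "c = f x" by simp
      qed
      then show "f ` carrier (free_Abelian_group {..<n}) = carrier ?H" using f_cyc by auto
    qed
  qed
  have f1: "f (frag_of i) = \<gamma> (enum i)" for i by (simp add: f_def)
  define P where "P = (\<lambda>i j. integration G (\<gamma> (enum i)) (\<gamma> (enum j)))"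
  have posdef: "x i = 0" if z: "\<forall>j<n. (\<Sum>i<n. x i * P i j) = 0" and i: "i < n" for x :: "nat \<Rightarrow> real" and i
  proof -
    \<comment> \<open>\<open>?S e\<close> is the coefficient at \<open>e\<close> of the real cycle
      with coordinates \<open>x\<close>; the Gram form at \<open>x\<close> is the sum of the squares
      of these coefficients, weighted by length.\<close>
    let ?S = "\<lambda>e. \<Sum>i<n. x i * of_int (Poly_Mapping.lookup (\<gamma> (enum i)) e)"
    have "0 = (\<Sum>j<n. x j * (\<Sum>i<n. x i * P i j))" using z by simp
    also have "\<dots> = (\<Sum>j<n. \<Sum>i<n. \<Sum>e\<in>medges G. len G e * ((x i * of_int (Poly_Mapping.lookup (\<gamma> (enum i)) e)) *
        (x j * of_int (Poly_Mapping.lookup (\<gamma> (enum j)) e))))"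
      unfolding P_def integration_eq[OF assms] sum_distrib_left by (intro sum.cong refl) (simp add: mult_ac)
    also have "\<dots> = (\<Sum>j<n. \<Sum>e\<in>medges G. \<Sum>i<n. len G e * ((x i * of_int (Poly_Mapping.lookup (\<gamma> (enum i)) e)) *
        (x j * of_int (Poly_Mapping.lookup (\<gamma> (enum j)) e))))"
      by (intro sum.cong refl sum.swap)
    also have "\<dots> = (\<Sum>e\<in>medges G. \<Sum>j<n. \<Sum>i<n. len G e * ((x i * of_int (Poly_Mapping.lookup (\<gamma> (enum i)) e)) *
        (x j * of_int (Poly_Mapping.lookup (\<gamma> (enum j)) e))))"
      by (rule sum.swap)
    also have "\<dots> = (\<Sum>e\<in>medges G. len G e * (?S e * ?S e))"
      by (intro sum.cong refl) (simp only: sum_distrib_left sum_distrib_right)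
    finally have "(\<Sum>e\<in>medges G. len G e * (?S e * ?S e)) = 0" by simp
    then have "\<forall>e\<in>medges G. len G e * (?S e * ?S e) = 0"
      using D(2) less_imp_le[OF D(6)] by (subst (asm) sum_nonneg_eq_0_iff) auto
    then have "len G (enum i) * (?S (enum i) * ?S (enum i)) = 0" using eB[OF i] B(1) by blast
    moreover have "0 < len G (enum i)" using eB[OF i] B(1) D(6) by blast
    ultimately have "?S (enum i) = 0" by simp
    \<comment> \<open>The edge \<open>enum i\<close> lies outside the tree and occurs in only one
      basis cycle, so the coefficient there is the coordinate itself.\<close>
    moreover have "?S (enum i) = (\<Sum>k<n. if k = i then x k else 0)"
      using i by (intro sum.cong refl) (simp add: B(4) eB einj)
    ultimately show ?thesis using i by simp
  qed
  have "P i j = P j i" for i j by (simp add: P_def integration_commute[OF assms])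
  then have "nondegenerate n P"
    unfolding nondegenerate_def using posdef by (auto simp: mult.commute)
  then show ?thesis
    unfolding integral_torus_def Jac_def torus.simps first_homology_eq harmonic_forms_eq[OF assms]
    using cycles_comm_group f_iso
    by (auto simp: integration_add_left[OF assms] integration_add_right[OF assms] P_def f1
        intro!: exI[of _ n] bexI[of _ f])
qed

section \<open>Splitting of the Jacobian\<close>

text \<open>On the index type \<^typ>\<open>nat\<close> this rule would rewrite \<open>frag_of 0\<close> to \<open>1\<close>.\<close>

declare single_one [simp del]

definition integral_cycle :: "real \<Rightarrow> ('v, 'e) metric_graph \<Rightarrow> ('e \<Rightarrow>\<^sub>0 int) \<Rightarrow> bool" where
  "integral_cycle l G u \<longleftrightarrow> u \<in> cycles G \<and> (\<forall>c\<in>cycles G. \<exists>n::int. integration G u c = of_int n * l)"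

definition loop_graph :: "real \<Rightarrow> (nat, nat) metric_graph" where
  "loop_graph l = \<lparr> ograph = \<lparr> verts = {0}, arcs = {0}, tail = (\<lambda>_. 0), head = (\<lambda>_. 0) \<rparr>, len = (\<lambda>_. l) \<rparr>"

lemma loop_graph_simps [simp]:
  "mverts (loop_graph l) = {0}" "medges (loop_graph l) = {0}" "len (loop_graph l) e = l"
  "tail (ograph (loop_graph l)) e = 0" "head (ograph (loop_graph l)) e = 0"
  by (simp_all add: loop_graph_def)

lemma tropical_curve_loop_graph:
  assumes "0 < l"
  shows "tropical_curve (loop_graph l)"
proof -
  have "fin_digraph (ograph (loop_graph l))"
    by unfold_locales auto
  moreover from this have "wf_digraph (ograph (loop_graph l))" by (rule fin_digraph.axioms)
  then have "Digraph_Component.connected (ograph (loop_graph l))"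
    by (subst connected_iff_cut) auto
  ultimately show ?thesis
    using assms by (simp add: tropical_curve_def)
qed

lemma tropical_elliptic_curve_loop_graph: "0 < l \<Longrightarrow> tropical_elliptic_curve (loop_graph l)"
  by (simp add: tropical_elliptic_curve_def tropical_curve_loop_graph genus_def)

lemma cycles_loop_graph: "cycles (loop_graph l) = {c. Poly_Mapping.keys c \<subseteq> {0}}"
  by (auto simp: cycles_def boundary_def frag_extend_def)

lemma integration_loop_graph:
  "0 < l \<Longrightarrow> integration (loop_graph l) u c = l * of_int (Poly_Mapping.lookup u 0) * of_int (Poly_Mapping.lookup c 0)"
  by (simp add: integration_eq tropical_curve_loop_graph)

lemma keys_subset_singleton_eq:
  assumes "Poly_Mapping.keys c \<subseteq> {a}" "Poly_Mapping.keys d \<subseteq> {a}"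
  shows "c = d \<longleftrightarrow> Poly_Mapping.lookup c a = Poly_Mapping.lookup d a"
proof -
  have "Poly_Mapping.lookup c x = Poly_Mapping.lookup d x" if "x \<noteq> a" for x
    using assms that by (metis in_keys_iff singletonD subsetD)
  then show ?thesis by (metis poly_mapping_eqI)
qed

lemma frag_cmul_lookup_singleton:
  assumes "Poly_Mapping.keys c \<subseteq> {a}"
  shows "frag_cmul (Poly_Mapping.lookup c a) (frag_of a) = c"
  using assms by (subst keys_subset_singleton_eq[of _ a]) (auto simp: keys_frag_of)

lemma cycle_basis_rank1:
  assumes "tropical_curve E" "genus E = 1"
  obtains c where "c \<in> cycles E" "c \<noteq> 0" "\<And>d. d \<in> cycles E \<Longrightarrow> \<exists>k. d = frag_cmul k c"
proof -
  obtain B \<gamma> where B: "B \<subseteq> medges E" "int (card B) = genus E"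
    "\<And>b. b \<in> B \<Longrightarrow> \<gamma> b \<in> cycles E"
    "\<And>b b'. b \<in> B \<Longrightarrow> b' \<in> B \<Longrightarrow> Poly_Mapping.lookup (\<gamma> b) b' = (if b = b' then 1 else 0)"
    "\<And>c. c \<in> cycles E \<Longrightarrow> (\<And>b. b \<in> B \<Longrightarrow> Poly_Mapping.lookup c b = 0) \<Longrightarrow> c = 0"
    using cycle_basis[OF assms(1)] by metis
  have "card B = 1" using B(2) assms(2) by simp
  then obtain b where b: "B = {b}" by (auto simp: card_1_singleton_iff)
  have "\<gamma> b \<noteq> 0" using B(4)[of b b] b by auto
  moreover have "d = frag_cmul (Poly_Mapping.lookup d b) (\<gamma> b)" if "d \<in> cycles E" for d
  proof -
    have "d - frag_cmul (Poly_Mapping.lookup d b) (\<gamma> b) \<in> cycles E"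
      using that B(3) b by (intro cycles_diff cycles_cmul) auto
    then have "d - frag_cmul (Poly_Mapping.lookup d b) (\<gamma> b) = 0"
      by (rule B(5)) (use B(4)[of b b] b in \<open>auto simp: lookup_minus\<close>)
    then show ?thesis by simp
  qed
  ultimately show thesis using that[of "\<gamma> b"] B(3) b by blast
qed

lemma cycle_basis_rank2:
  assumes "tropical_curve G" "genus G = 2"
  obtains a b \<alpha> \<beta> where "\<alpha> \<in> cycles G" "\<beta> \<in> cycles G"
    "Poly_Mapping.lookup \<alpha> a = 1" "Poly_Mapping.lookup \<alpha> b = 0"
    "Poly_Mapping.lookup \<beta> a = 0" "Poly_Mapping.lookup \<beta> b = 1"
    "\<And>d. d \<in> cycles G \<Longrightarrow> d = frag_cmul (Poly_Mapping.lookup d a) \<alpha> + frag_cmul (Poly_Mapping.lookup d b) \<beta>"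
proof -
  obtain B \<gamma> where B: "B \<subseteq> medges G" "int (card B) = genus G"
    "\<And>b. b \<in> B \<Longrightarrow> \<gamma> b \<in> cycles G"
    "\<And>b b'. b \<in> B \<Longrightarrow> b' \<in> B \<Longrightarrow> Poly_Mapping.lookup (\<gamma> b) b' = (if b = b' then 1 else 0)"
    "\<And>c. c \<in> cycles G \<Longrightarrow> (\<And>b. b \<in> B \<Longrightarrow> Poly_Mapping.lookup c b = 0) \<Longrightarrow> c = 0"
    using cycle_basis[OF assms(1)] by metis
  have "card B = 2" using B(2) assms(2) by simp
  then obtain a b where b: "B = {a, b}" "a \<noteq> b" by (auto simp: card_2_iff)
  have l: "Poly_Mapping.lookup (\<gamma> a) a = 1" "Poly_Mapping.lookup (\<gamma> a) b = 0"
    "Poly_Mapping.lookup (\<gamma> b) a = 0" "Poly_Mapping.lookup (\<gamma> b) b = 1"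
    using B(4) b by auto
  have "d = frag_cmul (Poly_Mapping.lookup d a) (\<gamma> a) + frag_cmul (Poly_Mapping.lookup d b) (\<gamma> b)" (is "d = ?e")
    if "d \<in> cycles G" for d
  proof -
    have "d - ?e \<in> cycles G"
      using that B(3) b by (intro cycles_diff cycles_add cycles_cmul) auto
    then have "d - ?e = 0"
      by (rule B(5)) (use b(1) l in \<open>auto simp: lookup_minus lookup_add\<close>)
    then show ?thesis by simp
  qed
  then show thesis using that[of "\<gamma> a" "\<gamma> b" a b] l B(3) b by blast
qed

text \<open>Adjointness turns periods of \<open>f (c, 0)\<close> on \<open>G\<close> into periods of
  \<open>c\<close> on \<open>E\<close>, and these are multiples of the integral of \<open>c\<close>
  over itself because \<open>c\<close> generates the cycles of \<open>E\<close>. Injectivity of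
  \<open>f\<close> keeps the cycle nonzero.\<close>

lemma splits_imp_integral_cycle:
  assumes G: "tropical_curve G" and "jacobian_splits G"
  obtains l u where "0 < l" "integral_cycle l G u" "u \<noteq> 0"
proof -
  obtain E E' :: "(nat, nat) metric_graph" and f g where
    E: "tropical_elliptic_curve E" and iso: "isogeny (Jac G) (torus_coprod (Jac E) (Jac E')) (f, g)"
    using assms(2) unfolding jacobian_splits_def isogenous_def by (metis surj_pair)
  have tE: "tropical_curve E" "genus E = 1" using E by (auto simp: tropical_elliptic_curve_def)
  obtain c where c: "c \<in> cycles E" "c \<noteq> 0" "\<And>d. d \<in> cycles E \<Longrightarrow> \<exists>k. d = frag_cmul k c"
    using cycle_basis_rank1[OF tE] by metis
  let ?T = "torus_coprod (Jac E) (Jac E')"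
  have mor: "torus_morphism (Jac G) ?T (f, g)" and inj: "inj_on f (carrier (Lam ?T))"
    using iso by (auto simp: isogeny_def surjective_morphism_def)
  have LG: "Lam (Jac G) = free_Abelian_group (medges G) \<lparr> carrier := cycles G \<rparr>"
    "Lam' (Jac G) = free_Abelian_group (medges G) \<lparr> carrier := cycles G \<rparr>"
    by (simp_all add: Jac_def harmonic_forms_eq[OF G] first_homology_eq)
  have z: "0 \<in> carrier (harmonic_forms E')" by (simp add: harmonic_forms_def)
  have cT: "(c, 0) \<in> carrier (Lam ?T)" "(0, 0) \<in> carrier (Lam ?T)"
    using c(1) z by (auto simp: torus_coprod_def Jac_def harmonic_forms_eq[OF tE(1)])
  have hom: "f \<in> hom (Lam ?T) (Lam (Jac G))" "g \<in> hom (Lam' (Jac G)) (Lam' ?T)"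
    and adj: "\<And>x y. x \<in> carrier (Lam ?T) \<Longrightarrow> y \<in> cycles G \<Longrightarrow> integration G (f x) y = pairing ?T x (g y)"
    using mor by (auto simp: torus_morphism_def LG) (simp add: Jac_def)
  have f0: "f (0, 0) = 0"
  proof -
    have "f ((0, 0) \<otimes>\<^bsub>Lam ?T\<^esub> (0, 0)) = f (0, 0) \<otimes>\<^bsub>Lam (Jac G)\<^esub> f (0, 0)"
      using hom(1) cT(2) by (simp add: hom_def)
    then show ?thesis by (simp add: torus_coprod_def LG) (simp add: Jac_def harmonic_forms_def DirProd_def)
  qed
  define u where "u = f (c, 0)"
  have u: "u \<in> cycles G" using hom(1) cT(1) by (auto simp: hom_def LG u_def)
  have "u \<noteq> 0" using inj cT f0 c(2) by (metis inj_onD prod.inject u_def)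
  define l where "l = integration E c c"
  have "0 < l" unfolding l_def using integration_pos[OF tE(1) c(1,2)] .
  moreover have "\<exists>n::int. integration G u y = of_int n * l" if y: "y \<in> cycles G" for y
  proof -
    have "g y \<in> carrier (Lam' ?T)" using hom(2) y by (auto simp: hom_def LG)
    then have "fst (g y) \<in> cycles E"
      by (auto simp: torus_coprod_def Jac_def first_homology_eq)
    then obtain k where k: "fst (g y) = frag_cmul k c" using c(3) by blast
    have "integration G u y = integration E c (fst (g y)) + integration E' 0 (snd (g y))"
      unfolding u_def adj[OF cT(1) y] by (simp add: torus_coprod_def Jac_def case_prod_beta)
    also have "\<dots> = of_int k * l"
      unfolding k integration_cmul_right[OF tE(1)] l_def by (simp add: integration_def)
    finally show ?thesis by blast
  qed
  ultimately show thesis using that[of l u] u \<open>u \<noteq> 0\<close> by (simp add: integral_cycle_def)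
qed

lemma integral_torus_coprod_loop_graphs:
  assumes "0 < l" "0 < l'"
  shows "integral_torus (torus_coprod (Jac (loop_graph l)) (Jac (loop_graph l')))" (is "integral_torus ?T")
proof -
  let ?L = "free_Abelian_group {0::nat}"
  have L: "free_Abelian_group {0} \<lparr> carrier := cycles (loop_graph k) \<rparr> = ?L" for k
    by (simp add: cycles_loop_graph free_Abelian_group_def)
  have Lam: "Lam ?T = ?L \<times>\<times> ?L" "Lam' ?T = ?L \<times>\<times> ?L"
    using assms by (simp_all add: torus_coprod_def Jac_def harmonic_forms_eq first_homology_eq tropical_curve_loop_graph L)
  have pair: "pairing ?T x y = l * of_int (Poly_Mapping.lookup (fst x) 0) * of_int (Poly_Mapping.lookup (fst y) 0)
      + l' * of_int (Poly_Mapping.lookup (snd x) 0) * of_int (Poly_Mapping.lookup (snd y) 0)" for x y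
    using assms by (simp add: torus_coprod_def Jac_def integration_loop_graph case_prod_beta)
  define f :: "(nat \<Rightarrow>\<^sub>0 int) \<Rightarrow> (nat \<Rightarrow>\<^sub>0 int) \<times> (nat \<Rightarrow>\<^sub>0 int)" where
    "f = (\<lambda>x. (frag_cmul (Poly_Mapping.lookup x 0) (frag_of 0), frag_cmul (Poly_Mapping.lookup x 1) (frag_of 0)))"
  have "f \<in> iso (free_Abelian_group {..<2}) (?L \<times>\<times> ?L)"
  proof (rule isoI)
    show "f \<in> hom (free_Abelian_group {..<2}) (?L \<times>\<times> ?L)"
      by (auto simp: hom_def f_def lookup_add frag_cmul_distrib keys_frag_of)
    show "bij_betw f (carrier (free_Abelian_group {..<2})) (carrier (?L \<times>\<times> ?L))"
    proof (rule bij_betw_byWitness[where f' = "\<lambda>(a, b). frag_cmul (Poly_Mapping.lookup a 0) (frag_of 0) + frag_cmul (Poly_Mapping.lookup b 0) (frag_of 1)"], goal_cases)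
      case 1
      have "Poly_Mapping.lookup x i = 0" if "Poly_Mapping.keys x \<subseteq> {..<2}" "i \<noteq> 0" "i \<noteq> 1" for x :: "nat \<Rightarrow>\<^sub>0 int" and i
      proof -
        have "i \<notin> Poly_Mapping.keys x" using that by auto
        then show ?thesis by (simp add: in_keys_iff)
      qed
      then show ?case by (auto simp: f_def lookup_add intro!: poly_mapping_eqI)
    next
      case 2
      have "Poly_Mapping.lookup x (Suc 0) = 0" if "Poly_Mapping.keys x \<subseteq> {0}" for x :: "nat \<Rightarrow>\<^sub>0 int"
      proof -
        have "Suc 0 \<notin> Poly_Mapping.keys x" using that by auto
        then show ?thesis by (simp add: in_keys_iff)
      qed
      then show ?case
        by (auto simp: f_def lookup_add frag_cmul_lookup_singleton)
    next
      case 3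
      show ?case by (auto simp: f_def keys_frag_of)
    next
      case 4
      show ?case
        by (auto simp: keys_frag_of dest!: subsetD[OF keys_add])
    qed
  qed
  \<comment> \<open>In these bases the Gram matrix is diagonal with entries \<open>l\<close> and
    \<open>l'\<close>.\<close>
  moreover have "nondegenerate 2 (\<lambda>i j. pairing ?T (f (frag_of i)) (f (frag_of j)))"
    using assms by (auto simp: nondegenerate_def pair f_def numeral_2_eq_2 less_Suc_eq)
  moreover have "comm_group (?L \<times>\<times> ?L)"
  proof (rule group.group_comm_groupI)
    show "group (?L \<times>\<times> ?L)" by (simp add: DirProd_group)
  qed (auto simp: add.commute)
  ultimately show ?thesis
    unfolding integral_torus_def Lam pair
    by (auto simp: lookup_add algebra_simps intro!: exI[of _ 2] bexI[of _ f])
qed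

text \<open>The cycles \<open>u\<close> and \<open>w\<close> span a sublattice of finite index, and
  \<open>f\<close> sends the two generators to them. Its adjoint \<open>g\<close> must record the
  periods of a cycle against \<open>u\<close> and \<open>w\<close>, in units of \<open>l\<close> and
  \<open>l'\<close>. Both maps are injective because the index \<open>D\<close> is not zero.\<close>

lemma integral_cycle_imp_splits:
  fixes G :: "('v, 'e) metric_graph"
  assumes G: "tropical_curve G" "genus G = 2" and l: "0 < l" and u: "integral_cycle l G u" "u \<noteq> 0"
  shows "jacobian_splits G"
proof -
  obtain a b and \<alpha> \<beta> :: "'e \<Rightarrow>\<^sub>0 int" where cyc: "\<alpha> \<in> cycles G" "\<beta> \<in> cycles G"
    and lk: "Poly_Mapping.lookup \<alpha> a = 1" "Poly_Mapping.lookup \<alpha> b = 0"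
    "Poly_Mapping.lookup \<beta> a = 0" "Poly_Mapping.lookup \<beta> b = 1"
    and rep: "\<And>d. d \<in> cycles G \<Longrightarrow> d = frag_cmul (Poly_Mapping.lookup d a) \<alpha> + frag_cmul (Poly_Mapping.lookup d b) \<beta>"
    using cycle_basis_rank2[OF G] by metis
  have uc: "u \<in> cycles G" using u by (simp add: integral_cycle_def)
  obtain p q :: int where pq: "integration G u \<alpha> = of_int p * l" "integration G u \<beta> = of_int q * l"
    using u(1) cyc unfolding integral_cycle_def by meson
  define c :: "('e \<Rightarrow>\<^sub>0 int) \<Rightarrow> int" where "c = (\<lambda>y. Poly_Mapping.lookup y a)"
  define d :: "('e \<Rightarrow>\<^sub>0 int) \<Rightarrow> int" where "d = (\<lambda>y. Poly_Mapping.lookup y b)"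
  have rep: "y = frag_cmul (c y) \<alpha> + frag_cmul (d y) \<beta>" if "y \<in> cycles G" for y
    using rep[OF that] by (simp add: c_def d_def)
  have lin: "c (x + y) = c x + c y" "d (x + y) = d x + d y" "c (frag_cmul k x) = k * c x" "d (frag_cmul k x) = k * d x" for x y k
    by (simp_all add: c_def d_def lookup_add)
  have Qu: "integration G u y = of_int (c y * p + d y * q) * l" if "y \<in> cycles G" for y
    by (subst rep[OF that]) (simp add: integration_add_right[OF G(1)] integration_cmul_right[OF G(1)] pq algebra_simps)
  \<comment> \<open>\<open>w\<close> spans the orthogonal complement of \<open>u\<close>.\<close>
  define w where "w = frag_cmul q \<alpha> + frag_cmul (- p) \<beta>"
  have wc: "w \<in> cycles G" unfolding w_def using cyc by (intro cycles_add cycles_cmul)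
  have cw: "c w = q" "d w = - p" by (simp_all add: c_def d_def w_def lookup_add lk)
  have Quw: "integration G u w = 0" using Qu[OF wc] by (simp add: cw)
  \<comment> \<open>Up to sign the determinant of \<open>u\<close>, \<open>w\<close> in the basis
    \<open>\<alpha>\<close>, \<open>\<beta>\<close>. It is also the integral of \<open>u\<close>
    over itself in units of \<open>l\<close>, hence positive.\<close>
  define D where "D = c u * p + d u * q"
  have "0 < of_int D * l" using Qu[OF uc] integration_pos[OF G(1) uc u(2)] by (simp add: D_def)
  then have D: "0 < D" using l by (simp add: zero_less_mult_iff)
  \<comment> \<open>\<open>A\<close> and \<open>B\<close> are the numerators in Cramer's rule for
    the coordinates of \<open>y\<close> with respect to \<open>u\<close> and \<open>w\<close>;
    \<open>A y\<close> is moreover the period of \<open>u\<close> along \<open>y\<close> in units of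
    \<open>l\<close>.\<close>
  define A where "A = (\<lambda>y. c y * p + d y * q)"
  define B where "B = (\<lambda>y. c y * d u - d y * c u)"
  have DA: "D * c y = A y * c u + B y * q" "D * d y = A y * d u - B y * p" for y
    by (simp_all add: D_def A_def B_def algebra_simps)
  have Dy: "frag_cmul D y = frag_cmul (A y) u + frag_cmul (B y) w" if y: "y \<in> cycles G" for y
  proof -
    have mem: "frag_cmul D y \<in> cycles G" "frag_cmul (A y) u + frag_cmul (B y) w \<in> cycles G"
      using y uc wc by (auto intro: cycles_add cycles_cmul)
    have "c (frag_cmul D y) = c (frag_cmul (A y) u + frag_cmul (B y) w)"
      "d (frag_cmul D y) = d (frag_cmul (A y) u + frag_cmul (B y) w)"
      by (simp_all add: lin DA cw)
    then show ?thesis using rep[OF mem(1)] rep[OF mem(2)] by argo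
  qed
  have "w \<noteq> 0"
  proof
    assume "w = 0"
    then have "p = 0" "q = 0" using cw by (simp_all add: c_def d_def)
    then show False using D by (simp add: D_def)
  qed
  \<comment> \<open>Pairing the expansion of \<open>frag_cmul D y\<close> with \<open>w\<close>
    leaves \<open>B y\<close> times the integral of \<open>w\<close> over itself, so in this unit
    every period of \<open>w\<close> is an integer.\<close>
  define l' where "l' = integration G w w / of_int D"
  have l': "0 < l'" using integration_pos[OF G(1) wc \<open>w \<noteq> 0\<close>] D by (simp add: l'_def)
  have Qw: "integration G w y = of_int (B y) * l'" if y: "y \<in> cycles G" for y
  proof -
    have "of_int D * integration G w y = integration G w (frag_cmul D y)"
      by (simp add: integration_cmul_right[OF G(1)])
    also have "\<dots> = of_int (B y) * integration G w w"
      unfolding Dy[OF y] using Quw integration_commute[OF G(1), of w u]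
      by (simp add: integration_add_right[OF G(1)] integration_cmul_right[OF G(1)])
    finally show ?thesis using D by (simp add: l'_def field_simps)
  qed
  let ?E = "loop_graph l" and ?E' = "loop_graph l'"
  let ?T = "torus_coprod (Jac ?E) (Jac ?E')"
  let ?L = "free_Abelian_group {0::nat}" and ?H = "free_Abelian_group (medges G) \<lparr> carrier := cycles G \<rparr>"
  have L: "free_Abelian_group {0} \<lparr> carrier := cycles (loop_graph k) \<rparr> = ?L" for k
    by (simp add: cycles_loop_graph free_Abelian_group_def)
  have Lam: "Lam ?T = ?L \<times>\<times> ?L" "Lam' ?T = ?L \<times>\<times> ?L" "Lam (Jac G) = ?H" "Lam' (Jac G) = ?H"
    using l l' by (simp_all add: torus_coprod_def Jac_def harmonic_forms_eq G(1) first_homology_eq tropical_curve_loop_graph L)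
  define f :: "(nat \<Rightarrow>\<^sub>0 int) \<times> (nat \<Rightarrow>\<^sub>0 int) \<Rightarrow> 'e \<Rightarrow>\<^sub>0 int" where
    "f = (\<lambda>(m, n). frag_cmul (Poly_Mapping.lookup m 0) u + frag_cmul (Poly_Mapping.lookup n 0) w)"
  define g :: "('e \<Rightarrow>\<^sub>0 int) \<Rightarrow> (nat \<Rightarrow>\<^sub>0 int) \<times> (nat \<Rightarrow>\<^sub>0 int)" where
    "g = (\<lambda>y. (frag_cmul (A y) (frag_of 0), frag_cmul (B y) (frag_of 0)))"
  have "f \<in> hom (Lam ?T) (Lam (Jac G))"
    unfolding Lam using uc wc
    by (auto simp: hom_def f_def lookup_add frag_cmul_distrib intro!: cycles_add cycles_cmul)
  moreover have "g \<in> hom (Lam' (Jac G)) (Lam' ?T)"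
    unfolding Lam by (auto simp: hom_def g_def A_def B_def lin keys_frag_of frag_cmul_distrib[symmetric] algebra_simps)
  moreover have "pairing (Jac G) (f x) y = pairing ?T x (g y)" if "y \<in> cycles G" for x y
    using l l' that
    by (simp add: Jac_def torus_coprod_def f_def g_def case_prod_beta integration_loop_graph Qu Qw A_def
        integration_add_left[OF G(1)] integration_cmul_left[OF G(1)] algebra_simps)
  moreover have "inj_on f (carrier (Lam ?T))"
  proof (rule inj_onI)
    fix x y assume xy: "x \<in> carrier (Lam ?T)" "y \<in> carrier (Lam ?T)" "f x = f y"
    obtain m n m' n' where mn: "x = (m, n)" "y = (m', n')" by (metis surj_pair)
    let ?m = "Poly_Mapping.lookup m 0" and ?n = "Poly_Mapping.lookup n 0"
    let ?m' = "Poly_Mapping.lookup m' 0" and ?n' = "Poly_Mapping.lookup n' 0"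
    have e: "?m * c u + ?n * q = ?m' * c u + ?n' * q" "?m * d u - ?n * p = ?m' * d u - ?n' * p"
      using arg_cong[OF xy(3), of c] arg_cong[OF xy(3), of d] unfolding mn f_def by (simp_all add: lin cw)
    \<comment> \<open>Cramer's rule again: the coefficients of \<open>u\<close> and \<open>w\<close>
      are recovered up to the factor \<open>D\<close>.\<close>
    have "?m * D = (?m * c u + ?n * q) * p + (?m * d u - ?n * p) * q"
      "?m' * D = (?m' * c u + ?n' * q) * p + (?m' * d u - ?n' * p) * q"
      "?n * D = (?m * c u + ?n * q) * d u - (?m * d u - ?n * p) * c u"
      "?n' * D = (?m' * c u + ?n' * q) * d u - (?m' * d u - ?n' * p) * c u"
      by (simp_all add: D_def algebra_simps)
    then have "?m * D = ?m' * D" "?n * D = ?n' * D" using e by simp_all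
    then have "?m = ?m'" "?n = ?n'" using D by simp_all
    moreover have "Poly_Mapping.keys m \<subseteq> {0}" "Poly_Mapping.keys n \<subseteq> {0}"
      "Poly_Mapping.keys m' \<subseteq> {0}" "Poly_Mapping.keys n' \<subseteq> {0}"
      using xy(1,2) by (simp_all add: mn Lam)
    ultimately show "x = y" unfolding mn by (metis frag_cmul_lookup_singleton)
  qed
  moreover have "inj_on g (carrier (Lam' (Jac G)))"
  proof (rule inj_onI)
    fix x y assume xy: "x \<in> carrier (Lam' (Jac G))" "y \<in> carrier (Lam' (Jac G))" "g x = g y"
    then have mem: "x \<in> cycles G" "y \<in> cycles G" by (simp_all add: Lam)
    have AB: "A x = A y" "B x = B y"
      using xy(3) by (auto simp: g_def dest!: arg_cong[where f = "\<lambda>z. Poly_Mapping.lookup z 0"])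
    have "D * c x = D * c y" "D * d x = D * d y" by (simp_all only: DA AB)
    then have "c x = c y" "d x = d y" using D by simp_all
    then show "x = y" using rep[OF mem(1)] rep[OF mem(2)] by simp
  qed
  ultimately have "isogeny (Jac G) ?T (f, g)"
    using integral_torus_Jac[OF G(1)] integral_torus_coprod_loop_graphs[OF l l']
    by (auto simp: isogeny_def surjective_morphism_def finite_morphism_def torus_morphism_def Lam)
  then show ?thesis
    using tropical_elliptic_curve_loop_graph[OF l] tropical_elliptic_curve_loop_graph[OF l']
    unfolding jacobian_splits_def isogenous_def by blast
qed

section \<open>Circle-valued harmonic functions\<close>

text \<open>Subtracting the congruences at \<open>x\<close> and \<open>x/2\<close> removes the
  constants. For small \<open>x\<close> the remaining difference is less than \<open>l\<close> in
  absolute value, so the congruence is an equality. This makes slopes of circle-valued functions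
  well defined.\<close>

lemma rcong_affine_unique:
  fixes a b s s' l :: real
  assumes "0 < l" "\<forall>\<^sub>F x in at_right 0. [a + s * x = b + s' * x] (rmod l)"
  shows "s = s'" "[a = b] (rmod l)"
proof -
  obtain \<delta> where \<delta>: "0 < \<delta>" "\<And>x. 0 < x \<Longrightarrow> x < \<delta> \<Longrightarrow> [a + s * x = b + s' * x] (rmod l)"
    using assms(2) unfolding eventually_at_right_field by auto
  \<comment> \<open>The second bound makes \<open>\<bar>s - s'\<bar> * x\<close> smaller than
    \<open>l\<close>; the summand 1 keeps the denominator positive when the slopes agree.\<close>
  define x where "x = min (\<delta> / 2) (l / (\<bar>s - s'\<bar> + 1))"
  have x: "0 < x" "x < \<delta>" "x \<le> l / (\<bar>s - s'\<bar> + 1)" using \<delta>(1) assms(1) by (auto simp: x_def)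
  have "[(a + s * x) - (a + s * (x/2)) = (b + s' * x) - (b + s' * (x/2))] (rmod l)"
    using x by (intro rcong_diff \<delta>(2)) auto
  then have c: "[s * (x/2) = s' * (x/2)] (rmod l)" by (simp add: algebra_simps)
  have "x * (\<bar>s - s'\<bar> + 1) \<le> l" using x(3) by (simp add: pos_le_divide_eq)
  then have "\<bar>s - s'\<bar> * x < l" using x(1) by (simp add: algebra_simps)
  moreover have "\<bar>(s - s') * (x/2)\<bar> = \<bar>s - s'\<bar> * (x/2)" using x(1) by (subst abs_mult) simp
  then have "\<bar>s * (x/2) - s' * (x/2)\<bar> = \<bar>s - s'\<bar> * x / 2" unfolding left_diff_distrib by (simp only: times_divide_eq_right)
  moreover have "0 \<le> \<bar>s - s'\<bar> * x" using x(1) by simp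
  ultimately have "\<bar>s * (x/2) - s' * (x/2)\<bar> < \<bar>l\<bar>" using assms(1) by linarith
  from rcong_imp_eq[OF c this] show "s = s'" using x(1) by simp
  then show "[a = b] (rmod l)" using \<delta>(2)[OF x(1,2)] by simp
qed

section \<open>Germs in tangent directions\<close>

lemma edge_pt_0 [simp]: "edge_pt G e 0 = Vertex (tail (ograph G) e)"
  by (simp add: edge_pt_def)

lemma edge_pt_len: "0 < len G e \<Longrightarrow> edge_pt G e (len G e) = Vertex (head (ograph G) e)"
  by (simp add: edge_pt_def)

lemma edge_pt_inner: "0 < t \<Longrightarrow> t < len G e \<Longrightarrow> edge_pt G e t = Inner e t"
  by (simp add: edge_pt_def)

lemma edge_pt_in_points:
  assumes "tropical_curve G" "e \<in> medges G"
  shows "edge_pt G e t \<in> points G"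
  using tropical_curveD[OF assms(1)] assms(2) by (auto simp: edge_pt_def points_def)

lemma tangents_germ_0: "v \<in> tangents G p \<Longrightarrow> germ G v 0 = p"
  by (auto simp: tangents_def germ_def)

lemma tangents_edge: "v \<in> tangents G p \<Longrightarrow> fst v \<in> medges G"
  by (auto simp: tangents_def)

lemma germ_in_points: "tropical_curve G \<Longrightarrow> v \<in> tangents G p \<Longrightarrow> germ G v x \<in> points G"
  by (auto simp: germ_def tangents_def intro!: edge_pt_in_points)

lemma finite_tangents:
  assumes "tropical_curve G"
  shows "finite (tangents G p)"
proof -
  note D = tropical_curveD[OF assms]
  define T where "T = {0} \<union> len G ` medges G \<union> (case p of Inner e t \<Rightarrow> {t} | _ \<Rightarrow> {})"
  have "tangents G p \<subseteq> medges G \<times> T \<times> {1, -1}"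
    using D(6) by (auto simp: tangents_def T_def edge_pt_def split: if_splits)
  moreover have "finite T" using D by (auto simp: T_def split: point.split)
  ultimately show ?thesis using D(2) finite_subset by blast
qed

lemma germ_eventually_inner:
  assumes "(e, t, \<sigma>) \<in> tangents G p"
  shows "\<forall>\<^sub>F x in at_right 0. germ G (e, t, \<sigma>) x = Inner e (t + \<sigma> * x) \<and>
    0 < t + \<sigma> * x \<and> t + \<sigma> * x < len G e"
proof -
  define \<epsilon> where "\<epsilon> = (if \<sigma> = 1 then len G e - t else t)"
  have "0 < \<epsilon>" using assms by (auto simp: \<epsilon>_def tangents_def)
  moreover have "germ G (e, t, \<sigma>) x = Inner e (t + \<sigma> * x) \<and> 0 < t + \<sigma> * x \<and> t + \<sigma> * x < len G e"
    if "0 < x" "x < \<epsilon>" for x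
    using assms that by (auto simp: \<epsilon>_def tangents_def germ_def intro!: edge_pt_inner)
  ultimately show ?thesis unfolding eventually_at_right_field by auto
qed

lemma eventually_at_right_scale:
  fixes d :: real
  assumes "0 < d" "\<forall>\<^sub>F x in at_right 0. P x"
  shows "\<forall>\<^sub>F x in at_right 0. P (d * x)"
proof -
  obtain \<epsilon> where "0 < \<epsilon>" "\<And>x. 0 < x \<Longrightarrow> x < \<epsilon> \<Longrightarrow> P x"
    using assms(2) unfolding eventually_at_right_field by auto
  then show ?thesis
    unfolding eventually_at_right_field using assms(1)
    by (intro exI[of _ "\<epsilon> / d"]) (auto simp: field_simps)
qed

text \<open>A germ enters the open edge at once, where a point determines its edge and coordinate;
  two instants then determine the base coordinate and the sign. The factor \<open>d\<close>
  accommodates germs traversed at the speed given by a slope.\<close>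

lemma tangent_eqI:
  assumes v: "v \<in> tangents G p" and w: "w \<in> tangents G q" and d: "0 < d"
    and ev: "\<forall>\<^sub>F x in at_right 0. germ G v (d * x) = germ G w (d * x)"
  shows "v = w"
proof -
  obtain e t \<sigma> where v_eq: "v = (e, t, \<sigma>)" by (metis surj_pair)
  obtain e' t' \<sigma>' where w_eq: "w = (e', t', \<sigma>')" by (metis surj_pair)
  have "\<forall>\<^sub>F x in at_right 0. e = e' \<and> t + \<sigma> * (d * x) = t' + \<sigma>' * (d * x)"
    using ev eventually_at_right_scale[OF d germ_eventually_inner[OF v[unfolded v_eq]]]
      eventually_at_right_scale[OF d germ_eventually_inner[OF w[unfolded w_eq]]]
    by eventually_elim (auto simp: v_eq w_eq)
  then obtain \<epsilon> where \<epsilon>: "0 < \<epsilon>" "\<And>x. 0 < x \<Longrightarrow> x < \<epsilon> \<Longrightarrow> e = e' \<and> t + \<sigma> * (d * x) = t' + \<sigma>' * (d * x)"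
    unfolding eventually_at_right_field by auto
  have e: "e = e'" and a: "t + \<sigma> * (d * (\<epsilon>/2)) = t' + \<sigma>' * (d * (\<epsilon>/2))"
    and b: "t + \<sigma> * (d * (\<epsilon>/3)) = t' + \<sigma>' * (d * (\<epsilon>/3))"
    using \<epsilon>(1) \<epsilon>(2)[of "\<epsilon>/2"] \<epsilon>(2)[of "\<epsilon>/3"] by auto
  have "\<sigma> * (d * (\<epsilon>/2)) - \<sigma> * (d * (\<epsilon>/3)) = \<sigma>' * (d * (\<epsilon>/2)) - \<sigma>' * (d * (\<epsilon>/3))"
    using a b by linarith
  then have "\<sigma> * (d * \<epsilon> / 6) = \<sigma>' * (d * \<epsilon> / 6)" by (simp add: algebra_simps)
  then have "\<sigma> = \<sigma>'" using d \<epsilon>(1) by simp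
  then show ?thesis using e a by (simp add: v_eq w_eq)
qed

lemma affine_on_edgeE:
  assumes "affine_on_edge M N \<psi> e d" "0 < d"
  obtains e' a s where "e' \<in> medges N" "s = 1 \<or> s = -1"
    "\<And>t. t \<in> {0..len M e} \<Longrightarrow> a + s * real d * t \<in> {0..len N e'} \<and>
       \<psi> (edge_pt M e t) = edge_pt N e' (a + s * real d * t)"
proof -
  have "d \<noteq> 0" using assms(2) by simp
  have "\<exists>e'\<in>medges N. \<exists>a. \<exists>s\<in>{1, -1}. \<forall>t\<in>{0..len M e}. a + s * real d * t \<in> {0..len N e'} \<and>
       \<psi> (edge_pt M e t) = edge_pt N e' (a + s * real d * t)"
    using assms(1) unfolding affine_on_edge_def if_not_P[OF \<open>d \<noteq> 0\<close>] .
  then obtain e' a s where "e' \<in> medges N" "s \<in> {1, -1}" and *: "\<forall>t\<in>{0..len M e}. a + s * real d * t \<in> {0..len N e'} \<and>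
       \<psi> (edge_pt M e t) = edge_pt N e' (a + s * real d * t)"
    by (elim bexE exE)
  then show thesis by (intro that[of e' s a] bspec[OF *]) auto
qed

text \<open>The affine formula on the edge restricts to a germ. Orientation signs multiply, and time
  is rescaled by the slope.\<close>

lemma affine_tangent:
  assumes aff: "affine_on_edge M N \<psi> (fst v) d" and d: "0 < d" and v: "v \<in> tangents M p"
  shows "\<exists>w\<in>tangents N (\<psi> p). \<exists>\<epsilon>>0. \<forall>x\<in>{0..\<epsilon>}. \<psi> (germ M v x) = germ N w (real d * x)"
proof -
  obtain e t \<sigma> where v_eq: "v = (e, t, \<sigma>)" by (metis surj_pair)
  obtain e' a s where e': "e' \<in> medges N" and s: "s = 1 \<or> s = -1"
    and A: "\<And>t. t \<in> {0..len M e} \<Longrightarrow> a + s * real d * t \<in> {0..len N e'} \<and>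
             \<psi> (edge_pt M e t) = edge_pt N e' (a + s * real d * t)"
    using affine_on_edgeE[OF aff d] unfolding v_eq fst_conv by metis
  have t: "t \<in> {0..len M e}" "edge_pt M e t = p" and \<sigma>: "\<sigma> = 1 \<and> t < len M e \<or> \<sigma> = -1 \<and> 0 < t"
    using v by (auto simp: v_eq tangents_def)
  define \<epsilon> where "\<epsilon> = (if \<sigma> = 1 then len M e - t else t)"
  have \<epsilon>: "0 < \<epsilon>" using \<sigma> by (auto simp: \<epsilon>_def)
  have mem: "t + \<sigma> * x \<in> {0..len M e}" if "x \<in> {0..\<epsilon>}" for x
    using that t(1) \<sigma> by (auto simp: \<epsilon>_def)
  define w where "w = (e', a + s * real d * t, s * \<sigma>)"
  have eq: "a + s * real d * (t + \<sigma> * x) = a + s * real d * t + s * \<sigma> * (real d * x)" for x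
    by (simp add: algebra_simps)
  have "\<psi> (germ M v x) = germ N w (real d * x)" if "x \<in> {0..\<epsilon>}" for x
    using A[OF mem[OF that]] by (simp add: germ_def v_eq w_def eq)
  moreover have "w \<in> tangents N (\<psi> p)"
  proof -
    have 1: "a + s * real d * t \<in> {0..len N e'}" "\<psi> p = edge_pt N e' (a + s * real d * t)"
      using A[OF t(1)] t(2) by auto
    \<comment> \<open>That the formula is still inside the edge of \<open>N\<close> after a positive
      distance gives the strict inequality required of a tangent direction.\<close>
    have 2: "a + s * real d * t + s * \<sigma> * (real d * \<epsilon>) \<in> {0..len N e'}"
      using A[OF mem[of \<epsilon>]] \<epsilon> unfolding eq by auto
    have "0 < real d * \<epsilon>" using d \<epsilon> by simp
    then show ?thesis
      using 1 2 e' s \<sigma> by (auto simp: tangents_def w_def)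
  qed
  ultimately show ?thesis using \<epsilon> by blast
qed

section \<open>Refinements and tangent directions\<close>

lemma refines_tangent:
  assumes R: "refines R k G" and v: "v \<in> tangents R p"
  shows "\<exists>w\<in>tangents G (k p). \<forall>\<^sub>F x in at_right 0. k (germ R v x) = germ G w x"
proof -
  have "affine_on_edge R G k (fst v) 1"
    using R tangents_edge[OF v] by (auto simp: refines_def)
  from affine_tangent[OF this zero_less_one v]
  obtain w \<epsilon> where "w \<in> tangents G (k p)" "0 < \<epsilon>" "\<forall>x\<in>{0..\<epsilon>}. k (germ R v x) = germ G w x"
    by auto
  then show ?thesis
    unfolding eventually_at_right_field by (intro bexI[of _ w] exI[of _ \<epsilon>]) auto
qed

text \<open>The points near \<open>k p\<close> in the direction \<open>w\<close> lie in the images of finitely many edges of \<open>R\<close>, so one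
  edge contributes points arbitrarily close to \<open>k p\<close>.\<close>

lemma refines_tangent_onto:
  assumes R: "refines R k G" and G: "tropical_curve G" and p: "p \<in> points R" and w: "w \<in> tangents G (k p)"
  shows "\<exists>v\<in>tangents R p. \<forall>\<^sub>F x in at_right 0. k (germ R v x) = germ G w x"
proof -
  have tR: "tropical_curve R" and inj: "inj_on k (points R)" and im: "k ` points R = points G"
    and aff: "\<And>e. e \<in> medges R \<Longrightarrow> affine_on_edge R G k e 1"
    using R by (auto simp: refines_def bij_betw_def)
  note D = tropical_curveD[OF tR]
  obtain e' t' \<sigma>' where w_eq: "w = (e', t', \<sigma>')" by (metis surj_pair)
  have t': "e' \<in> medges G" "edge_pt G e' t' = k p" and \<sigma>': "\<sigma>' = 1 \<or> \<sigma>' = -1"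
    using w by (auto simp: w_eq tangents_def)
  \<comment> \<open>A germ passes through a given point at most once, so near its start it avoids
    the finitely many images of vertices.\<close>
  have "\<forall>\<^sub>F x in at_right 0. Inner e' (t' + \<sigma>' * x) \<noteq> q" for q :: "('c, 'd) point"
  proof (cases "\<exists>x>0. Inner e' (t' + \<sigma>' * x) = q")
    case True
    then obtain y where y: "0 < y" "Inner e' (t' + \<sigma>' * y) = q" by blast
    have "Inner e' (t' + \<sigma>' * x) \<noteq> q" if "0 < x" "x < y" for x
      using y that \<sigma>' by auto
    then show ?thesis using y(1) unfolding eventually_at_right_field by blast
  next
    case False
    then show ?thesis unfolding eventually_at_right_field by (intro exI[of _ 1]) auto
  qed
  then have "\<forall>\<^sub>F x in at_right 0. \<forall>q\<in>k ` Vertex ` mverts R. Inner e' (t' + \<sigma>' * x) \<noteq> q"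
    using D(1) by (intro eventually_ball_finite) auto
  moreover note ev = germ_eventually_inner[OF w[unfolded w_eq]]
  ultimately have "\<forall>\<^sub>F x in at_right 0. \<exists>e\<in>medges R. \<exists>\<tau>. 0 < \<tau> \<and> \<tau> < len R e \<and> k (Inner e \<tau>) = Inner e' (t' + \<sigma>' * x)"
  proof eventually_elim
    case (elim x)
    then have "Inner e' (t' + \<sigma>' * x) \<in> k ` points R"
      using t'(1) unfolding im by (auto simp: points_def)
    then obtain r where r: "r \<in> points R" "k r = Inner e' (t' + \<sigma>' * x)" by auto
    then have "r \<notin> Vertex ` mverts R" using elim(1) by (metis imageI)
    then show ?case using r by (auto simp: points_def)
  qed
  \<comment> \<open>The weakening to \<open>frequently\<close> is deliberate: unlike
    \<open>eventually\<close>, it distributes over the finitely many edges, which is the pigeonhole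
    principle needed.\<close>
  then have "\<exists>\<^sub>F x in at_right 0. \<exists>e\<in>medges R. \<exists>\<tau>. 0 < \<tau> \<and> \<tau> < len R e \<and> k (Inner e \<tau>) = Inner e' (t' + \<sigma>' * x)"
    by (rule eventually_frequently[rotated]) simp
  then obtain e where e: "e \<in> medges R"
    and fr: "\<exists>\<^sub>F x in at_right 0. \<exists>\<tau>. 0 < \<tau> \<and> \<tau> < len R e \<and> k (Inner e \<tau>) = Inner e' (t' + \<sigma>' * x)"
    using D(2) by (auto simp: frequently_bex_finite_distrib)
  obtain e2 a s where s: "s = 1 \<or> s = -1"
    and A: "\<And>t. t \<in> {0..len R e} \<Longrightarrow> a + s * t \<in> {0..len G e2} \<and> k (edge_pt R e t) = edge_pt G e2 (a + s * t)"
    using affine_on_edgeE[OF aff[OF e] zero_less_one] by (metis mult.right_neutral of_nat_1)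
  have s2: "s * s = 1" using s by auto
  \<comment> \<open>The solution of \<open>a + s * \<tau> = t'\<close>, as \<open>s\<close> is its
    own inverse.\<close>
  define \<tau>\<^sub>0 where "\<tau>\<^sub>0 = s * (t' - a)"
  have fr': "\<exists>\<^sub>F x in at_right 0. e2 = e' \<and> 0 < \<tau>\<^sub>0 + s * \<sigma>' * x \<and> \<tau>\<^sub>0 + s * \<sigma>' * x < len R e"
    using fr
  proof (rule frequently_elim1)
    fix x assume "\<exists>\<tau>. 0 < \<tau> \<and> \<tau> < len R e \<and> k (Inner e \<tau>) = Inner e' (t' + \<sigma>' * x)"
    then obtain \<tau> where \<tau>: "0 < \<tau>" "\<tau> < len R e" "k (Inner e \<tau>) = Inner e' (t' + \<sigma>' * x)" by blast
    then have "edge_pt G e2 (a + s * \<tau>) = Inner e' (t' + \<sigma>' * x)"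
      using A[of \<tau>] by (simp add: edge_pt_inner)
    then have eq: "e2 = e'" "a + s * \<tau> = t' + \<sigma>' * x" by (auto simp: edge_pt_def split: if_splits)
    have "s * (a + s * \<tau>) = s * a + \<tau>" using s2 by (simp add: algebra_simps mult.assoc[symmetric])
    then have "\<tau> = \<tau>\<^sub>0 + s * \<sigma>' * x" unfolding eq(2) \<tau>\<^sub>0_def by (simp add: algebra_simps)
    then show "e2 = e' \<and> 0 < \<tau>\<^sub>0 + s * \<sigma>' * x \<and> \<tau>\<^sub>0 + s * \<sigma>' * x < len R e" using \<tau> eq by simp
  qed
  have e2: "e2 = e'" using frequently_ex[OF fr'] by blast
  have lim: "((\<lambda>x. \<tau>\<^sub>0 + s * \<sigma>' * x) \<longlongrightarrow> \<tau>\<^sub>0) (at_right 0)"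
    by (rule tendsto_eq_intros refl tendsto_ident_at | simp)+
  \<comment> \<open>\<open>\<tau>\<^sub>0\<close> is a limit of parameters inside the edge, hence
    lies in the closed edge.\<close>
  have "0 \<le> \<tau>\<^sub>0"
  proof (rule ccontr)
    assume "\<not> 0 \<le> \<tau>\<^sub>0"
    then have "\<forall>\<^sub>F x in at_right 0. \<tau>\<^sub>0 + s * \<sigma>' * x < 0" using order_tendstoD(2)[OF lim, of 0] by simp
    from frequently_ex[OF frequently_eventually_frequently[OF fr' this]] show False by auto
  qed
  moreover have "\<tau>\<^sub>0 \<le> len R e"
  proof (rule ccontr)
    assume "\<not> \<tau>\<^sub>0 \<le> len R e"
    then have "\<forall>\<^sub>F x in at_right 0. len R e < \<tau>\<^sub>0 + s * \<sigma>' * x" using order_tendstoD(1)[OF lim, of "len R e"] by simp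
    from frequently_ex[OF frequently_eventually_frequently[OF fr' this]] show False by auto
  qed
  ultimately have \<tau>\<^sub>0: "\<tau>\<^sub>0 \<in> {0..len R e}" by simp
  have "\<exists>\<^sub>F x in at_right 0. 0 < x \<and> 0 < \<tau>\<^sub>0 + s * \<sigma>' * x \<and> \<tau>\<^sub>0 + s * \<sigma>' * x < len R e"
    by (rule frequently_elim1[OF frequently_eventually_frequently[OF fr' eventually_at_right_less[of 0]]]) simp
  from frequently_ex[OF this]
  obtain x where x: "0 < x" "0 < \<tau>\<^sub>0 + s * \<sigma>' * x" "\<tau>\<^sub>0 + s * \<sigma>' * x < len R e"
    by (elim exE conjE)
  have ret: "a + s * (\<tau>\<^sub>0 + s * \<sigma>' * y) = t' + \<sigma>' * y" for y
    using s by (auto simp: \<tau>\<^sub>0_def algebra_simps)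
  have "k (edge_pt R e \<tau>\<^sub>0) = k p"
    using A[OF \<tau>\<^sub>0] ret[of 0] t'(2) e2 by simp
  then have "edge_pt R e \<tau>\<^sub>0 = p"
    using inj p edge_pt_in_points[OF tR e] by (auto dest: inj_onD)
  then have v: "(e, \<tau>\<^sub>0, s * \<sigma>') \<in> tangents R p"
    using e \<tau>\<^sub>0 x s \<sigma>' by (auto simp: tangents_def)
  moreover have "\<forall>\<^sub>F x in at_right 0. k (germ R (e, \<tau>\<^sub>0, s * \<sigma>') x) = germ G w x"
    using germ_eventually_inner[OF v]
  proof eventually_elim
    case (elim x)
    then show ?case using A[of "\<tau>\<^sub>0 + s * \<sigma>' * x"] ret[of x] e2 by (simp add: germ_def w_eq)
  qed
  ultimately show ?thesis by blast
qed

text \<open>Injectivity of \<open>k\<close> on points separates directions, because equal image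
  germs come from equal germs; surjectivity is the preceding lemma. Refinements preserve arc length,
  so the germs match without rescaling.\<close>

lemma refines_tangents_bij:
  assumes R: "refines R k G" and G: "tropical_curve G" and p: "p \<in> points R"
  obtains \<beta> where "bij_betw \<beta> (tangents R p) (tangents G (k p))"
    "\<And>v. v \<in> tangents R p \<Longrightarrow> \<forall>\<^sub>F x in at_right 0. k (germ R v x) = germ G (\<beta> v) x"
proof -
  have tR: "tropical_curve R" and inj: "inj_on k (points R)" using R by (auto simp: refines_def bij_betw_def)
  obtain \<beta> where \<beta>: "\<And>v. v \<in> tangents R p \<Longrightarrow> \<beta> v \<in> tangents G (k p)"
    "\<And>v. v \<in> tangents R p \<Longrightarrow> \<forall>\<^sub>F x in at_right 0. k (germ R v x) = germ G (\<beta> v) x"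
    using bchoice[of "tangents R p" "\<lambda>v w. w \<in> tangents G (k p) \<and> (\<forall>\<^sub>F x in at_right 0. k (germ R v x) = germ G w x)"]
      refines_tangent[OF R] by blast
  have "inj_on \<beta> (tangents R p)"
  proof (rule inj_onI)
    fix v v' assume v: "v \<in> tangents R p" "v' \<in> tangents R p" "\<beta> v = \<beta> v'"
    have "\<forall>\<^sub>F x in at_right 0. germ R v (1 * x) = germ R v' (1 * x)"
      using \<beta>(2)[OF v(1)] \<beta>(2)[OF v(2)]
    proof eventually_elim
      case (elim x)
      then show ?case
        using inj_on_eq_iff[OF inj germ_in_points[OF tR v(1), of x] germ_in_points[OF tR v(2), of x]] v(3) by simp
    qed
    then show "v = v'" using tangent_eqI[OF v(1,2), of 1] by simp
  qed
  moreover have "w \<in> \<beta> ` tangents R p" if w: "w \<in> tangents G (k p)" for w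
  proof -
    from refines_tangent_onto[OF R G p w]
    obtain v where v: "v \<in> tangents R p" "\<forall>\<^sub>F x in at_right 0. k (germ R v x) = germ G w x"
      by (elim bexE)
    have "\<forall>\<^sub>F x in at_right 0. germ G (\<beta> v) (1 * x) = germ G w (1 * x)"
      using \<beta>(2)[OF v(1)] v(2) by eventually_elim auto
    then have "\<beta> v = w" using tangent_eqI[OF \<beta>(1)[OF v(1)] w, of 1] by simp
    then show ?thesis using v(1) by blast
  qed
  ultimately have "bij_betw \<beta> (tangents R p) (tangents G (k p))"
    using \<beta>(1) by (intro bij_betw_imageI) auto
  then show thesis using that \<beta>(2) by (simp only:)
qed

text \<open>The comparison is with the value at the base point itself, so the condition includes
  continuity of the R/lZ-valued function along the germ.\<close>

definition local_slope ::
  "real \<Rightarrow> ('v, 'e) metric_graph \<Rightarrow> (('v, 'e) point \<Rightarrow> real) \<Rightarrow> 'e \<times> real \<times> real \<Rightarrow> int \<Rightarrow> bool" where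
  "local_slope l G F v s \<longleftrightarrow>
     (\<forall>\<^sub>F x in at_right 0. [F (germ G v x) = F (germ G v 0) + of_int s * x] (rmod l))"

text \<open>At an interior point of an edge the two outgoing slopes have to cancel, which excludes
  kinks. Vertices and interior points are thus treated alike, and the condition does not see which
  points are vertices.\<close>

definition harmonic_at :: "real \<Rightarrow> ('v, 'e) metric_graph \<Rightarrow> (('v, 'e) point \<Rightarrow> real) \<Rightarrow> ('v, 'e) point \<Rightarrow> bool" where
  "harmonic_at l G F p \<longleftrightarrow>
     (\<exists>\<sigma>. (\<forall>v\<in>tangents G p. local_slope l G F v (\<sigma> v)) \<and> (\<Sum>v\<in>tangents G p. \<sigma> v) = 0)"

definition harmonic_mod :: "real \<Rightarrow> ('v, 'e) metric_graph \<Rightarrow> (('v, 'e) point \<Rightarrow> real) \<Rightarrow> bool" where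
  "harmonic_mod l G F \<longleftrightarrow> (\<forall>p\<in>points G. harmonic_at l G F p)"

lemma local_slope_unique:
  assumes "0 < l" "local_slope l G F v s" "local_slope l G F v s'"
  shows "s = s'"
proof -
  have "\<forall>\<^sub>F x in at_right 0. [F (germ G v 0) + of_int s * x = F (germ G v 0) + of_int s' * x] (rmod l)"
    using assms(2,3) unfolding local_slope_def
    by eventually_elim (rule rcong_trans[OF rcong_sym])
  then show ?thesis using rcong_affine_unique(1)[OF assms(1)] of_int_eq_iff by blast
qed

lemma local_slope_cong:
  assumes "tropical_curve G" "\<And>q. q \<in> points G \<Longrightarrow> F q = F' q" "v \<in> tangents G p"
  shows "local_slope l G F v s \<longleftrightarrow> local_slope l G F' v s"
  using assms by (simp add: local_slope_def germ_in_points)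

lemma harmonic_mod_cong:
  assumes "tropical_curve G" "\<And>q. q \<in> points G \<Longrightarrow> F q = F' q"
  shows "harmonic_mod l G F \<longleftrightarrow> harmonic_mod l G F'"
  unfolding harmonic_mod_def harmonic_at_def using local_slope_cong[OF assms] by simp

lemma refines_tangents_slope:
  assumes "refines R k G" "tropical_curve G" "p \<in> points R"
  obtains \<beta> where "bij_betw \<beta> (tangents R p) (tangents G (k p))"
    "\<And>l F v s. v \<in> tangents R p \<Longrightarrow> local_slope l R (F \<circ> k) v s \<longleftrightarrow> local_slope l G F (\<beta> v) s"
proof -
  obtain \<beta> where bij: "bij_betw \<beta> (tangents R p) (tangents G (k p))"
    and \<beta>: "\<And>v. v \<in> tangents R p \<Longrightarrow> \<forall>\<^sub>F x in at_right 0. k (germ R v x) = germ G (\<beta> v) x"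
    using refines_tangents_bij[OF assms] by metis
  have "local_slope l R (F \<circ> k) v s \<longleftrightarrow> local_slope l G F (\<beta> v) s" if v: "v \<in> tangents R p" for l F v s
  proof -
    have "\<beta> v \<in> tangents G (k p)" using bij v by (auto simp: bij_betw_def)
    then have 0: "germ R v 0 = p" "germ G (\<beta> v) 0 = k p" using tangents_germ_0 v by blast+
    show ?thesis
      unfolding local_slope_def o_def 0 by (rule eventually_subst) (use \<beta>[OF v] in eventually_elim, simp)
  qed
  then show thesis using that[OF bij] by simp
qed

lemma harmonic_at_refines:
  assumes "refines R k G" "tropical_curve G" "p \<in> points R"
  shows "harmonic_at l R (F \<circ> k) p \<longleftrightarrow> harmonic_at l G F (k p)"
proof -
  obtain \<beta> where bij: "bij_betw \<beta> (tangents R p) (tangents G (k p))"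
    and slope: "\<And>l F v s. v \<in> tangents R p \<Longrightarrow> local_slope l R (F \<circ> k) v s \<longleftrightarrow> local_slope l G F (\<beta> v) s"
    using refines_tangents_slope[OF assms] by metis
  show ?thesis
  proof
    assume "harmonic_at l R (F \<circ> k) p"
    then obtain \<sigma> where \<sigma>: "\<And>v. v \<in> tangents R p \<Longrightarrow> local_slope l R (F \<circ> k) v (\<sigma> v)" "(\<Sum>v\<in>tangents R p. \<sigma> v) = 0"
      unfolding harmonic_at_def by blast
    let ?i = "the_inv_into (tangents R p) \<beta>"
    have i: "?i (\<beta> v) = v" if "v \<in> tangents R p" for v
      using bij that by (auto simp: bij_betw_def the_inv_into_f_f)
    have "local_slope l G F w (\<sigma> (?i w))" if "w \<in> tangents G (k p)" for w
    proof -
      have "w \<in> \<beta> ` tangents R p" using that by (simp only: bij_betw_imp_surj_on[OF bij])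
      then obtain v where v: "w = \<beta> v" "v \<in> tangents R p" by (elim imageE)
      then show ?thesis using slope[OF v(2)] \<sigma>(1)[OF v(2)] i[OF v(2)] v(1) by simp
    qed
    moreover have "(\<Sum>w\<in>tangents G (k p). \<sigma> (?i w)) = (\<Sum>v\<in>tangents R p. \<sigma> v)"
      unfolding sum.reindex_bij_betw[OF bij, symmetric] by (intro sum.cong refl) (simp add: i)
    ultimately show "harmonic_at l G F (k p)"
      unfolding harmonic_at_def using \<sigma>(2) by (intro exI[of _ "\<lambda>w. \<sigma> (?i w)"]) simp
  next
    assume "harmonic_at l G F (k p)"
    then obtain \<sigma> where \<sigma>: "\<And>v. v \<in> tangents G (k p) \<Longrightarrow> local_slope l G F v (\<sigma> v)" "(\<Sum>v\<in>tangents G (k p). \<sigma> v) = 0"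
      unfolding harmonic_at_def by blast
    have "local_slope l R (F \<circ> k) v (\<sigma> (\<beta> v))" if "v \<in> tangents R p" for v
      using slope[OF that] \<sigma>(1)[OF bij_betwE[OF bij, rule_format, OF that]] by (simp only:)
    moreover have "(\<Sum>v\<in>tangents R p. \<sigma> (\<beta> v)) = 0"
      using \<sigma>(2) sum.reindex_bij_betw[OF bij, of \<sigma>] by simp
    ultimately show "harmonic_at l R (F \<circ> k) p"
      unfolding harmonic_at_def by (intro exI[of _ "\<lambda>v. \<sigma> (\<beta> v)"]) simp
  qed
qed

lemma harmonic_mod_refines:
  assumes "refines R k G" "tropical_curve G"
  shows "harmonic_mod l R (F \<circ> k) \<longleftrightarrow> harmonic_mod l G F"
proof -
  have "points G = k ` points R" using assms(1) by (simp add: refines_def bij_betw_def)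
  then show ?thesis
    unfolding harmonic_mod_def using harmonic_at_refines[OF assms] by simp
qed

text \<open>Both curves are compared with their common refinement.\<close>

lemma harmonic_mod_model:
  assumes "model_of M h G" "tropical_curve G"
  shows "harmonic_mod l M (F \<circ> h) \<longleftrightarrow> harmonic_mod l G F"
proof -
  obtain R :: "(nat, nat) metric_graph" and k where R: "refines R k M" "refines R (h \<circ> k) G"
    and M: "tropical_curve M"
    using assms(1) unfolding model_of_def by (elim conjE exE)
  show ?thesis
    using harmonic_mod_refines[OF R(1) M, of l "F \<circ> h"] harmonic_mod_refines[OF R(2) assms(2), of l F]
    by (simp only: o_assoc)
qed

text \<open>Grouping the directions at \<open>p\<close> by their images turns the sum of the slopes into a sum of local
  degrees.\<close>

lemma pullback_slopes:
  assumes M: "tropical_curve M" and N: "tropical_curve N"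
    and aff: "\<And>e. e \<in> medges M \<Longrightarrow> affine_on_edge M N \<psi> e (d e)"
    and \<tau>: "\<And>w. w \<in> tangents N (\<psi> p) \<Longrightarrow> local_slope l N \<theta> w (\<tau> w)"
  obtains \<sigma> where "\<And>v. v \<in> tangents M p \<Longrightarrow> local_slope l M (\<theta> \<circ> \<psi>) v (\<sigma> v)"
    "(\<Sum>v\<in>tangents M p. \<sigma> v) = (\<Sum>w\<in>tangents N (\<psi> p). \<tau> w * int (local_degree M N \<psi> d p w))"
proof -
  let ?m = "maps_direction M N \<psi> d"
  have ev: "\<forall>\<^sub>F x in at_right 0. \<psi> (germ M v x) = germ N w (real (d (fst v)) * x)" if m: "?m v w" for v w
  proof -
    obtain \<epsilon> where "0 < \<epsilon>" "\<forall>s\<in>{0..\<epsilon>}. \<psi> (germ M v s) = germ N w (real (d (fst v)) * s)"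
      using m unfolding maps_direction_def by (elim conjE exE)
    then show ?thesis unfolding eventually_at_right_field by (intro exI[of _ \<epsilon>]) auto
  qed
  have ex: "\<exists>w\<in>tangents N (\<psi> p). ?m v w" if v: "v \<in> tangents M p" "0 < d (fst v)" for v
  proof -
    from affine_tangent[OF aff[OF tangents_edge[OF v(1)]] v(2,1)]
    obtain w \<epsilon> where "w \<in> tangents N (\<psi> p)" "0 < \<epsilon>"
      "\<forall>x\<in>{0..\<epsilon>}. \<psi> (germ M v x) = germ N w (real (d (fst v)) * x)"
      by (elim bexE exE conjE)
    then show ?thesis
      unfolding maps_direction_def using v(2) by (intro bexI[of _ w] conjI exI[of _ \<epsilon>])
  qed
  have uniq: "w = w'" if "?m v w" "?m v w'" "w \<in> tangents N (\<psi> p)" "w' \<in> tangents N (\<psi> p)" for v w w'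
  proof (rule tangent_eqI[OF that(3,4)])
    show "0 < real (d (fst v))" using that(1) by (simp add: maps_direction_def)
    show "\<forall>\<^sub>F x in at_right 0. germ N w (real (d (fst v)) * x) = germ N w' (real (d (fst v)) * x)"
      using ev[OF that(1)] ev[OF that(2)] by eventually_elim simp
  qed
  \<comment> \<open>At most one direction \<open>w\<close> contributes. For a contracted direction
    the sum is empty, which gives the slope 0 it should have.\<close>
  define \<sigma> where "\<sigma> = (\<lambda>v. \<Sum>w\<in>{w\<in>tangents N (\<psi> p). ?m v w}. \<tau> w * int (d (fst v)))"
  have slope: "local_slope l M (\<theta> \<circ> \<psi>) v (\<sigma> v)" if v: "v \<in> tangents M p" for v
  proof (cases "d (fst v) = 0")
    case True
    then have "\<sigma> v = 0" by (simp add: \<sigma>_def)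
    obtain e t s where v_eq: "v = (e, t, s)" by (metis surj_pair)
    obtain q where q: "\<And>t. t \<in> {0..len M e} \<Longrightarrow> \<psi> (edge_pt M e t) = q"
      using aff[OF tangents_edge[OF v]] True unfolding affine_on_edge_def v_eq by auto
    have q0: "\<psi> (germ M v 0) = q" using v q by (auto simp: germ_def v_eq tangents_def)
    show ?thesis
      unfolding local_slope_def \<open>\<sigma> v = 0\<close> o_def q0
      using germ_eventually_inner[OF v[unfolded v_eq]]
    proof eventually_elim
      case (elim x)
      then have "\<psi> (germ M v x) = q" using q[of "t + s * x"] by (simp add: germ_def v_eq)
      then show ?case by simp
    qed
  next
    case False
    from False have "0 < d (fst v)" by simp
    from ex[OF v this] obtain w where w: "w \<in> tangents N (\<psi> p)" "?m v w" by (elim bexE)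
    have "{w\<in>tangents N (\<psi> p). ?m v w} = {w}"
    proof (intro equalityI subsetI)
      fix w' assume "w' \<in> {w\<in>tangents N (\<psi> p). ?m v w}"
      then have "w' \<in> tangents N (\<psi> p)" "?m v w'" by simp_all
      from uniq[OF this(2) w(2) this(1) w(1)] show "w' \<in> {w}" by simp
    qed (use w in simp)
    then have \<sigma>v: "\<sigma> v = \<tau> w * int (d (fst v))" by (simp add: \<sigma>_def)
    have d: "0 < real (d (fst v))" using False by simp
    have 0: "\<psi> (germ M v 0) = germ N w 0"
      using tangents_germ_0[OF v] tangents_germ_0[OF w(1)] by simp
    show ?thesis
      unfolding local_slope_def \<sigma>v o_def 0
      using ev[OF w(2)] eventually_at_right_scale[OF d \<tau>[OF w(1), unfolded local_slope_def]]
      by eventually_elim (simp add: mult.assoc)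
  qed
  have "(\<Sum>v\<in>tangents M p. \<sigma> v) =
      (\<Sum>w\<in>tangents N (\<psi> p). \<Sum>v\<in>{v\<in>tangents M p. ?m v w}. \<tau> w * int (d (fst v)))"
    unfolding \<sigma>_def by (rule sum.swap_restrict) (simp_all add: finite_tangents M N)
  also have "\<dots> = (\<Sum>w\<in>tangents N (\<psi> p). \<tau> w * int (local_degree M N \<psi> d p w))"
    by (simp add: local_degree_def sum_distrib_left)
  finally show thesis using that slope by blast
qed

text \<open>The local degree at \<open>p\<close> is the same in all directions, so it factors out of
  the weighted sum of slopes and leaves a sum that vanishes by harmonicity of
  \<open>\<theta>\<close>.\<close>

lemma harmonic_mod_pullback:
  assumes M: "tropical_curve M" and N: "tropical_curve N" and \<psi>: "harmonic_on_models M N \<psi>"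
    "\<And>p. p \<in> points M \<Longrightarrow> \<psi> p \<in> points N" and \<theta>: "harmonic_mod l N \<theta>"
  shows "harmonic_mod l M (\<theta> \<circ> \<psi>)"
  unfolding harmonic_mod_def
proof
  fix p assume p: "p \<in> points M"
  obtain d where aff: "\<forall>e\<in>medges M. affine_on_edge M N \<psi> e (d e)"
    and "\<forall>p\<in>points M. \<forall>w\<in>tangents N (\<psi> p). \<forall>w'\<in>tangents N (\<psi> p).
      local_degree M N \<psi> d p w = local_degree M N \<psi> d p w'"
    using \<psi>(1) unfolding harmonic_on_models_def by (elim conjE exE)
  from this(2) p have deg: "\<forall>w\<in>tangents N (\<psi> p). \<forall>w'\<in>tangents N (\<psi> p).
      local_degree M N \<psi> d p w = local_degree M N \<psi> d p w'"
    by (rule bspec)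
  from bspec[OF \<theta>[unfolded harmonic_mod_def] \<psi>(2)[OF p]]
  obtain \<tau> where \<tau>: "\<forall>w\<in>tangents N (\<psi> p). local_slope l N \<theta> w (\<tau> w)" "(\<Sum>w\<in>tangents N (\<psi> p). \<tau> w) = 0"
    unfolding harmonic_at_def by (elim exE conjE)
  obtain \<sigma> where \<sigma>: "\<And>v. v \<in> tangents M p \<Longrightarrow> local_slope l M (\<theta> \<circ> \<psi>) v (\<sigma> v)"
    "(\<Sum>v\<in>tangents M p. \<sigma> v) = (\<Sum>w\<in>tangents N (\<psi> p). \<tau> w * int (local_degree M N \<psi> d p w))"
    using pullback_slopes[OF M N bspec[OF aff] bspec[OF \<tau>(1)]] by metis
  obtain D where "\<forall>w\<in>tangents N (\<psi> p). local_degree M N \<psi> d p w = D" using deg by meson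
  then have "(\<Sum>w\<in>tangents N (\<psi> p). \<tau> w * int (local_degree M N \<psi> d p w)) = (\<Sum>w\<in>tangents N (\<psi> p). \<tau> w) * int D"
    by (simp add: sum_distrib_right)
  then show "harmonic_at l M (\<theta> \<circ> \<psi>) p"
    unfolding harmonic_at_def using \<sigma> \<tau>(2) by (intro exI[of _ \<sigma>] conjI ballI) simp_all
qed

section \<open>From local slopes to slopes on edges\<close>

lemma tangents_Vertex:
  assumes "tropical_curve G"
  shows "tangents G (Vertex v) = (\<lambda>e. (e, 0, 1)) ` {e\<in>medges G. tail (ograph G) e = v} \<union>
    (\<lambda>e. (e, len G e, -1)) ` {e\<in>medges G. head (ograph G) e = v}"
  using tropical_curveD(6)[OF assms]
  by (fastforce simp: tangents_def edge_pt_def image_iff split: if_splits)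

lemma tangents_Inner:
  assumes "e \<in> medges G" "0 < t" "t < len G e"
  shows "tangents G (Inner e t) = {(e, t, 1), (e, t, -1)}"
  using assms by (auto simp: tangents_def edge_pt_def split: if_splits)

lemma sum_tangents_Vertex:
  fixes g :: "'e \<Rightarrow> int" and G :: "('v, 'e) metric_graph"
  assumes "tropical_curve G"
  shows "(\<Sum>(e, t, s)\<in>tangents G (Vertex v). if s = 1 then g e else - g e) =
    (\<Sum>e\<in>{e\<in>medges G. tail (ograph G) e = v}. g e) - (\<Sum>e\<in>{e\<in>medges G. head (ograph G) e = v}. g e)"
proof -
  have fin: "finite (medges G)" using tropical_curveD[OF assms] by blast
  have inj: "inj_on (\<lambda>e. (e, 0::real, 1::real)) A" "inj_on (\<lambda>e. (e, len G e, -1::real)) A" for A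
    by (auto simp: inj_on_def)
  show ?thesis
    unfolding tangents_Vertex[OF assms]
    by (subst sum.union_disjoint) (auto simp: fin sum.reindex inj sum_negf)
qed

text \<open>Bolzano's bisection principle: the hypothesis handles short intervals, and at a junction
  the local formula forces the slopes on both sides to agree, so the two affine pieces fit
  together.\<close>

lemma affine_mod_interval:
  fixes f :: "real \<Rightarrow> real"
  assumes "0 < l" "a \<le> b"
    and loc: "\<And>x. x \<in> {a..b} \<Longrightarrow> \<exists>s::int. \<exists>\<delta>>0. \<forall>y\<in>{a..b}. \<bar>y - x\<bar> < \<delta> \<longrightarrow> [f y = f x + of_int s * (y - x)] (rmod l)"
  shows "\<exists>s::int. \<forall>y\<in>{a..b}. [f y = f a + of_int s * (y - a)] (rmod l)"
proof -
  define P where "P = (\<lambda>c d. a \<le> c \<longrightarrow> d \<le> b \<longrightarrow> (\<exists>s::int. \<forall>y\<in>{c..d}. [f y = f c + of_int s * (y - c)] (rmod l)))"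
  have "P a b"
    using assms(2)
  proof (induction rule: Bolzano)
    case (trans c d e)
    show ?case
      unfolding P_def
    proof (intro impI)
      assume ace: "a \<le> c" "e \<le> b"
      have "\<exists>s::int. \<forall>y\<in>{c..d}. [f y = f c + of_int s * (y - c)] (rmod l)"
        "\<exists>s::int. \<forall>y\<in>{d..e}. [f y = f d + of_int s * (y - d)] (rmod l)"
        using trans ace unfolding P_def by simp_all
      then obtain s s' :: int where ss: "\<forall>y\<in>{c..d}. [f y = f c + of_int s * (y - c)] (rmod l)"
        "\<forall>y\<in>{d..e}. [f y = f d + of_int s' * (y - d)] (rmod l)"
        by (elim exE)
      note s = bspec[OF ss(1)] and s' = bspec[OF ss(2)]
      show "\<exists>s::int. \<forall>y\<in>{c..e}. [f y = f c + of_int s * (y - c)] (rmod l)"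
      \<comment> \<open>On a one-point interval every slope is admissible, so slopes can be compared
        only when both intervals are proper.\<close>
      proof (cases "c = d \<or> d = e")
        case True
        then show ?thesis using ss by auto
      next
        case False
        then have cde: "c < d" "d < e" using trans(3,4) by auto
        have "d \<in> {a..b}" using ace cde by simp
        from loc[OF this]
        obtain r :: int and \<delta> where r: "0 < \<delta>" "\<forall>y\<in>{a..b}. \<bar>y - d\<bar> < \<delta> \<longrightarrow> [f y = f d + of_int r * (y - d)] (rmod l)"
          by (elim exE conjE)
        have r2: "[f y = f d + of_int r * (y - d)] (rmod l)" if "y \<in> {a..b}" "\<bar>y - d\<bar> < \<delta>" for y
          using bspec[OF r(2) that(1)] that(2) by (rule mp)
        \<comment> \<open>Both pieces are rewritten as germs leaving \<open>d\<close>, to the left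
          and to the right, and compared with the local slope \<open>r\<close>.\<close>
        have 1: "[f c + of_int s * (d - c) + of_int (- s) * x = f d + of_int (- r) * x] (rmod l)"
          if "0 < x" "x < min \<delta> (d - c)" for x
        proof -
          have "[f c + of_int s * (d - x - c) = f (d - x)] (rmod l)" using that by (intro rcong_sym[OF s]) auto
          also have "[f (d - x) = f d + of_int r * (d - x - d)] (rmod l)" using that ace cde by (intro r2) auto
          finally show ?thesis by (simp add: algebra_simps)
        qed
        have 2: "[f d + of_int s' * x = f d + of_int r * x] (rmod l)" if "0 < x" "x < min \<delta> (e - d)" for x
        proof -
          have "[f d + of_int s' * (d + x - d) = f (d + x)] (rmod l)" using that by (intro rcong_sym[OF s']) auto
          also have "[f (d + x) = f d + of_int r * (d + x - d)] (rmod l)" using that ace cde by (intro r2) auto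
          finally show ?thesis by simp
        qed
        have ev: "\<forall>\<^sub>F x in at_right 0. [f c + of_int s * (d - c) + of_int (- s) * x = f d + of_int (- r) * x] (rmod l)"
          "\<forall>\<^sub>F x in at_right 0. [f d + of_int s' * x = f d + of_int r * x] (rmod l)"
          unfolding eventually_at_right_field
          using 1 2 r(1) cde by (intro exI[of _ "min \<delta> (d - c)"] exI[of _ "min \<delta> (e - d)"]; simp)+
        have eq: "s = s'" "[f c + of_int s * (d - c) = f d] (rmod l)"
          using rcong_affine_unique[OF assms(1) ev(1)] rcong_affine_unique[OF assms(1) ev(2)] by simp_all
        have "[f y = f c + of_int s * (y - c)] (rmod l)" if y: "y \<in> {c..e}" for y
        proof (cases "y \<le> d")
          case False
          then have "[f y = f d + of_int s * (y - d)] (rmod l)" using s'[of y] y eq(1) by simp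
          also have "[f d + of_int s * (y - d) = (f c + of_int s * (d - c)) + of_int s * (y - d)] (rmod l)"
            using rcong_sym[OF eq(2)] by simp
          finally show ?thesis by (simp add: algebra_simps)
        qed (use s y in auto)
        then show ?thesis by blast
      qed
    qed
  next
    case (local x)
    show ?case
    proof -
      have "x \<in> {a..b}" using local by simp
      from loc[OF this]
      obtain s :: int and \<delta> where s: "0 < \<delta>" "\<forall>y\<in>{a..b}. \<bar>y - x\<bar> < \<delta> \<longrightarrow> [f y = f x + of_int s * (y - x)] (rmod l)"
        by (elim exE conjE)
      have s2: "[f y = f x + of_int s * (y - x)] (rmod l)" if "y \<in> {a..b}" "\<bar>y - x\<bar> < \<delta>" for y
        using bspec[OF s(2) that(1)] that(2) by (rule mp)
      have "P c d" if cd: "c \<le> x" "x \<le> d" "d - c < \<delta>" for c d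
        unfolding P_def
      proof (intro impI exI[of _ s] ballI)
        fix y assume "a \<le> c" "d \<le> b" and y: "y \<in> {c..d}"
        have "[f y = f x + of_int s * (y - x)] (rmod l)" using y cd \<open>a \<le> c\<close> \<open>d \<le> b\<close> by (intro s2) auto
        moreover have "[f c = f x + of_int s * (c - x)] (rmod l)" using y cd \<open>a \<le> c\<close> \<open>d \<le> b\<close> by (intro s2) auto
        then have "[f c + of_int s * (y - c) = f x + of_int s * (c - x) + of_int s * (y - c)] (rmod l)" by simp
        then have "[f c + of_int s * (y - c) = f x + of_int s * (y - x)] (rmod l)" by (simp add: algebra_simps)
        ultimately show "[f y = f c + of_int s * (y - c)] (rmod l)" by (rule rcong_trans[OF _ rcong_sym])
      qed
      then show ?thesis using s(1) by blast
    qed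
  qed
  then show ?thesis unfolding P_def by auto
qed

text \<open>\<open>F\<close> is a potential of the form \<open>\<Sum> u\<^sub>e de\<close> modulo \<open>l\<close>.\<close>

definition affine_mod :: "real \<Rightarrow> ('v, 'e) metric_graph \<Rightarrow> (('v, 'e) point \<Rightarrow> real) \<Rightarrow> ('e \<Rightarrow>\<^sub>0 int) \<Rightarrow> bool" where
  "affine_mod l G F u \<longleftrightarrow> (\<forall>e\<in>medges G. \<forall>t\<in>{0..len G e}.
     [F (edge_pt G e t) = F (Vertex (tail (ograph G) e)) + of_int (Poly_Mapping.lookup u e) * t] (rmod l))"

lemma affine_mod_local_slope:
  assumes "affine_mod l G F u" "(e, t, s) \<in> tangents G p"
  shows "local_slope l G F (e, t, s) (if s = 1 then Poly_Mapping.lookup u e else - Poly_Mapping.lookup u e)"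
proof -
  let ?c = "F (Vertex (tail (ograph G) e))" and ?u = "of_int (Poly_Mapping.lookup u e) :: real"
  have t: "e \<in> medges G" "t \<in> {0..len G e}" and s: "s = 1 \<or> s = -1" using assms(2) by (auto simp: tangents_def)
  have A: "[F (edge_pt G e y) = ?c + ?u * y] (rmod l)" if "y \<in> {0..len G e}" for y
    using assms(1) t(1) that by (simp add: affine_mod_def)
  have k: "of_int (if s = 1 then Poly_Mapping.lookup u e else - Poly_Mapping.lookup u e) = ?u * s" using s by auto
  show ?thesis
    unfolding local_slope_def k
    using germ_eventually_inner[OF assms(2)]
  proof eventually_elim
    case (elim x)
    then have "[F (edge_pt G e (t + s * x)) = ?c + ?u * (t + s * x)] (rmod l)" by (intro A) auto
    also have "?c + ?u * (t + s * x) = (?c + ?u * t) + ?u * s * x" by (simp add: algebra_simps)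
    also have "[\<dots> = F (edge_pt G e t) + ?u * s * x] (rmod l)"
      using rcong_sym[OF A[OF t(2)]] by simp
    finally show ?case by (simp add: germ_def)
  qed
qed

lemma affine_mod_imp_harmonic:
  assumes G: "tropical_curve G" and u: "u \<in> cycles G" and F: "affine_mod l G F u"
  shows "harmonic_mod l G F"
  unfolding harmonic_mod_def
proof
  fix p assume p: "p \<in> points G"
  let ?\<sigma> = "\<lambda>(e, t, s). if s = (1::real) then Poly_Mapping.lookup u e else - Poly_Mapping.lookup u e"
  have "(\<Sum>v\<in>tangents G p. ?\<sigma> v) = 0"
  proof (cases p)
    case (Vertex v)
    then have "v \<in> mverts G" using p by (auto simp: points_def)
    then show ?thesis
      using u unfolding Vertex sum_tangents_Vertex[OF G] cycles_iff_balanced[OF G] by simp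
  next
    case (Inner e t)
    then have "e \<in> medges G" "0 < t" "t < len G e" using p by (auto simp: points_def)
    then show ?thesis unfolding Inner by (simp add: tangents_Inner)
  qed
  moreover have "local_slope l G F v (?\<sigma> v)" if "v \<in> tangents G p" for v
    using affine_mod_local_slope[OF F] that by (cases v) auto
  ultimately show "harmonic_at l G F p" unfolding harmonic_at_def by blast
qed

text \<open>Along an edge harmonicity makes \<open>F\<close> affine modulo \<open>l\<close> near
  every point, hence on the whole edge. At a vertex the vanishing sum of outgoing slopes is the
  balancing condition for the edge slopes.\<close>

lemma harmonic_mod_imp_affine:
  fixes G :: "('v, 'e) metric_graph"
  assumes G: "tropical_curve G" and l: "0 < l" and F: "harmonic_mod l G F"
  obtains u where "u \<in> cycles G" "affine_mod l G F u"
proof -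
  note D = tropical_curveD[OF G]
  have "\<exists>s::int. \<forall>y\<in>{0..len G e}. [F (edge_pt G e y) = F (edge_pt G e 0) + of_int s * (y - 0)] (rmod l)"
    if e: "e \<in> medges G" for e
  proof (rule affine_mod_interval[OF l])
    show "0 \<le> len G e" using D(6)[OF e] by simp
    fix t assume t: "t \<in> {0..len G e}"
    let ?p = "edge_pt G e t"
    obtain \<sigma> where \<sigma>: "\<And>v. v \<in> tangents G ?p \<Longrightarrow> local_slope l G F v (\<sigma> v)" "(\<Sum>v\<in>tangents G ?p. \<sigma> v) = 0"
      using bspec[OF F[unfolded harmonic_mod_def] edge_pt_in_points[OF G e, of t]] unfolding harmonic_at_def by blast
    \<comment> \<open>The slope along the edge. At the head only the backward direction exists, and
      its outgoing slope has the opposite sign.\<close>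
    define s where "s = (if t < len G e then \<sigma> (e, t, 1) else - \<sigma> (e, t, -1))"
    have r: "\<sigma> (e, t, 1) = s" if "t < len G e" using that by (simp add: s_def)
    \<comment> \<open>In the interior this is harmonicity; at the head it holds by the choice of
      \<open>s\<close>.\<close>
    have lft: "\<sigma> (e, t, -1) = - s" if "0 < t"
    proof (cases "t < len G e")
      case True
      then have "tangents G ?p = {(e, t, 1), (e, t, -1)}"
        using tangents_Inner[OF e that True] by (simp add: edge_pt_inner that)
      then show ?thesis using \<sigma>(2) True by (simp add: s_def)
    qed (simp add: s_def)
    have "\<exists>\<delta>>0. \<forall>y\<in>{0..len G e}. t < y \<and> y < t + \<delta> \<longrightarrow> [F (edge_pt G e y) = F ?p + of_int s * (y - t)] (rmod l)"
    proof (cases "t < len G e")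
      case True
      then have "(e, t, 1) \<in> tangents G ?p" using t e by (auto simp: tangents_def)
      from \<sigma>(1)[OF this] obtain \<delta> where "0 < \<delta>"
        "\<And>x. 0 < x \<Longrightarrow> x < \<delta> \<Longrightarrow> [F (edge_pt G e (t + x)) = F ?p + of_int s * x] (rmod l)"
        unfolding local_slope_def eventually_at_right_field r[OF True] by (auto simp: germ_def)
      from this(1) this(2)[of "_ - t"] show ?thesis by (intro exI[of _ \<delta>]) auto
    qed (use t in \<open>auto intro!: exI[of _ 1]\<close>)
    then obtain \<delta>1 where 1: "0 < \<delta>1" "\<And>y. y \<in> {0..len G e} \<Longrightarrow> t < y \<Longrightarrow> y < t + \<delta>1 \<Longrightarrow> [F (edge_pt G e y) = F ?p + of_int s * (y - t)] (rmod l)"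
      by blast
    have "\<exists>\<delta>>0. \<forall>y\<in>{0..len G e}. y < t \<and> t < y + \<delta> \<longrightarrow> [F (edge_pt G e y) = F ?p + of_int s * (y - t)] (rmod l)"
    proof (cases "0 < t")
      case True
      then have "(e, t, -1) \<in> tangents G ?p" using t e by (auto simp: tangents_def)
      from \<sigma>(1)[OF this] obtain \<delta> where \<delta>: "0 < \<delta>"
        "\<And>x. 0 < x \<Longrightarrow> x < \<delta> \<Longrightarrow> [F (edge_pt G e (t - x)) = F ?p - of_int s * x] (rmod l)"
        unfolding local_slope_def eventually_at_right_field lft[OF True] by (auto simp: germ_def)
      have "[F (edge_pt G e y) = F ?p + of_int s * (y - t)] (rmod l)" if "y < t" "t < y + \<delta>" for y
        using \<delta>(2)[of "t - y"] that by (simp add: algebra_simps)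
      then show ?thesis using \<delta>(1) by blast
    qed (use t in \<open>auto intro!: exI[of _ 1]\<close>)
    then obtain \<delta>2 where 2: "0 < \<delta>2" "\<And>y. y \<in> {0..len G e} \<Longrightarrow> y < t \<Longrightarrow> t < y + \<delta>2 \<Longrightarrow> [F (edge_pt G e y) = F ?p + of_int s * (y - t)] (rmod l)"
      by blast
    have "[F (edge_pt G e y) = F ?p + of_int s * (y - t)] (rmod l)" if "y \<in> {0..len G e}" "\<bar>y - t\<bar> < min \<delta>1 \<delta>2" for y
      using 1(2)[OF that(1)] 2(2)[OF that(1)] that(2) by (cases y t rule: linorder_cases) auto
    then show "\<exists>s::int. \<exists>\<delta>>0. \<forall>y\<in>{0..len G e}. \<bar>y - t\<bar> < \<delta> \<longrightarrow> [F (edge_pt G e y) = F ?p + of_int s * (y - t)] (rmod l)"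
      using 1(1) 2(1) by (intro exI[of _ s] exI[of _ "min \<delta>1 \<delta>2"]) auto
  qed
  then have "\<forall>e\<in>medges G. \<exists>s::int. \<forall>y\<in>{0..len G e}. [F (edge_pt G e y) = F (edge_pt G e 0) + of_int s * (y - 0)] (rmod l)"
    by (intro ballI)
  from bchoice[OF this] obtain s :: "'e \<Rightarrow> int" where s: "\<forall>e\<in>medges G. \<forall>y\<in>{0..len G e}.
      [F (edge_pt G e y) = F (edge_pt G e 0) + of_int (s e) * (y - 0)] (rmod l)"
    by (elim exE)
  define u where "u = (\<Sum>e\<in>medges G. frag_cmul (s e) (frag_of e))"
  have lu: "Poly_Mapping.lookup u e = (if e \<in> medges G then s e else 0)" for e
    using D(2) by (simp add: u_def lookup_sum if_distrib[of "\<lambda>x. _ * x"] sum.delta cong: if_cong)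
  have aff: "affine_mod l G F u" using s by (simp add: affine_mod_def lu)
  have "u \<in> cycles G"
    unfolding cycles_iff_balanced[OF G]
  proof (intro conjI ballI)
    show "Poly_Mapping.keys u \<subseteq> medges G" by (auto simp: in_keys_iff lu split: if_splits)
    fix v assume v: "v \<in> mverts G"
    then have "Vertex v \<in> points G" by (auto simp: points_def)
    then obtain \<sigma> where \<sigma>: "\<And>w. w \<in> tangents G (Vertex v) \<Longrightarrow> local_slope l G F w (\<sigma> w)" "(\<Sum>w\<in>tangents G (Vertex v). \<sigma> w) = 0"
      using F unfolding harmonic_mod_def harmonic_at_def by blast
    have "(\<Sum>(e, t, s)\<in>tangents G (Vertex v). if s = 1 then Poly_Mapping.lookup u e else - Poly_Mapping.lookup u e) =
        (\<Sum>w\<in>tangents G (Vertex v). \<sigma> w)"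
    proof (intro sum.cong refl)
      fix w assume w: "w \<in> tangents G (Vertex v)"
      obtain e t s where w_eq: "w = (e, t, s)" by (metis surj_pair)
      show "(case w of (e, t, s) \<Rightarrow> if s = 1 then Poly_Mapping.lookup u e else - Poly_Mapping.lookup u e) = \<sigma> w"
        using local_slope_unique[OF l affine_mod_local_slope[OF aff w[unfolded w_eq]]] \<sigma>(1)[OF w] by (simp add: w_eq)
    qed
    then show "(\<Sum>e\<in>{e\<in>medges G. head (ograph G) e = v}. Poly_Mapping.lookup u e) =
        (\<Sum>e\<in>{e\<in>medges G. tail (ograph G) e = v}. Poly_Mapping.lookup u e)"
      unfolding sum_tangents_Vertex[OF G] \<sigma>(2) by simp
  qed
  then show thesis using that aff by blast
qed

section \<open>Covers yield integral cycles\<close>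

lemma affine_modD:
  assumes "affine_mod l G F u" "e \<in> medges G" "0 \<le> t" "t \<le> len G e"
  shows "[F (edge_pt G e t) = F (Vertex (tail (ograph G) e)) + of_int (Poly_Mapping.lookup u e) * t] (rmod l)"
  using assms by (simp add: affine_mod_def)

text \<open>On each edge the integral of \<open>u\<close> equals the increment of \<open>F\<close>
  up to a multiple of \<open>l\<close>, and along a cycle the increments cancel.\<close>

lemma affine_mod_imp_integral_cycle:
  assumes G: "tropical_curve G" and u: "u \<in> cycles G" and F: "affine_mod l G F u"
  shows "integral_cycle l G u"
proof -
  note D = tropical_curveD[OF G]
  let ?F = "\<lambda>v. F (Vertex v)"
  have "\<forall>e\<in>medges G. \<exists>n::int. len G e * of_int (Poly_Mapping.lookup u e) =
      ?F (head (ograph G) e) - ?F (tail (ograph G) e) + of_int n * l"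
  proof
    fix e assume e: "e \<in> medges G"
    have "[?F (head (ograph G) e) = ?F (tail (ograph G) e) + of_int (Poly_Mapping.lookup u e) * len G e] (rmod l)"
      using affine_modD[OF F e, of "len G e"] D(6)[OF e] by (simp add: edge_pt_len)
    then obtain n where "?F (tail (ograph G) e) + of_int (Poly_Mapping.lookup u e) * len G e = ?F (head (ograph G) e) + of_int n * l"
      unfolding rcong_altdef by (elim exE)
    then show "\<exists>n::int. len G e * of_int (Poly_Mapping.lookup u e) =
      ?F (head (ograph G) e) - ?F (tail (ograph G) e) + of_int n * l"
      by (intro exI[of _ n]) (simp add: algebra_simps)
  qed
  from bchoice[OF this] obtain n :: "_ \<Rightarrow> int" where n: "\<forall>e\<in>medges G. len G e * of_int (Poly_Mapping.lookup u e) =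
      ?F (head (ograph G) e) - ?F (tail (ograph G) e) + of_int (n e) * l"
    by (elim exE)
  have "\<exists>m::int. integration G u c = of_int m * l" if c: "c \<in> cycles G" for c
  proof
    have "integration G u c = (\<Sum>e\<in>medges G. of_int (Poly_Mapping.lookup c e) * (?F (head (ograph G) e) - ?F (tail (ograph G) e))
        + of_int (Poly_Mapping.lookup c e * n e) * l)"
      unfolding integration_eq[OF G] by (intro sum.cong refl) (simp add: n algebra_simps)
    also have "\<dots> = of_int (\<Sum>e\<in>medges G. Poly_Mapping.lookup c e * n e) * l"
      using cycle_stokes[OF G c, of ?F] by (simp add: sum.distrib sum_distrib_right)
    finally show "integration G u c = of_int (\<Sum>e\<in>medges G. Poly_Mapping.lookup c e * n e) * l" .
  qed
  then show ?thesis using u by (simp add: integral_cycle_def)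
qed

text \<open>The potential at \<open>v\<close> is the integral of \<open>u\<close> along the tree
  path from the root. Consistency at the head of an edge holds only modulo \<open>l\<close>; the
  discrepancy is a period of \<open>u\<close>.\<close>

lemma integral_cycle_imp_affine_mod:
  fixes G :: "('v, 'e) metric_graph"
  assumes G: "tropical_curve G" and u: "integral_cycle l G u"
  obtains F where "affine_mod l G F u"
proof -
  note D = tropical_curveD[OF G]
  let ?tl = "tail (ograph G)" and ?hd = "head (ograph G)"
  obtain T r and P :: "'v \<Rightarrow> 'e \<Rightarrow>\<^sub>0 int" where T: "T \<subseteq> medges G"
    and P: "\<And>v. v \<in> mverts G \<Longrightarrow> Poly_Mapping.keys (P v) \<subseteq> T \<and> boundary G (P v) = frag_of v - frag_of r"
    using spanning_tree[OF G] by metis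
  define f where "f = (\<lambda>v. integration G u (P v))"
  define F where "F = (\<lambda>p. case p of Vertex v \<Rightarrow> f v | Inner e t \<Rightarrow> f (?tl e) + of_int (Poly_Mapping.lookup u e) * t)"
  have hd_tl: "[f (?hd e) = f (?tl e) + of_int (Poly_Mapping.lookup u e) * len G e] (rmod l)" if e: "e \<in> medges G" for e
  proof -
    \<comment> \<open>The edge closed up by tree paths. The period of \<open>u\<close> along this
      cycle measures how far the potential is off across \<open>e\<close>.\<close>
    let ?c = "frag_of e + P (?tl e) + frag_cmul (-1) (P (?hd e))"
    have "Poly_Mapping.keys ?c \<subseteq> medges G"
      using P[OF D(4)[OF e]] P[OF D(5)[OF e]] T e
      by (intro order_trans[OF keys_add] Un_least order_trans[OF keys_cmul]) (auto simp: keys_frag_of)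
    moreover have "boundary G ?c = 0"
      using P[OF D(4)[OF e]] P[OF D(5)[OF e]]
      by (simp add: boundary_def frag_extend_add frag_extend_cmul frag_extend_minus frag_extend_diff)
    ultimately have "?c \<in> cycles G" by (simp add: cycles_def)
    then have "\<exists>n::int. integration G u ?c = of_int n * l"
      using u unfolding integral_cycle_def by (elim conjE) (rule bspec)
    then obtain n :: int where n: "integration G u ?c = of_int n * l" by (elim exE)
    have "integration G u (frag_of e) = (\<Sum>x\<in>medges G. if x = e then len G x * of_int (Poly_Mapping.lookup u x) else 0)"
      unfolding integration_eq[OF G] by (intro sum.cong refl) simp
    also have "\<dots> = len G e * of_int (Poly_Mapping.lookup u e)"
      using e D(2) by simp
    finally have "integration G u (frag_of e) = len G e * of_int (Poly_Mapping.lookup u e)" .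
    then have "integration G u ?c = len G e * of_int (Poly_Mapping.lookup u e) + f (?tl e) - f (?hd e)"
      by (simp only: integration_add_right[OF G] integration_cmul_right[OF G] f_def of_int_minus of_int_1 mult_minus1 diff_conv_add_uminus)
    then have "f (?tl e) + of_int (Poly_Mapping.lookup u e) * len G e = f (?hd e) + of_int n * l"
      using n by (simp add: algebra_simps del: frag_cmul_minus_one)
    then show ?thesis unfolding rcong_altdef by (rule exI)
  qed
  have "affine_mod l G F u"
    unfolding affine_mod_def
  proof (intro ballI)
    fix e t assume e: "e \<in> medges G" and t: "t \<in> {0..len G e}"
    consider "t = 0" | "t = len G e" | "0 < t" "t < len G e" using t by fastforce
    then show "[F (edge_pt G e t) = F (Vertex (?tl e)) + of_int (Poly_Mapping.lookup u e) * t] (rmod l)"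
    proof cases
      case 2
      then show ?thesis using hd_tl[OF e] D(6)[OF e] by (simp add: F_def edge_pt_len)
    qed (simp_all add: F_def edge_pt_inner)
  qed
  then show thesis by (rule that)
qed

lemma affine_mod_0_constant:
  assumes G: "tropical_curve G" and F: "affine_mod l G F 0" and pq: "p \<in> points G" "q \<in> points G"
  shows "[F p = F q] (rmod l)"
proof -
  note D = tropical_curveD[OF G]
  obtain r where r: "r \<in> mverts G" using D(3) by blast
  have edge: "[F (edge_pt G e t) = F (Vertex (tail (ograph G) e))] (rmod l)" if "e \<in> medges G" "t \<in> {0..len G e}" for e t
    using affine_modD[OF F, of e t] that by simp
  have hd: "[F (Vertex (head (ograph G) e)) = F (Vertex (tail (ograph G) e))] (rmod l)" if "e \<in> medges G" for e
    using edge[OF that, of "len G e"] D(6)[OF that] by (simp add: edge_pt_len)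
  define S where "S = {v\<in>mverts G. [F (Vertex v) = F (Vertex r)] (rmod l)}"
  have "S = mverts G"
  proof (rule tropical_curve_cut[OF G])
    show "S \<subseteq> mverts G" "S \<noteq> {}" using r by (auto simp: S_def)
    show "tail (ograph G) e \<in> S \<longleftrightarrow> head (ograph G) e \<in> S" if "e \<in> medges G" for e
      using hd[OF that] D(4,5)[OF that] by (auto simp: S_def rcong_def)
  qed
  then have v: "[F (Vertex v) = F (Vertex r)] (rmod l)" if "v \<in> mverts G" for v
    using that by (auto simp: S_def)
  have "[F p = F (Vertex r)] (rmod l)" if "p \<in> points G" for p
  proof (cases p)
    case (Inner e t)
    then have "e \<in> medges G" "0 < t" "t < len G e" using that by (auto simp: points_def)
    then show ?thesis using edge[of e t] v[OF D(4)] by (simp add: Inner edge_pt_inner rcong_def)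
  qed (use that v in \<open>auto simp: points_def\<close>)
  then show ?thesis using pq by (simp add: rcong_def)
qed

text \<open>Surjectivity of the cover makes \<open>u\<close> nonzero: if \<open>u\<close> were 0,
  the pulled back potential would be constant modulo \<open>l\<close>, and then so would
  \<open>\<theta>\<close> be on all of \<open>E\<close>, contradicting its nonzero slope on some
  edge.\<close>

lemma cover_imp_integral_cycle:
  assumes G: "tropical_curve G" and "covers_elliptic_curve G"
  obtains l u where "0 < l" "integral_cycle l G u" "u \<noteq> 0"
proof -
  obtain E :: "(nat, nat) metric_graph" and \<phi> where "tropical_elliptic_curve E" and cov: "tropical_cover G E \<phi>"
    using assms(2) unfolding covers_elliptic_curve_def by (elim exE conjE)
  then have E: "tropical_curve E" "genus E = 1" by (simp_all add: tropical_elliptic_curve_def)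
  note D = tropical_curveD[OF E(1)]
  obtain c where c: "c \<in> cycles E" "c \<noteq> 0" "\<And>d. d \<in> cycles E \<Longrightarrow> \<exists>k. d = frag_cmul k c"
    using cycle_basis_rank1[OF E] by metis
  define l where "l = integration E c c"
  have l: "0 < l" unfolding l_def by (rule integration_pos[OF E(1) c(1,2)])
  have "\<exists>n::int. integration E c d = of_int n * l" if d: "d \<in> cycles E" for d
  proof -
    from c(3)[OF d] obtain k where "d = frag_cmul k c" by (elim exE)
    then have "integration E c d = of_int k * l" by (simp only: integration_cmul_right[OF E(1)] l_def)
    then show ?thesis by (rule exI)
  qed
  then have "integral_cycle l E c" using c(1) by (simp add: integral_cycle_def)
  then obtain \<theta> where \<theta>: "affine_mod l E \<theta> c" by (rule integral_cycle_imp_affine_mod[OF E(1)])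
  obtain M N :: "(nat, nat) metric_graph" and h k \<psi> where M: "model_of M h G" and N: "model_of N k E"
    and \<psi>: "\<forall>p\<in>points M. \<psi> p \<in> points N \<and> k (\<psi> p) = \<phi> (h p)" and harm: "harmonic_on_models M N \<psi>"
    and surj: "\<phi> ` points G = points E"
    using cov unfolding tropical_cover_def by (elim exE conjE)
  have MN: "tropical_curve M" "tropical_curve N" using M N by (simp_all add: model_of_def)
  have "harmonic_mod l E \<theta>" by (rule affine_mod_imp_harmonic[OF E(1) c(1) \<theta>])
  then have "harmonic_mod l N (\<theta> \<circ> k)" by (simp only: harmonic_mod_model[OF N E(1)])
  then have "harmonic_mod l M ((\<theta> \<circ> k) \<circ> \<psi>)"
    using \<psi> by (intro harmonic_mod_pullback[OF MN harm]) auto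
  \<comment> \<open>The two composites agree on the points of \<open>M\<close> only, not as
    functions on the whole type.\<close>
  moreover have "harmonic_mod l M ((\<theta> \<circ> k) \<circ> \<psi>) \<longleftrightarrow> harmonic_mod l M ((\<theta> \<circ> \<phi>) \<circ> h)"
    using \<psi> by (intro harmonic_mod_cong[OF MN(1)]) simp
  ultimately have harmG: "harmonic_mod l G (\<theta> \<circ> \<phi>)" by (simp only: harmonic_mod_model[OF M G])
  obtain u where u: "u \<in> cycles G" "affine_mod l G (\<theta> \<circ> \<phi>) u"
    by (rule harmonic_mod_imp_affine[OF G l harmG])
  have "u \<noteq> 0"
  proof
    assume "u = 0"
    then have const: "[\<theta> p = \<theta> q] (rmod l)" if "p \<in> points E" "q \<in> points E" for p q
    proof -
      from that have "p \<in> \<phi> ` points G" "q \<in> \<phi> ` points G" by (simp_all only: surj)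
      then obtain p' q' where "p = \<phi> p'" "q = \<phi> q'" "p' \<in> points G" "q' \<in> points G" by (elim imageE)
      then show ?thesis using affine_mod_0_constant[OF G u(2)[unfolded \<open>u = 0\<close>]] by simp
    qed
    obtain e where e: "Poly_Mapping.lookup c e \<noteq> 0" using c(2) by (metis lookup_zero poly_mapping_eqI)
    then have em: "e \<in> medges E" using c(1) by (auto simp: cycles_def in_keys_iff)
    let ?a = "\<theta> (Vertex (tail (ograph E) e))"
    have "[?a + of_int (Poly_Mapping.lookup c e) * t = ?a + 0 * t] (rmod l)" if t: "0 < t" "t < len E e" for t
    proof -
      have "[\<theta> (edge_pt E e t) = ?a + of_int (Poly_Mapping.lookup c e) * t] (rmod l)"
        using t by (intro affine_modD[OF \<theta> em]) simp_all
      moreover have "[\<theta> (edge_pt E e t) = \<theta> (edge_pt E e 0)] (rmod l)"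
        by (intro const edge_pt_in_points E(1) em)
      ultimately show ?thesis by (simp add: rcong_def)
    qed
    then have "\<forall>\<^sub>F t in at_right 0. [?a + of_int (Poly_Mapping.lookup c e) * t = ?a + 0 * t] (rmod l)"
      unfolding eventually_at_right_field using D(6)[OF em] by (intro exI[of _ "len E e"]) simp
    from rcong_affine_unique(1)[OF l this] show False using e by simp
  qed
  then show thesis using that[OF l affine_mod_imp_integral_cycle[OF G u]] by simp
qed

section \<open>Subdivisions\<close>

lemma tropical_curveI:
  assumes "finite (mverts G)" "finite (medges G)" "mverts G \<noteq> {}"
    and "\<And>e. e \<in> medges G \<Longrightarrow> tail (ograph G) e \<in> mverts G"
    and "\<And>e. e \<in> medges G \<Longrightarrow> head (ograph G) e \<in> mverts G"
    and "\<And>e. e \<in> medges G \<Longrightarrow> 0 < len G e"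
    and cut: "\<And>S. S \<subseteq> mverts G \<Longrightarrow> S \<noteq> {} \<Longrightarrow>
      (\<And>e. e \<in> medges G \<Longrightarrow> tail (ograph G) e \<in> S \<longleftrightarrow> head (ograph G) e \<in> S) \<Longrightarrow> S = mverts G"
  shows "tropical_curve G"
proof -
  have "fin_digraph (ograph G)"
    by unfold_locales (use assms in auto)
  moreover from this have "wf_digraph (ograph G)" by (rule fin_digraph.axioms)
  then have "Digraph_Component.connected (ograph G)"
    by (subst connected_iff_cut) (use assms(3) cut in \<open>simp_all\<close>)
  ultimately show ?thesis
    using assms(6) by (simp add: tropical_curve_def)
qed

lemma Vertex_in_points [simp]: "Vertex v \<in> points G \<longleftrightarrow> v \<in> mverts G"
  and Inner_in_points [simp]: "Inner e t \<in> points G \<longleftrightarrow> e \<in> medges G \<and> 0 < t \<and> t < len G e"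
  by (auto simp: points_def)

lemma refines_refl:
  assumes "tropical_curve G"
  shows "refines G id G"
proof -
  have "affine_on_edge G G id e 1" if "e \<in> medges G" for e
    unfolding affine_on_edge_def using that by (auto intro!: bexI[of _ e] exI[of _ 0])
  then show ?thesis using assms by (simp add: refines_def)
qed

lemma refines_trans:
  assumes R': "refines R' k' R" and R: "refines R k G"
  shows "refines R' (k \<circ> k') G"
  unfolding refines_def
proof (intro conjI ballI)
  show "tropical_curve R'" using R' by (simp add: refines_def)
  show "bij_betw (k \<circ> k') (points R') (points G)"
    using R R' bij_betw_trans unfolding refines_def by metis
  have "Vertex ` mverts G \<subseteq> k ` Vertex ` mverts R" "Vertex ` mverts R \<subseteq> k' ` Vertex ` mverts R'"
    using R R' by (simp_all add: refines_def)
  then show "Vertex ` mverts G \<subseteq> (k \<circ> k') ` Vertex ` mverts R'"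
    unfolding image_comp[symmetric] by (meson image_mono order_trans)
  fix e assume e: "e \<in> medges R'"
  have "affine_on_edge R' R k' e 1" using R' e by (simp add: refines_def)
  then obtain f a s where f: "f \<in> medges R" and s: "s = 1 \<or> s = -1"
    and 1: "\<And>t. t \<in> {0..len R' e} \<Longrightarrow> a + s * real 1 * t \<in> {0..len R f} \<and> k' (edge_pt R' e t) = edge_pt R f (a + s * real 1 * t)"
    by (rule affine_on_edgeE[OF _ zero_less_one]) auto
  have "affine_on_edge R G k f 1" using R f by (simp add: refines_def)
  then obtain g b r where g: "g \<in> medges G" and r: "r = 1 \<or> r = -1"
    and 2: "\<And>t. t \<in> {0..len R f} \<Longrightarrow> b + r * real 1 * t \<in> {0..len G g} \<and> k (edge_pt R f t) = edge_pt G g (b + r * real 1 * t)"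
    by (rule affine_on_edgeE[OF _ zero_less_one]) auto
  have "(b + r * a) + (r * s) * real 1 * t \<in> {0..len G g} \<and>
      (k \<circ> k') (edge_pt R' e t) = edge_pt G g ((b + r * a) + (r * s) * real 1 * t)" if "t \<in> {0..len R' e}" for t
    using 1[OF that] 2[of "a + s * real 1 * t"] by (simp add: algebra_simps)
  moreover have "r * s \<in> {1, -1}" using r s by auto
  ultimately show "affine_on_edge R' G (k \<circ> k') e 1"
    unfolding affine_on_edge_def if_not_P[OF one_neq_zero]
    by (intro bexI[OF _ g] exI[of _ "b + r * a"] bexI[of _ "r * s"] ballI)
qed

text \<open>Models in a cover carry natural number labels. This provides the trivial subdivision
  with such labels, and from then on fresh names are always available.\<close>

lemma ex_nat_relabelling:
  fixes G :: "('v, 'e) metric_graph"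
  assumes G: "tropical_curve G"
  obtains R :: "(nat, nat) metric_graph" and k where
    "refines R k G" "k ` Vertex ` mverts R = Vertex ` mverts G"
proof -
  note D = tropical_curveD[OF G]
  obtain f :: "'v \<Rightarrow> nat" where f: "inj_on f (mverts G)"
    using finite_imp_inj_to_nat_seg[OF D(1)] by (elim exE conjE)
  obtain g :: "'e \<Rightarrow> nat" where g: "inj_on g (medges G)"
    using finite_imp_inj_to_nat_seg[OF D(2)] by (elim exE conjE)
  define f' where "f' = the_inv_into (mverts G) f"
  define g' where "g' = the_inv_into (medges G) g"
  have f': "f' (f v) = v" if "v \<in> mverts G" for v using f that by (simp add: f'_def the_inv_into_f_f)
  have g': "g' (g e) = e" if "e \<in> medges G" for e using g that by (simp add: g'_def the_inv_into_f_f)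
  define R :: "(nat, nat) metric_graph" where
    "R = \<lparr> ograph = \<lparr> verts = f ` mverts G, arcs = g ` medges G,
        tail = (\<lambda>n. f (tail (ograph G) (g' n))), head = (\<lambda>n. f (head (ograph G) (g' n))) \<rparr>,
      len = (\<lambda>n. len G (g' n)) \<rparr>"
  have Rs: "mverts R = f ` mverts G" "medges R = g ` medges G" "len R n = len G (g' n)"
    "tail (ograph R) n = f (tail (ograph G) (g' n))" "head (ograph R) n = f (head (ograph G) (g' n))" for n
    by (simp_all add: R_def)
  define k :: "(nat, nat) point \<Rightarrow> ('v, 'e) point" where
    "k = (\<lambda>p. case p of Vertex n \<Rightarrow> Vertex (f' n) | Inner n t \<Rightarrow> Inner (g' n) t)"
  have ke: "k (edge_pt R (g e) t) = edge_pt G e t" if "e \<in> medges G" for e t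
    using that D(4)[OF that] D(5)[OF that] by (simp add: edge_pt_def Rs g' k_def f')
  have tR: "tropical_curve R"
  proof (rule tropical_curveI)
    fix S assume S: "S \<subseteq> mverts R" "S \<noteq> {}" "\<And>e. e \<in> medges R \<Longrightarrow> tail (ograph R) e \<in> S \<longleftrightarrow> head (ograph R) e \<in> S"
    let ?S = "{v\<in>mverts G. f v \<in> S}"
    have "?S = mverts G"
    proof (rule tropical_curve_cut[OF G])
      show "?S \<subseteq> mverts G" "?S \<noteq> {}" using S(1,2) by (auto simp: Rs)
      show "tail (ograph G) e \<in> ?S \<longleftrightarrow> head (ograph G) e \<in> ?S" if "e \<in> medges G" for e
        using S(3)[of "g e"] that D(4,5)[OF that] by (simp add: Rs g')
    qed
    then show "S = mverts R" using S(1) by (auto simp: Rs)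
  qed (use D in \<open>auto simp: Rs g'\<close>)
  have "bij_betw k (points R) (points G)"
  proof (rule bij_betw_byWitness[where f' = "\<lambda>p. case p of Vertex v \<Rightarrow> Vertex (f v) | Inner e t \<Rightarrow> Inner (g e) t"])
  qed (auto simp: points_def Rs k_def f' g')
  moreover have "k ` Vertex ` mverts R = Vertex ` mverts G"
    by (auto simp: Rs k_def f' image_iff)
  moreover have "affine_on_edge R G k n 1" if n: "n \<in> medges R" for n
  proof -
    obtain e where e: "e \<in> medges G" "n = g e" using n by (auto simp: Rs)
    show ?thesis
      unfolding affine_on_edge_def using e
      by (auto simp: ke Rs g' intro!: bexI[of _ e] exI[of _ 0])
  qed
  ultimately show thesis using that[of R k] tR by (simp add: refines_def)
qed

lemma split_edge:
  fixes G :: "(nat, nat) metric_graph"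
  assumes G: "tropical_curve G" and e\<^sub>0: "e\<^sub>0 \<in> medges G" and t\<^sub>0: "0 < t\<^sub>0" "t\<^sub>0 < len G e\<^sub>0"
  obtains R :: "(nat, nat) metric_graph" and k where
    "refines R k G" "k ` Vertex ` mverts R = insert (Inner e\<^sub>0 t\<^sub>0) (Vertex ` mverts G)"
proof -
  note D = tropical_curveD[OF G]
  obtain w where w: "w \<notin> mverts G" using D(1) ex_new_if_finite infinite_UNIV_nat by blast
  obtain n where n: "n \<notin> medges G" using D(2) ex_new_if_finite infinite_UNIV_nat by blast
  have ne: "n \<noteq> e\<^sub>0" using n e\<^sub>0 by blast
  \<comment> \<open>The initial segment keeps the name \<open>e\<^sub>0\<close> and now ends in the
    fresh vertex \<open>w\<close>; the fresh edge \<open>n\<close> runs from \<open>w\<close> to the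
    old head.\<close>
  define R :: "(nat, nat) metric_graph" where
    "R = \<lparr> ograph = \<lparr> verts = insert w (mverts G), arcs = insert n (medges G),
        tail = (tail (ograph G))(n := w), head = (head (ograph G))(n := head (ograph G) e\<^sub>0, e\<^sub>0 := w) \<rparr>,
      len = (len G)(e\<^sub>0 := t\<^sub>0, n := len G e\<^sub>0 - t\<^sub>0) \<rparr>"
  have Rs: "mverts R = insert w (mverts G)" "medges R = insert n (medges G)"
    "len R = (len G)(e\<^sub>0 := t\<^sub>0, n := len G e\<^sub>0 - t\<^sub>0)"
    "tail (ograph R) = (tail (ograph G))(n := w)"
    "head (ograph R) = (head (ograph G))(n := head (ograph G) e\<^sub>0, e\<^sub>0 := w)"
    by (simp_all add: R_def)
  define k :: "(nat, nat) point \<Rightarrow> (nat, nat) point" where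
    "k = (\<lambda>p. case p of Vertex v \<Rightarrow> if v = w then Inner e\<^sub>0 t\<^sub>0 else Vertex v
       | Inner e t \<Rightarrow> if e = n then Inner e\<^sub>0 (t\<^sub>0 + t) else Inner e t)"
  define k' :: "(nat, nat) point \<Rightarrow> (nat, nat) point" where
    "k' = (\<lambda>p. case p of Vertex v \<Rightarrow> Vertex v
       | Inner e t \<Rightarrow> if e = e\<^sub>0 \<and> t = t\<^sub>0 then Vertex w else if e = e\<^sub>0 \<and> t\<^sub>0 < t then Inner n (t - t\<^sub>0) else Inner e t)"
  have tR: "tropical_curve R"
  proof (rule tropical_curveI)
    fix S assume S: "S \<subseteq> mverts R" "S \<noteq> {}" "\<And>e. e \<in> medges R \<Longrightarrow> tail (ograph R) e \<in> S \<longleftrightarrow> head (ograph R) e \<in> S"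
    \<comment> \<open>The two halves tie \<open>w\<close> to both ends of \<open>e\<^sub>0\<close>,
      so a closed set of \<open>R\<close> contains both ends or neither, as the cut criterion for
      \<open>G\<close> demands.\<close>
    have w_tl: "w \<in> S \<longleftrightarrow> tail (ograph G) e\<^sub>0 \<in> S" using S(3)[of e\<^sub>0] e\<^sub>0 ne by (auto simp: Rs)
    have w_hd: "w \<in> S \<longleftrightarrow> head (ograph G) e\<^sub>0 \<in> S" using S(3)[of n] ne by (auto simp: Rs)
    let ?S = "S - {w}"
    have "?S = mverts G"
    proof (rule tropical_curve_cut[OF G])
      show "?S \<subseteq> mverts G" using S(1) by (auto simp: Rs)
      show "?S \<noteq> {}"
      proof
        assume "?S = {}"
        then have "w \<in> S" using S(2) by auto
        then have "tail (ograph G) e\<^sub>0 \<in> S" using w_tl by simp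
        moreover have "tail (ograph G) e\<^sub>0 \<noteq> w" using D(4)[OF e\<^sub>0] w by auto
        ultimately show False using \<open>?S = {}\<close> by auto
      qed
      fix e assume e: "e \<in> medges G"
      then have "e \<noteq> n" using n by auto
      have nw: "tail (ograph G) e \<noteq> w" "head (ograph G) e \<noteq> w" using D(4)[OF e] D(5)[OF e] w by auto
      show "tail (ograph G) e \<in> ?S \<longleftrightarrow> head (ograph G) e \<in> ?S"
      proof (cases "e = e\<^sub>0")
        case True
        then show ?thesis using w_tl w_hd nw by auto
      next
        case False
        then show ?thesis using S(3)[of e] e \<open>e \<noteq> n\<close> nw by (auto simp: Rs)
      qed
    qed
    moreover from this have "tail (ograph G) e\<^sub>0 \<in> S" using D(4)[OF e\<^sub>0] by blast
    then have "w \<in> S" using w_tl by simp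
    ultimately show "S = mverts R" by (auto simp: Rs)
  next
    fix e assume e: "e \<in> medges R"
    show "tail (ograph R) e \<in> mverts R" using e D(4) by (auto simp: Rs)
    show "head (ograph R) e \<in> mverts R" using e D(5) e\<^sub>0 by (auto simp: Rs)
    show "0 < len R e" using e D(6) t\<^sub>0 by (auto simp: Rs)
  qed (use D in \<open>auto simp: Rs\<close>)
  have "bij_betw k (points R) (points G)"
  proof (rule bij_betw_byWitness[where f' = k'])
    show "\<forall>p\<in>points R. k' (k p) = p"
      using w n ne t\<^sub>0 by (auto simp: points_def Rs k_def k'_def)
    show "\<forall>p\<in>points G. k (k' p) = p"
      using w n ne t\<^sub>0 by (auto simp: points_def k_def k'_def)
    show "k ` points R \<subseteq> points G"
      using w n ne t\<^sub>0 e\<^sub>0 by (auto simp: points_def Rs k_def split: if_splits)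
    show "k' ` points G \<subseteq> points R"
    proof (rule image_subsetI)
      fix p assume "p \<in> points G"
      then show "k' p \<in> points R"
        using w n ne t\<^sub>0 e\<^sub>0 by (cases p) (auto simp: Rs k'_def)
    qed
  qed
  moreover have vi: "k ` Vertex ` mverts R = insert (Inner e\<^sub>0 t\<^sub>0) (Vertex ` mverts G)"
    using w by (auto simp: Rs k_def image_iff split: if_splits)
  moreover have "affine_on_edge R G k e 1" if e: "e \<in> medges R" for e
  proof -
    define e' a where "e' = (if e = n then e\<^sub>0 else e)" and "a = (if e = n then t\<^sub>0 else 0)"
    have e': "e' \<in> medges G" using e e\<^sub>0 by (auto simp: e'_def Rs)
    have nw: "tail (ograph G) e' \<noteq> w" "head (ograph G) e' \<noteq> w" using D(4)[OF e'] D(5)[OF e'] w by auto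
    have "a + 1 * real 1 * t \<in> {0..len G e'} \<and> k (edge_pt R e t) = edge_pt G e' (a + 1 * real 1 * t)"
      if t: "t \<in> {0..len R e}" for t
    proof -
      consider "e = n" | "e = e\<^sub>0" | "e \<noteq> n" "e \<noteq> e\<^sub>0" by blast
      then show ?thesis
      proof cases
        case 1
        then show ?thesis using t t\<^sub>0 nw ne by (auto simp: e'_def a_def Rs k_def edge_pt_def)
      next
        case 2
        then show ?thesis using t t\<^sub>0 nw ne by (auto simp: e'_def a_def Rs k_def edge_pt_def)
      next
        case 3
        then show ?thesis using t nw by (auto simp: e'_def a_def Rs k_def edge_pt_def)
      qed
    qed
    then show ?thesis
      unfolding affine_on_edge_def if_not_P[OF one_neq_zero]
      by (intro bexI[OF _ e'] exI[of _ a] bexI[of _ 1] ballI) auto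
  qed
  ultimately show thesis using that[of R k] tR by (auto simp: refines_def)
qed

text \<open>Points are added one at a time. A point that is not yet a vertex has its preimage inside
  an edge of the current refinement, where that edge is split.\<close>

lemma ex_subdivision:
  fixes G :: "('v, 'e) metric_graph"
  assumes G: "tropical_curve G" and "finite A" "A \<subseteq> points G"
  shows "\<exists>(R :: (nat, nat) metric_graph) k. refines R k G \<and> k ` Vertex ` mverts R = Vertex ` mverts G \<union> A"
  using assms(2,3)
proof (induction A)
  case empty
  obtain R :: "(nat, nat) metric_graph" and k where "refines R k G" "k ` Vertex ` mverts R = Vertex ` mverts G"
    by (rule ex_nat_relabelling[OF G])
  then show ?case by (intro exI[of _ R] exI[of _ k]) simp
next
  case (insert q A)
  have "A \<subseteq> points G" using insert.prems by simp
  from insert.IH[OF this] obtain R :: "(nat, nat) metric_graph" and k where R: "refines R k G" "k ` Vertex ` mverts R = Vertex ` mverts G \<union> A"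
    by (elim exE conjE)
  show ?case
  proof (cases "q \<in> Vertex ` mverts G \<union> A")
    case True
    then have "Vertex ` mverts G \<union> A = Vertex ` mverts G \<union> insert q A" by blast
    then show ?thesis using R by (intro exI[of _ R] exI[of _ k]) (simp only:)
  next
    case False
    have "q \<in> k ` points R" using R(1) insert.prems by (simp add: refines_def bij_betw_def)
    then obtain p where p: "q = k p" "p \<in> points R" by (elim imageE)
    have "p \<notin> Vertex ` mverts R" using False p(1) unfolding R(2)[symmetric] by blast
    then obtain e t where et: "p = Inner e t" "e \<in> medges R" "0 < t" "t < len R e"
      using p(2) by (auto simp: points_def)
    have tR: "tropical_curve R" using R(1) by (simp add: refines_def)
    obtain R' :: "(nat, nat) metric_graph" and k' where R': "refines R' k' R"
      "k' ` Vertex ` mverts R' = insert (Inner e t) (Vertex ` mverts R)"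
      by (rule split_edge[OF tR et(2-4)])
    have "(k \<circ> k') ` Vertex ` mverts R' = insert q (Vertex ` mverts G \<union> A)"
      unfolding image_comp[symmetric] R'(2) image_insert R(2) by (simp add: p(1) et(1))
    then have "(k \<circ> k') ` Vertex ` mverts R' = Vertex ` mverts G \<union> insert q A"
      by (simp only: Un_insert_right)
    then show ?thesis
      by (intro exI[of _ R'] exI[of _ "k \<circ> k'"] conjI refines_trans[OF R'(1) R(1)])
  qed
qed

section \<open>Maps to the circle\<close>

text \<open>The universal covering of the circle by the real line; the reduced argument lies between
  0 and \<open>l\<close>, and multiples of \<open>l\<close> go to the vertex.\<close>

definition circ :: "real \<Rightarrow> real \<Rightarrow> (nat, nat) point" where
  "circ l x = edge_pt (loop_graph l) 0 (x rmod l)"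

text \<open>On the circle this is a section of \<open>circ l\<close>. The value 0 at the vertex is
  one of the two limits there, and the other one, \<open>l\<close>, is congruent to it.\<close>

fun circ_coord :: "('v, 'e) point \<Rightarrow> real" where
  "circ_coord (Vertex v) = 0"
| "circ_coord (Inner e t) = t"

lemma circ_coord_circ:
  assumes "0 < l"
  shows "circ_coord (circ l x) = x rmod l"
  using rmod_less[OF assms, of x] rmod_nonneg[of l x] assms by (auto simp: circ_def edge_pt_def)

lemma circ_eq_iff:
  assumes "0 < l"
  shows "circ l x = circ l y \<longleftrightarrow> [x = y] (rmod l)"
proof
  assume "circ l x = circ l y"
  then have "circ_coord (circ l x) = circ_coord (circ l y)" by simp
  then show "[x = y] (rmod l)" by (simp add: circ_coord_circ[OF assms] rcong_def)
qed (simp add: circ_def rcong_def)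

lemma edge_pt_loop_graph:
  assumes "0 < l" "t \<in> {0..l}"
  shows "edge_pt (loop_graph l) 0 t = circ l t"
proof (cases "t = l")
  case True
  then show ?thesis by (simp add: circ_def edge_pt_def)
next
  case False
  then have "t \<in> {0..<\<bar>l\<bar>}" using assms by auto
  then show ?thesis unfolding circ_def by (subst rmod_idem) auto
qed

lemma circ_in_points: "0 < l \<Longrightarrow> circ l x \<in> points (loop_graph l)"
  by (auto simp: circ_def intro!: edge_pt_in_points tropical_curve_loop_graph)

lemma circ_circ_coord:
  assumes "0 < l" "q \<in> points (loop_graph l)"
  shows "circ l (circ_coord q) = q"
proof (cases q)
  case (Inner e t)
  with assms have "e = 0" "0 < t" "t < l" by auto
  then have "circ l t = Inner e t" using edge_pt_loop_graph[OF assms(1), of t] by (simp add: edge_pt_inner)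
  then show ?thesis by (simp add: Inner)
qed (use assms in \<open>simp add: circ_def\<close>)

lemma topspace_realization: "tropical_curve G \<Longrightarrow> topspace (realization G) = points G"
proof -
  assume G: "tropical_curve G"
  have "{t \<in> {0..len G e}. edge_pt G e t \<in> points G} = {0..len G e}" if "e \<in> medges G" for e
    using edge_pt_in_points[OF G that] by auto
  then have "openin (realization G) (points G)"
    unfolding openin_realization by simp
  then show ?thesis
    unfolding topspace_def using openin_realization by blast
qed

text \<open>Continuity of the covering map. The quotient topology controls only the closed parameter
  interval, so over the vertex neighbourhoods of both of its ends have to be glued.\<close>

lemma open_circ_vimage:
  assumes l: "0 < l" and U: "openin (realization (loop_graph l)) U"
  shows "open {x. circ l x \<in> U}"
proof -
  have "openin (top_of_set {0..l}) {t\<in>{0..l}. edge_pt (loop_graph l) 0 t \<in> U}"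
    using U by (simp add: openin_realization)
  also have "{t\<in>{0..l}. edge_pt (loop_graph l) 0 t \<in> U} = {t\<in>{0..l}. circ l t \<in> U}"
    using edge_pt_loop_graph[OF l] by auto
  finally obtain T where T: "open T" "{t\<in>{0..l}. circ l t \<in> U} = {0..l} \<inter> T"
    by (auto simp: openin_open)
  have mem: "circ l t \<in> U \<longleftrightarrow> t \<in> T" if "t \<in> {0..l}" for t
    using T(2) that by blast
  have per: "circ l (x + of_int n * l) = circ l x" for x n
    unfolding circ_eq_iff[OF l] rcong_altdef by (intro exI[of _ "- n"]) simp
  show ?thesis
    unfolding open_dist
  proof
    fix x assume x: "x \<in> {x. circ l x \<in> U}"
    \<comment> \<open>Translation by a period moves \<open>x\<close> into the fundamental
      interval.\<close>
    define n where "n = \<lfloor>x / l\<rfloor>"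
    define r where "r = x - of_int n * l"
    have r: "0 \<le> r" "r < l"
      using floor_divide_lower[OF l, of x] floor_divide_upper[OF l, of x] by (simp_all add: r_def n_def algebra_simps)
    have shift: "circ l (y - of_int n * l) = circ l y" for y
      using per[of y "- n"] by simp
    have rU: "circ l r \<in> U" using x shift by (simp add: r_def)
    then have rT: "r \<in> T" using mem[of r] r by simp
    then obtain \<epsilon> where \<epsilon>: "0 < \<epsilon>" "\<And>y. \<bar>y - r\<bar> < \<epsilon> \<Longrightarrow> y \<in> T"
      using T(1) unfolding open_dist dist_real_def by blast
    show "\<exists>e>0. \<forall>y. dist y x < e \<longrightarrow> y \<in> {x. circ l x \<in> U}"
    proof (cases "r = 0")
      case False
      define \<delta> where "\<delta> = min \<epsilon> (min r (l - r))"
      have "circ l y \<in> U" if "\<bar>y - x\<bar> < \<delta>" for y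
      proof -
        have "\<bar>(y - of_int n * l) - r\<bar> < \<delta>" using that by (simp add: r_def)
        then have "y - of_int n * l \<in> {0..l}" "y - of_int n * l \<in> T" by (auto simp: \<delta>_def intro: \<epsilon>(2))
        then have "circ l (y - of_int n * l) \<in> U" using mem by blast
        then show ?thesis by (simp only: shift)
      qed
      moreover have "0 < \<delta>" using r False \<epsilon> by (simp add: \<delta>_def)
      ultimately show ?thesis by (intro exI[of _ \<delta>]) (simp add: dist_real_def)
    next
      case True
      \<comment> \<open>Over the vertex, points to the left of \<open>x\<close> correspond to
        parameters just below \<open>l\<close>, points to the right to parameters just above
        0.\<close>
      have "circ l l \<in> U" using rU per[of 0 1] True by simp
      then have "l \<in> T" using mem[of l] l by simp
      then obtain \<epsilon>' where \<epsilon>': "0 < \<epsilon>'" "\<And>y. \<bar>y - l\<bar> < \<epsilon>' \<Longrightarrow> y \<in> T"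
        using T(1) unfolding open_dist dist_real_def by blast
      define \<delta> where "\<delta> = min \<epsilon> (min \<epsilon>' l)"
      have "circ l y \<in> U" if "\<bar>y - x\<bar> < \<delta>" for y
      proof -
        let ?z = "y - of_int n * l"
        have z: "\<bar>?z\<bar> < \<delta>" using that True by (simp add: r_def)
        show ?thesis
        proof (cases "0 \<le> ?z")
          case nonneg: True
          have "?z \<in> T" using z True by (intro \<epsilon>(2)) (simp add: \<delta>_def)
          moreover have "?z \<in> {0..l}" using z nonneg by (auto simp: \<delta>_def)
          ultimately have "circ l ?z \<in> U" using mem by blast
          then show ?thesis by (simp only: shift)
        next
          case False
          have "?z + l \<in> T" using z by (intro \<epsilon>'(2)) (simp add: \<delta>_def)
          moreover have "?z + l \<in> {0..l}" using z False by (auto simp: \<delta>_def)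
          ultimately have "circ l (?z + l) \<in> U" using mem by blast
          then show ?thesis using shift[of y] per[of ?z 1] by simp
        qed
      qed
      moreover have "0 < \<delta>" using l \<epsilon> \<epsilon>' by (simp add: \<delta>_def)
      ultimately show ?thesis by (intro exI[of _ \<delta>]) (simp add: dist_real_def)
    qed
  qed
qed

lemma continuous_circ_map:
  assumes G: "tropical_curve G" and l: "0 < l" and F: "affine_mod l G F u"
  shows "continuous_map (realization G) (realization (loop_graph l)) (\<lambda>p. circ l (F p))"
  unfolding continuous_map_def topspace_realization[OF G] topspace_realization[OF tropical_curve_loop_graph[OF l]]
proof (intro conjI allI impI)
  show "(\<lambda>p. circ l (F p)) \<in> points G \<rightarrow> points (loop_graph l)"
    using circ_in_points[OF l] by simp
  fix U assume U: "openin (realization (loop_graph l)) U"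
  show "openin (realization G) {p \<in> points G. circ l (F p) \<in> U}"
    unfolding openin_realization
  proof (intro conjI ballI)
    fix e assume e: "e \<in> medges G"
    let ?g = "\<lambda>t. F (Vertex (tail (ograph G) e)) + of_int (Poly_Mapping.lookup u e) * t"
    have "circ l (F (edge_pt G e t)) = circ l (?g t)" if "t \<in> {0..len G e}" for t
      unfolding circ_eq_iff[OF l] using affine_modD[OF F e] that by simp
    then have "{t \<in> {0..len G e}. edge_pt G e t \<in> {p \<in> points G. circ l (F p) \<in> U}} =
        {0..len G e} \<inter> ?g -` {x. circ l x \<in> U}"
      using edge_pt_in_points[OF G e] by auto
    moreover have "open (?g -` {x. circ l x \<in> U})"
      by (rule open_vimage[OF open_circ_vimage[OF l U]]) (intro continuous_intros)
    ultimately show "openin (top_of_set {0..len G e}) {t \<in> {0..len G e}. edge_pt G e t \<in> {p \<in> points G. circ l (F p) \<in> U}}"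
      by (simp add: openin_open_Int)
  qed auto
qed

text \<open>The intermediate value theorem for affine functions. The zero is given as a strict
  convex combination, so it stays inside the segment even when \<open>y\<close> is an endpoint of an
  edge.\<close>

lemma affine_root:
  fixes a b x y :: real
  assumes "0 < a + b * x" "a + b * y < 0"
  obtains \<theta> where "0 < \<theta>" "\<theta> < 1" "a + b * ((1 - \<theta>) * x + \<theta> * y) = 0"
proof -
  let ?d = "(a + b * x) - (a + b * y)"
  have d: "0 < ?d" using assms by simp
  define \<theta> where "\<theta> = (a + b * x) / ?d"
  have "\<theta> * ?d = a + b * x" unfolding \<theta>_def using d by (subst nonzero_eq_divide_eq[symmetric]) auto
  then have "a + b * ((1 - \<theta>) * x + \<theta> * y) = 0" by (simp add: algebra_simps)
  moreover have "0 < \<theta>" "\<theta> < 1" using assms d by (simp_all add: \<theta>_def)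
  ultimately show thesis using that by blast
qed

text \<open>If a value were missed, then \<open>F\<close> could be lifted to a real-valued potential of \<open>u\<close>, and
  \<open>u\<close> would be orthogonal to itself.\<close>

lemma circ_map_onto:
  fixes F :: "('v, 'e) point \<Rightarrow> real"
  assumes G: "tropical_curve G" and l: "0 < l" and F: "affine_mod l G F u" and u: "u \<in> cycles G" "u \<noteq> 0"
  shows "(\<lambda>p. circ l (F p)) ` points G = points (loop_graph l)"
proof (rule ccontr)
  assume "\<not> ?thesis"
  moreover have "(\<lambda>p. circ l (F p)) ` points G \<subseteq> points (loop_graph l)" using circ_in_points[OF l] by blast
  ultimately obtain q where q: "q \<in> points (loop_graph l)" "q \<notin> (\<lambda>p. circ l (F p)) ` points G" by blast
  note D = tropical_curveD[OF G]
  define a where "a = circ_coord q"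
  have q_eq: "circ l a = q" unfolding a_def by (rule circ_circ_coord[OF l q(1)])
  have miss: "\<not> [F p = a] (rmod l)" if "p \<in> points G" for p
  proof
    assume "[F p = a] (rmod l)"
    then have "q = circ l (F p)" using circ_eq_iff[OF l] q_eq by metis
    then show False using q(2) that by blast
  qed
  \<comment> \<open>The real lift: as the value \<open>a\<close> is missed, the representative of
    \<open>F - a\<close> lies strictly between 0 and \<open>l\<close>.\<close>
  define \<Phi> where "\<Phi> = (\<lambda>v. (F (Vertex v) - a) rmod l)"
  have \<Phi>: "0 < \<Phi> v" "\<Phi> v < l" if "v \<in> mverts G" for v
  proof -
    have "\<Phi> v \<noteq> 0" using miss[of "Vertex v"] that unfolding \<Phi>_def rcong_conv_diff_rmod_eq_0 by simp
    then show "0 < \<Phi> v" "\<Phi> v < l" using rmod_nonneg[of l "F (Vertex v) - a"] rmod_less[OF l] l by (auto simp: \<Phi>_def)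
  qed
  have step: "of_int (Poly_Mapping.lookup u e) * len G e = \<Phi> (head (ograph G) e) - \<Phi> (tail (ograph G) e)"
    if e: "e \<in> medges G" for e
  proof -
    let ?u = "of_int (Poly_Mapping.lookup u e) :: real" and ?x = "\<Phi> (tail (ograph G) e)" and ?L = "len G e"
    note tl = \<Phi>[OF D(4)[OF e]]
    have cong: "[?x + ?u * t = F (edge_pt G e t) - a] (rmod l)" if "t \<in> {0..?L}" for t
    proof -
      have "[?x + ?u * t = (F (Vertex (tail (ograph G) e)) - a) + ?u * t] (rmod l)"
        by (simp add: \<Phi>_def)
      also have "(F (Vertex (tail (ograph G) e)) - a) + ?u * t = (F (Vertex (tail (ograph G) e)) + ?u * t) - a"
        by simp
      also have "[\<dots> = F (edge_pt G e t) - a] (rmod l)"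
        using affine_modD[OF F e, of t] that by (simp add: rcong_sym_iff)
      finally show ?thesis .
    qed
    \<comment> \<open>Reaching 0 or \<open>l\<close> would mean taking the missed value.\<close>
    have avoid: "?x + ?u * t \<noteq> 0" "?x + ?u * t \<noteq> l" if t: "t \<in> {0..?L}" for t
    proof -
      have n: "\<not> [F (edge_pt G e t) - a = 0] (rmod l)"
        using miss[OF edge_pt_in_points[OF G e], of t] by (simp add: rcong_conv_diff_rmod_eq_0 rcong_0_iff)
      show "?x + ?u * t \<noteq> 0" using cong[OF t] n by (auto simp: rcong_sym_iff)
      have "[l = 0] (rmod l)" by (simp add: rcong_def)
      then show "?x + ?u * t \<noteq> l" using cong[OF t] n rcong_trans rcong_sym by metis
    qed
    have L: "0 < ?L" by (rule D(6)[OF e])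
    have mem: "(1 - \<theta>) * 0 + \<theta> * ?L \<in> {0..?L}" if "0 < \<theta>" "\<theta> < 1" for \<theta>
      using L that by simp
    have "\<not> ?x + ?u * ?L < 0"
    proof
      assume "?x + ?u * ?L < 0"
      then obtain \<theta> where "0 < \<theta>" "\<theta> < 1" "?x + ?u * ((1 - \<theta>) * 0 + \<theta> * ?L) = 0"
        using affine_root[of ?x ?u 0 ?L] tl(1) by auto
      then show False using avoid(1)[OF mem] by blast
    qed
    moreover have "\<not> l < ?x + ?u * ?L"
    proof
      assume "l < ?x + ?u * ?L"
      then have "0 < (l - ?x) + (- ?u) * 0" "(l - ?x) + (- ?u) * ?L < 0" using tl(2) by simp_all
      then obtain \<theta> where "0 < \<theta>" "\<theta> < 1" "(l - ?x) + (- ?u) * ((1 - \<theta>) * 0 + \<theta> * ?L) = 0"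
        by (rule affine_root)
      moreover from this(3) have "?x + ?u * ((1 - \<theta>) * 0 + \<theta> * ?L) = l" by simp
      ultimately show False using avoid(2)[OF mem] by blast
    qed
    moreover have "?L \<in> {0..?L}" using L by simp
    ultimately have "0 < ?x + ?u * ?L" "?x + ?u * ?L < l" using avoid[of ?L] by linarith+
    moreover have "[?x + ?u * ?L = \<Phi> (head (ograph G) e)] (rmod l)"
      using cong[OF \<open>?L \<in> {0..?L}\<close>] by (simp add: \<Phi>_def edge_pt_len[OF L])
    \<comment> \<open>Two congruent numbers strictly between 0 and \<open>l\<close> are equal, so on
      each edge the congruence becomes an exact increment.\<close>
    ultimately have "?x + ?u * ?L = \<Phi> (head (ograph G) e)"
      using \<Phi>[OF D(5)[OF e]] by (intro rcong_imp_eq) auto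
    then show ?thesis by simp
  qed
  \<comment> \<open>Now \<open>u\<close> is the differential of \<open>\<Phi>\<close>, and exact
    forms have no periods.\<close>
  have "integration G u u = (\<Sum>e\<in>medges G. of_int (Poly_Mapping.lookup u e) * (\<Phi> (head (ograph G) e) - \<Phi> (tail (ograph G) e)))"
    unfolding integration_eq[OF G] by (intro sum.cong refl) (simp add: step[symmetric] mult_ac)
  also have "\<dots> = 0" by (rule cycle_stokes[OF G u(1)])
  finally show False using integration_pos[OF G u] by simp
qed

text \<open>A solution \<open>t\<close> is determined by the integer multiple of \<open>l\<close> in
  the congruence, because \<open>s\<close> is not 0. That integer is bounded since \<open>t\<close>
  is, and \<open>K\<close> is such a bound.\<close>

lemma finite_rcong_affine:
  fixes c d s L l :: real
  assumes "0 < l" "s \<noteq> 0"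
  shows "finite {t\<in>{0..L}. [c + s * t = d] (rmod l)}"
proof -
  define K where "K = (\<bar>d - c\<bar> + \<bar>s\<bar> * L) / l"
  have "{t\<in>{0..L}. [c + s * t = d] (rmod l)} \<subseteq> (\<lambda>n::int. (d - c - of_int n * l) / s) ` {- \<lceil>K\<rceil>..\<lceil>K\<rceil>}"
  proof
    fix t assume "t \<in> {t\<in>{0..L}. [c + s * t = d] (rmod l)}"
    then have t: "0 \<le> t" "t \<le> L" "[c + s * t = d] (rmod l)" by auto
    from t(3) obtain n where n: "d = c + s * t + of_int n * l" unfolding rcong_altdef by (elim exE)
    have "\<bar>of_int n * l\<bar> = \<bar>(d - c) - s * t\<bar>" using n by simp
    also have "\<dots> \<le> \<bar>d - c\<bar> + \<bar>s\<bar> * t" using abs_triangle_ineq4[of "d - c" "s * t"] t(1) by (simp add: abs_mult)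
    also have "\<dots> \<le> \<bar>d - c\<bar> + \<bar>s\<bar> * L" using t(2) by (simp add: mult_left_mono)
    finally have "\<bar>of_int n\<bar> \<le> K" using assms(1) by (simp add: K_def pos_le_divide_eq abs_mult)
    then have "n \<in> {- \<lceil>K\<rceil>..\<lceil>K\<rceil>}" by (simp add: abs_le_iff) linarith
    moreover have "t = (d - c - of_int n * l) / s" using n assms(2) by simp
    ultimately show "t \<in> (\<lambda>n::int. (d - c - of_int n * l) / s) ` {- \<lceil>K\<rceil>..\<lceil>K\<rceil>}" by (rule rev_image_eqI)
  qed
  then show ?thesis by (rule finite_subset) simp
qed

section \<open>Integral cycles yield covers\<close>

lemma local_slope_rcong:
  assumes G: "tropical_curve G" and FF': "\<And>q. q \<in> points G \<Longrightarrow> [F q = F' q] (rmod l)"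
    and v: "v \<in> tangents G p" and s: "local_slope l G F v s"
  shows "local_slope l G F' v s"
  using s unfolding local_slope_def
proof eventually_elim
  case (elim x)
  have "[F' (germ G v x) = F (germ G v x)] (rmod l)" using FF'[OF germ_in_points[OF G v]] by (rule rcong_sym)
  also note elim
  also have "[F (germ G v 0) + of_int s * x = F' (germ G v 0) + of_int s * x] (rmod l)"
    using FF'[OF germ_in_points[OF G v]] by simp
  finally show ?case .
qed

text \<open>The coordinate is the potential of the generating form of the circle; its jump at the
  vertex is exactly \<open>l\<close>.\<close>

lemma circ_coord_affine_mod:
  assumes "0 < l"
  shows "affine_mod l (loop_graph l) circ_coord (frag_of 0)"
  unfolding affine_mod_def
proof (intro ballI)
  fix e t assume "e \<in> medges (loop_graph l)" "t \<in> {0..len (loop_graph l) e}"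
  then have "e = 0" "t \<in> {0..l}" by simp_all
  then show "[circ_coord (edge_pt (loop_graph l) e t) =
      circ_coord (Vertex (tail (ograph (loop_graph l)) e)) + of_int (Poly_Mapping.lookup (frag_of 0) e) * t] (rmod l)"
    by (simp add: edge_pt_loop_graph[OF assms] circ_coord_circ[OF assms])
qed

lemma tangents_loop_graph:
  assumes "0 < l" "q \<in> points (loop_graph l)"
  obtains t t' where "tangents (loop_graph l) q = {(0, t, 1), (0, t', -1)}"
proof (cases q)
  case (Vertex v)
  then have "tangents (loop_graph l) q = {(0, 0, 1), (0, l, -1)}"
    using assms(2) by (auto simp: tangents_Vertex[OF tropical_curve_loop_graph[OF assms(1)]])
  then show thesis by (rule that)
next
  case (Inner e t)
  then have "tangents (loop_graph l) q = {(0, t, 1), (0, t, -1)}"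
    using assms(2) tangents_Inner[of 0 "loop_graph l" t] by simp
  then show thesis by (rule that)
qed

text \<open>Given a function \<open>F\<close> with values in \<open>\<real>/l\<int>\<close>, subdivide the circle at the images of the vertices of
  \<open>G\<close>, and \<open>G\<close> at the preimages of these points on the edges that are not contracted.  The latter
  restriction keeps the subdivision finite.\<close>

locale circle_cover =
  fixes G :: "('v, 'e) metric_graph" and l :: real and u :: "'e \<Rightarrow>\<^sub>0 int" and F :: "('v, 'e) point \<Rightarrow> real"
    and M :: "(nat, nat) metric_graph" and h :: "(nat, nat) point \<Rightarrow> ('v, 'e) point" and s :: "nat \<Rightarrow>\<^sub>0 int"
    and N :: "(nat, nat) metric_graph" and k :: "(nat, nat) point \<Rightarrow> (nat, nat) point"
  assumes G: "tropical_curve G" and l: "0 < l" and u: "u \<in> cycles G" and F: "affine_mod l G F u"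
    and M: "refines M h G" and s: "affine_mod l M (F \<circ> h) s"
    and N: "refines N k (loop_graph l)"
    and vert: "\<And>v. v \<in> mverts M \<Longrightarrow> circ l (F (h (Vertex v))) \<in> k ` Vertex ` mverts N"
    and inner: "\<And>e t. Inner e t \<in> points G \<Longrightarrow> Poly_Mapping.lookup u e \<noteq> 0 \<Longrightarrow>
      circ l (F (Inner e t)) \<in> k ` Vertex ` mverts N \<Longrightarrow> Inner e t \<in> h ` Vertex ` mverts M"
begin

text \<open>The map to the circle read on the models: \<open>k\<close> is bijective on points, so
  there is only one choice.\<close>

definition lifted :: "(nat, nat) point \<Rightarrow> (nat, nat) point" where
  "lifted p = the_inv_into (points N) k (circ l (F (h p)))"

definition slope :: "nat \<Rightarrow> nat" where
  "slope e = nat \<bar>Poly_Mapping.lookup s e\<bar>"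

lemma tM: "tropical_curve M" and tN: "tropical_curve N"
  using M N by (simp_all add: refines_def)

lemma k_inj: "inj_on k (points N)" and k_onto: "k ` points N = points (loop_graph l)"
  using N by (simp_all add: refines_def bij_betw_def)

lemma k_lifted: "k (lifted p) = circ l (F (h p))"
  and lifted_in_points: "lifted p \<in> points N"
proof -
  have "circ l (F (h p)) \<in> k ` points N" unfolding k_onto by (rule circ_in_points[OF l])
  then show "k (lifted p) = circ l (F (h p))" "lifted p \<in> points N"
    unfolding lifted_def by (auto intro: f_the_inv_into_f[OF k_inj] the_inv_into_into[OF k_inj])
qed

lemma lifted_eqI: "q \<in> points N \<Longrightarrow> k q = circ l (F (h p)) \<Longrightarrow> lifted p = q"
  using k_inj lifted_in_points[of p] k_lifted[of p] by (simp add: inj_on_def)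

lemma lifted_vertex:
  assumes "circ l (F (h p)) \<in> k ` Vertex ` mverts N"
  shows "lifted p \<in> Vertex ` mverts N"
proof -
  obtain v where "v \<in> mverts N" "circ l (F (h p)) = k (Vertex v)" using assms by blast
  then show ?thesis using lifted_eqI[of "Vertex v" p] by simp
qed

lemma lifted_edge:
  assumes "e \<in> medges M" "t \<in> {0..len M e}"
  shows "k (lifted (edge_pt M e t)) =
    circ l (F (h (Vertex (tail (ograph M) e))) + of_int (Poly_Mapping.lookup s e) * t)"
  unfolding k_lifted circ_eq_iff[OF l] using affine_modD[OF s assms(1), of t] assms(2) by simp

text \<open>Otherwise the corresponding point of \<open>G\<close> would lie inside an edge with
  nonzero slope and over a vertex of \<open>N\<close>; by the assumption \<open>inner\<close> such
  points are vertices of \<open>M\<close> already.\<close>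

lemma inner_not_vertex:
  assumes e: "e \<in> medges M" and se: "Poly_Mapping.lookup s e \<noteq> 0" and t: "0 < t" "t < len M e"
  shows "lifted (edge_pt M e t) \<notin> Vertex ` mverts N"
proof
  assume "lifted (edge_pt M e t) \<in> Vertex ` mverts N"
  then have W: "circ l (F (h (edge_pt M e t))) \<in> k ` Vertex ` mverts N"
    unfolding k_lifted[symmetric] by blast
  have "affine_on_edge M G h e 1" using M e by (simp add: refines_def)
  then obtain f a r where f: "f \<in> medges G" and r: "r = 1 \<or> r = -1"
    and A: "\<And>t. t \<in> {0..len M e} \<Longrightarrow> a + r * real 1 * t \<in> {0..len G f} \<and> h (edge_pt M e t) = edge_pt G f (a + r * real 1 * t)"
    by (rule affine_on_edgeE[OF _ zero_less_one]) auto
  have L: "0 < len M e" by (rule tropical_curveD(6)[OF tM e])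
  have ends: "a + r * 0 \<in> {0..len G f}" "a + r * len M e \<in> {0..len G f}"
    using A[of 0] A[of "len M e"] L by simp_all
  have in_t: "0 < a + r * t" "a + r * t < len G f" using ends r t by auto
  have ht: "h (edge_pt M e t) = Inner f (a + r * t)"
    using A[of t] t in_t by (simp add: edge_pt_inner)
  let ?x = "F (h (Vertex (tail (ograph M) e)))" and ?y = "F (Vertex (tail (ograph G) f)) + of_int (Poly_Mapping.lookup u f) * a"
  \<comment> \<open>Both sides describe \<open>F\<close> along \<open>e\<close>, through the slope
    on \<open>M\<close> and through the slope on \<open>G\<close>. Comparing slopes shows that the
    edge \<open>f\<close> of \<open>G\<close> is not contracted either.\<close>
  have "[?x + of_int (Poly_Mapping.lookup s e) * x = ?y + (of_int (Poly_Mapping.lookup u f) * r) * x] (rmod l)"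
    if x: "0 < x" "x < len M e" for x
  proof -
    have x': "x \<in> {0..len M e}" using x by simp
    have "[?x + of_int (Poly_Mapping.lookup s e) * x = F (h (edge_pt M e x))] (rmod l)"
      using affine_modD[OF s e, of x] x' by (simp add: rcong_sym_iff)
    also have "F (h (edge_pt M e x)) = F (edge_pt G f (a + r * x))" using A[OF x'] by simp
    also have "[F (edge_pt G f (a + r * x)) = F (Vertex (tail (ograph G) f)) + of_int (Poly_Mapping.lookup u f) * (a + r * x)] (rmod l)"
      using A[OF x'] by (intro affine_modD[OF F f]) auto
    finally show ?thesis by (simp add: algebra_simps)
  qed
  then have "\<forall>\<^sub>F x in at_right 0. [?x + of_int (Poly_Mapping.lookup s e) * x = ?y + (of_int (Poly_Mapping.lookup u f) * r) * x] (rmod l)"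
    unfolding eventually_at_right_field using L by (intro exI[of _ "len M e"]) simp
  from rcong_affine_unique(1)[OF l this] have "Poly_Mapping.lookup u f \<noteq> 0" using se by auto
  moreover have "Inner f (a + r * t) \<in> points G" using f in_t by simp
  ultimately have "Inner f (a + r * t) \<in> h ` Vertex ` mverts M" using inner W ht by simp
  then obtain v where v: "v \<in> mverts M" "h (Vertex v) = h (edge_pt M e t)" using ht by (metis imageE)
  have "Vertex v = edge_pt M e t"
    using M v edge_pt_in_points[OF tM e, of t] unfolding refines_def bij_betw_def inj_on_def by simp
  then show False using t by (simp add: edge_pt_inner)
qed

text \<open>The interior of a non-contracted edge misses the vertices of \<open>N\<close>, so its image cannot leave the
  edge of \<open>N\<close> that contains the image of its midpoint.\<close>

lemma lifted_affine:
  assumes e: "e \<in> medges M"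
  shows "affine_on_edge M N lifted e (slope e)"
proof (cases "Poly_Mapping.lookup s e = 0")
  case True
  then have "lifted (edge_pt M e t) = lifted (edge_pt M e 0)" if "t \<in> {0..len M e}" for t
    using lifted_edge[OF e that] lifted_edge[OF e, of 0] that k_inj lifted_in_points
    by (simp add: inj_on_def)
  then show ?thesis unfolding affine_on_edge_def slope_def using True by auto
next
  case False
  let ?S = "of_int (Poly_Mapping.lookup s e) :: real" and ?L = "len M e"
  define x\<^sub>0 where "x\<^sub>0 = F (h (Vertex (tail (ograph M) e)))"
  have L: "0 < ?L" by (rule tropical_curveD(6)[OF tM e])
  have val: "k (lifted (edge_pt M e t)) = circ l (x\<^sub>0 + ?S * t)" if "t \<in> {0..?L}" for t
    using lifted_edge[OF e that] by (simp add: x\<^sub>0_def)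
  have avoid: "circ l (x\<^sub>0 + ?S * t) \<notin> k ` Vertex ` mverts N" if t: "0 < t" "t < ?L" for t
  proof
    assume "circ l (x\<^sub>0 + ?S * t) \<in> k ` Vertex ` mverts N"
    then have "circ l (F (h (edge_pt M e t))) \<in> k ` Vertex ` mverts N"
      using val[of t] t by (simp add: k_lifted)
    from lifted_vertex[OF this] show False using inner_not_vertex[OF e False t] by contradiction
  qed
  define t\<^sub>m where "t\<^sub>m = ?L / 2"
  have tm: "0 < t\<^sub>m" "t\<^sub>m < ?L" using L by (simp_all add: t\<^sub>m_def)
  obtain f \<tau>\<^sub>m where f: "f \<in> medges N" and \<tau>m: "0 < \<tau>\<^sub>m" "\<tau>\<^sub>m < len N f" "lifted (edge_pt M e t\<^sub>m) = Inner f \<tau>\<^sub>m"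
    using inner_not_vertex[OF e False tm] lifted_in_points[of "edge_pt M e t\<^sub>m"]
    by (cases "lifted (edge_pt M e t\<^sub>m)") auto
  have Lf: "0 < len N f" by (rule tropical_curveD(6)[OF tN f])
  have "affine_on_edge N (loop_graph l) k f 1" using N f by (simp add: refines_def)
  then obtain e' a r where e': "e' \<in> medges (loop_graph l)" and r: "r = 1 \<or> r = -1"
    and A: "\<And>t. t \<in> {0..len N f} \<Longrightarrow> a + r * real 1 * t \<in> {0..len (loop_graph l) e'} \<and>
      k (edge_pt N f t) = edge_pt (loop_graph l) e' (a + r * real 1 * t)"
    by (rule affine_on_edgeE[OF _ zero_less_one]) auto
  have rr: "r * (r * x) = x" for x using r by auto
  have kA: "k (edge_pt N f t) = circ l (a + r * t)" if "t \<in> {0..len N f}" for t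
    using A[OF that] e' edge_pt_loop_graph[OF l, of "a + r * t"] by simp
  have "circ l (a + r * \<tau>\<^sub>m) = circ l (x\<^sub>0 + ?S * t\<^sub>m)"
    using kA[of \<tau>\<^sub>m] val[of t\<^sub>m] \<tau>m tm by (simp add: edge_pt_inner)
  \<comment> \<open>The two real parametrizations agree on the circle at the midpoint, so they
    differ there by a period; \<open>b\<close> absorbs it.\<close>
  then obtain n where n: "x\<^sub>0 + ?S * t\<^sub>m = a + r * \<tau>\<^sub>m + of_int n * l"
    unfolding circ_eq_iff[OF l] rcong_altdef by (elim exE)
  define b where "b = a + of_int n * l"
  have kb: "k (edge_pt N f t) = circ l (b + r * t)" if "t \<in> {0..len N f}" for t
    unfolding kA[OF that] circ_eq_iff[OF l] rcong_altdef by (intro exI[of _ n]) (simp add: b_def)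
  \<comment> \<open>The candidate for the coordinate on \<open>f\<close>, obtained by solving
    \<open>b + r * \<tau> = x\<^sub>0 + ?S * t\<close>.\<close>
  define \<tau> where "\<tau> = (\<lambda>t. r * (x\<^sub>0 - b) + r * ?S * t)"
  have rel: "b + r * \<tau> t = x\<^sub>0 + ?S * t" for t
    using r by (auto simp: \<tau>_def algebra_simps)
  have \<tau>tm: "\<tau> t\<^sub>m = \<tau>\<^sub>m"
  proof -
    have "\<tau> t\<^sub>m = r * (x\<^sub>0 + ?S * t\<^sub>m - b)" by (simp add: \<tau>_def algebra_simps)
    also have "\<dots> = r * (r * \<tau>\<^sub>m)" unfolding n by (simp add: b_def)
    finally show ?thesis by (simp add: rr)
  qed
  \<comment> \<open>At an end of \<open>f\<close> the image would be a vertex of \<open>N\<close>.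
    Since \<open>\<tau>\<close> starts inside \<open>f\<close> at the midpoint, leaving
    \<open>f\<close> would require such a value strictly between the midpoint and
    \<open>t\<close>.\<close>
  have no_root: "\<tau> z \<noteq> 0" "\<tau> z \<noteq> len N f" if z: "0 < z" "z < ?L" for z
  proof -
    have "k (Vertex (tail (ograph N) f)) \<in> k ` Vertex ` mverts N" "k (Vertex (head (ograph N) f)) \<in> k ` Vertex ` mverts N"
      using tropical_curveD(4,5)[OF tN f] by blast+
    then have "circ l (b + r * 0) \<in> k ` Vertex ` mverts N" "circ l (b + r * len N f) \<in> k ` Vertex ` mverts N"
      using kb[of 0] kb[of "len N f"] Lf by (simp_all add: edge_pt_len)
    then show "\<tau> z \<noteq> 0" "\<tau> z \<noteq> len N f" using avoid[OF z] rel[of z] by metis+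
  qed
  have conv: "0 < (1 - \<theta>) * t\<^sub>m + \<theta> * t" "(1 - \<theta>) * t\<^sub>m + \<theta> * t < ?L"
    if "t \<in> {0..?L}" "0 < \<theta>" "\<theta> < 1" for t \<theta>
  proof -
    have "0 < (1 - \<theta>) * t\<^sub>m" "0 \<le> \<theta> * t" using that tm by simp_all
    then show "0 < (1 - \<theta>) * t\<^sub>m + \<theta> * t" by linarith
    have "(1 - \<theta>) * t\<^sub>m < (1 - \<theta>) * ?L" "\<theta> * t \<le> \<theta> * ?L" using that tm by simp_all
    then show "(1 - \<theta>) * t\<^sub>m + \<theta> * t < ?L" by (simp add: algebra_simps)
  qed
  have range: "\<tau> t \<in> {0..len N f}" if t: "t \<in> {0..?L}" for t
  proof -
    have "\<not> \<tau> t < 0"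
    proof
      assume "\<tau> t < 0"
      then have "0 < r * (x\<^sub>0 - b) + r * ?S * t\<^sub>m" "r * (x\<^sub>0 - b) + r * ?S * t < 0"
        using \<tau>m(1) \<tau>tm by (simp_all add: \<tau>_def)
      then obtain \<theta> where \<theta>: "0 < \<theta>" "\<theta> < 1" and "r * (x\<^sub>0 - b) + r * ?S * ((1 - \<theta>) * t\<^sub>m + \<theta> * t) = 0"
        by (rule affine_root)
      then show False using no_root(1)[OF conv[OF t \<theta>]] by (simp add: \<tau>_def)
    qed
    moreover have "\<not> len N f < \<tau> t"
    proof
      assume "len N f < \<tau> t"
      then have "0 < (len N f - r * (x\<^sub>0 - b)) + (- (r * ?S)) * t\<^sub>m" "(len N f - r * (x\<^sub>0 - b)) + (- (r * ?S)) * t < 0"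
        using \<tau>m(2) \<tau>tm by (simp_all add: \<tau>_def)
      then obtain \<theta> where \<theta>: "0 < \<theta>" "\<theta> < 1"
        and eq: "(len N f - r * (x\<^sub>0 - b)) + (- (r * ?S)) * ((1 - \<theta>) * t\<^sub>m + \<theta> * t) = 0"
        by (rule affine_root)
      have "\<tau> ((1 - \<theta>) * t\<^sub>m + \<theta> * t) = len N f" using eq unfolding \<tau>_def mult_minus_left by linarith
      then show False using no_root(2)[OF conv[OF t \<theta>]] by contradiction
    qed
    ultimately show ?thesis by simp
  qed
  \<comment> \<open>The definition of affine maps wants a natural number as slope, so the sign of
    \<open>?S\<close> is moved into the orientation.\<close>
  define \<sigma> where "\<sigma> = r * sgn ?S"
  have \<sigma>: "\<sigma> \<in> {1, -1}" using r False by (auto simp: \<sigma>_def sgn_if)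
  have slope: "\<sigma> * real (slope e) = r * ?S"
    by (simp add: \<sigma>_def slope_def mult.assoc sgn_mult_abs)
  have "r * (x\<^sub>0 - b) + \<sigma> * real (slope e) * t \<in> {0..len N f} \<and>
      lifted (edge_pt M e t) = edge_pt N f (r * (x\<^sub>0 - b) + \<sigma> * real (slope e) * t)" if t: "t \<in> {0..?L}" for t
  proof -
    have "k (edge_pt N f (\<tau> t)) = k (lifted (edge_pt M e t))"
      unfolding kb[OF range[OF t]] rel val[OF t] ..
    then have "lifted (edge_pt M e t) = edge_pt N f (\<tau> t)"
      using edge_pt_in_points[OF tN f] by (intro lifted_eqI) (simp_all add: k_lifted)
    then show ?thesis using range[OF t] unfolding slope \<tau>_def by simp
  qed
  moreover have "slope e \<noteq> 0" using False by (simp add: slope_def)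
  ultimately show ?thesis
    unfolding affine_on_edge_def using f \<sigma> by (simp only: if_False) (intro bexI[of _ f] exI[of _ "r * (x\<^sub>0 - b)"] bexI[of _ \<sigma>] ballI; simp)
qed

text \<open>On a contracted edge the image is constant. Otherwise the affine formula names a single
  edge of \<open>N\<close> whose interior contains the image, and distinct open edges are
  disjoint.\<close>

lemma lifted_open_edge:
  assumes e: "e \<in> medges M" and t: "0 < t" "t < len M e" and t': "0 < t'" "t' < len M e"
    and f: "lifted (Inner e t) \<in> open_edge N f"
  shows "lifted (Inner e t') \<in> open_edge N f"
proof (cases "Poly_Mapping.lookup s e = 0")
  case True
  then have "k (lifted (edge_pt M e t)) = k (lifted (edge_pt M e t'))"
    using lifted_edge[OF e, of t] lifted_edge[OF e, of t'] t t' by simp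
  then have "lifted (Inner e t') = lifted (Inner e t)"
    using k_inj lifted_in_points t t' by (simp add: inj_on_def edge_pt_inner)
  then show ?thesis using f by simp
next
  case False
  then have "0 < slope e" by (simp add: slope_def)
  with lifted_affine[OF e] obtain g a r where g: "g \<in> medges N"
    and A: "\<And>t. t \<in> {0..len M e} \<Longrightarrow> a + r * real (slope e) * t \<in> {0..len N g} \<and>
      lifted (edge_pt M e t) = edge_pt N g (a + r * real (slope e) * t)"
    by (rule affine_on_edgeE) auto
  have "lifted (Inner e x) \<in> open_edge N g" if x: "0 < x" "x < len M e" for x
  proof -
    let ?y = "a + r * real (slope e) * x"
    have y: "?y \<in> {0..len N g}" "lifted (edge_pt M e x) = edge_pt N g ?y" using A[of x] x by simp_all
    have "edge_pt N g ?y \<notin> Vertex ` mverts N"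
      unfolding y(2)[symmetric] by (rule inner_not_vertex[OF e False x])
    then have "0 < ?y \<and> ?y < len N g"
      using tropical_curveD(4,5)[OF tN g] by (auto simp: edge_pt_def split: if_splits)
    then show ?thesis using y(2) x by (auto simp: open_edge_def edge_pt_inner)
  qed
  from this[OF t] this[OF t'] f show ?thesis by (auto simp: open_edge_def)
qed

text \<open>An open edge of \<open>M\<close> that meets the preimage lies in it by the preceding
  lemma, and vertices of \<open>M\<close> stay outside because they go to vertices.\<close>

lemma lifted_preimage:
  assumes f: "f \<in> medges N"
  shows "\<exists>A\<subseteq>medges M. {p\<in>points M. lifted p \<in> open_edge N f} = (\<Union>e\<in>A. open_edge M e)"
proof -
  define A where "A = {e\<in>medges M. \<exists>t. 0 < t \<and> t < len M e \<and> lifted (Inner e t) \<in> open_edge N f}"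
  have "p \<in> (\<Union>e\<in>A. open_edge M e)" if p: "p \<in> points M" "lifted p \<in> open_edge N f" for p
  proof (cases p)
    case (Vertex v)
    then have "lifted p \<in> Vertex ` mverts N" using p(1) vert by (intro lifted_vertex) simp
    then show ?thesis using p(2) by (auto simp: open_edge_def)
  next
    case (Inner e t)
    then show ?thesis using p by (auto simp: A_def open_edge_def)
  qed
  moreover have "p \<in> points M \<and> lifted p \<in> open_edge N f" if "p \<in> (\<Union>e\<in>A. open_edge M e)" for p
  proof -
    obtain e t' where e: "e \<in> A" and p: "p = Inner e t'" "0 < t'" "t' < len M e"
      using \<open>p \<in> (\<Union>e\<in>A. open_edge M e)\<close> by (auto simp: open_edge_def)
    obtain t where "e \<in> medges M" "0 < t" "t < len M e" "lifted (Inner e t) \<in> open_edge N f"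
      using e by (auto simp: A_def)
    then show ?thesis using lifted_open_edge[OF _ _ _ p(2,3)] p by simp
  qed
  ultimately have "{p\<in>points M. lifted p \<in> open_edge N f} = (\<Union>e\<in>A. open_edge M e)" by blast
  moreover have "A \<subseteq> medges M" by (auto simp: A_def)
  ultimately show ?thesis by blast
qed

text \<open>The two directions at a point of the circle have slopes \<open>1\<close> and \<open>-1\<close>, so the sum of the slopes of
  \<open>F\<close> at \<open>p\<close> is the difference of the two local degrees.\<close>

lemma lifted_degree:
  assumes p: "p \<in> points M" and w: "w \<in> tangents N (lifted p)" "w' \<in> tangents N (lifted p)"
  shows "local_degree M N lifted slope p w = local_degree M N lifted slope p w'"
proof -
  let ?E = "loop_graph l"
  have tE: "tropical_curve ?E" by (rule tropical_curve_loop_graph[OF l])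
  have "k (lifted p) \<in> points ?E" unfolding k_lifted by (rule circ_in_points[OF l])
  then obtain t t' where T: "tangents ?E (k (lifted p)) = {(0, t, 1), (0, t', -1)}"
    by (rule tangents_loop_graph[OF l])
  obtain \<beta> where bij: "bij_betw \<beta> (tangents N (lifted p)) (tangents ?E (k (lifted p)))"
    and \<beta>: "\<And>l F v s. v \<in> tangents N (lifted p) \<Longrightarrow> local_slope l N (F \<circ> k) v s \<longleftrightarrow> local_slope l ?E F (\<beta> v) s"
    using refines_tangents_slope[OF N tE lifted_in_points] by metis
  \<comment> \<open>The outgoing slopes of the coordinate function on the circle.\<close>
  define \<kappa> :: "nat \<times> real \<times> real \<Rightarrow> int" where "\<kappa> = (\<lambda>(e, t, s). if s = 1 then 1 else -1)"
  note slopes = affine_mod_local_slope[OF circ_coord_affine_mod[OF l]]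
  have "local_slope l ?E circ_coord (0, t, 1) 1" "local_slope l ?E circ_coord (0, t', -1) (-1)"
    using slopes[of 0 t 1 "k (lifted p)"] slopes[of 0 t' "-1" "k (lifted p)"] by (simp_all add: T)
  then have "local_slope l ?E circ_coord v (\<kappa> v)" if "v \<in> tangents ?E (k (lifted p))" for v
    using that unfolding T by (auto simp: \<kappa>_def)
  then have \<tau>: "local_slope l N (circ_coord \<circ> k) v (\<kappa> (\<beta> v))" if "v \<in> tangents N (lifted p)" for v
    using \<beta>[OF that] bij_betwE[OF bij] that by simp
  obtain \<sigma> where \<sigma>: "\<And>v. v \<in> tangents M p \<Longrightarrow> local_slope l M ((circ_coord \<circ> k) \<circ> lifted) v (\<sigma> v)"
    "(\<Sum>v\<in>tangents M p. \<sigma> v) = (\<Sum>w\<in>tangents N (lifted p). \<kappa> (\<beta> w) * int (local_degree M N lifted slope p w))"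
  proof (rule pullback_slopes[where d = slope and \<tau> = "\<lambda>w. \<kappa> (\<beta> w)" and \<theta> = "circ_coord \<circ> k", OF tM tN lifted_affine \<tau>])
    fix \<sigma> assume a: "\<And>v. v \<in> tangents M p \<Longrightarrow> local_slope l M ((circ_coord \<circ> k) \<circ> lifted) v (\<sigma> v)"
      and b: "(\<Sum>v\<in>tangents M p. \<sigma> v) = (\<Sum>w\<in>tangents N (lifted p). \<kappa> (\<beta> w) * int (local_degree M N lifted slope p w))"
    show thesis by (rule that[OF a b])
  qed
  \<comment> \<open>Pulling the coordinate back along the map returns \<open>F\<close>, so the
    slopes computed from local degrees are those of \<open>F\<close> and sum to 0.\<close>
  have "[((circ_coord \<circ> k) \<circ> lifted) q = (F \<circ> h) q] (rmod l)" for q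
    by (simp add: k_lifted circ_coord_circ[OF l])
  then have \<sigma>': "local_slope l M (F \<circ> h) v (\<sigma> v)" if "v \<in> tangents M p" for v
    using local_slope_rcong[OF tM _ that \<sigma>(1)[OF that]] by simp
  have "harmonic_mod l M (F \<circ> h)"
    using affine_mod_imp_harmonic[OF G u F] by (simp only: harmonic_mod_refines[OF M G])
  then have "harmonic_at l M (F \<circ> h) p" using p by (simp add: harmonic_mod_def)
  then obtain \<rho> where \<rho>: "\<forall>v\<in>tangents M p. local_slope l M (F \<circ> h) v (\<rho> v)" "(\<Sum>v\<in>tangents M p. \<rho> v) = 0"
    unfolding harmonic_at_def by (elim exE conjE)
  have "(\<Sum>v\<in>tangents M p. \<sigma> v) = (\<Sum>v\<in>tangents M p. \<rho> v)"
    by (intro sum.cong refl local_slope_unique[OF l \<sigma>'] bspec[OF \<rho>(1)])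
  then have sum0: "(\<Sum>w\<in>tangents N (lifted p). \<kappa> (\<beta> w) * int (local_degree M N lifted slope p w)) = 0"
    using \<sigma>(2) \<rho>(2) by simp
  let ?i = "the_inv_into (tangents N (lifted p)) \<beta>"
  have bij': "bij_betw ?i (tangents ?E (k (lifted p))) (tangents N (lifted p))"
    by (rule bij_betw_the_inv_into[OF bij])
  define w1 w2 where "w1 = ?i (0, t, 1)" and "w2 = ?i (0, t', -1)"
  have TN: "tangents N (lifted p) = {w1, w2}"
    using bij_betw_imp_surj_on[OF bij'] unfolding T w1_def w2_def by simp
  have \<beta>w: "\<beta> w1 = (0, t, 1)" "\<beta> w2 = (0, t', -1)"
    unfolding w1_def w2_def using f_the_inv_into_f_bij_betw[OF bij] T by auto
  then have "w1 \<noteq> w2" by auto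
  then have "int (local_degree M N lifted slope p w1) = int (local_degree M N lifted slope p w2)"
    using sum0 unfolding TN by (simp add: \<beta>w \<kappa>_def)
  then show ?thesis using w unfolding TN by auto
qed

lemma harmonic_lifted: "harmonic_on_models M N lifted"
  unfolding harmonic_on_models_def
proof (intro conjI ballI exI[of _ slope])
  show "lifted (Vertex v) \<in> Vertex ` mverts N" if "v \<in> mverts M" for v
    by (rule lifted_vertex[OF vert[OF that]])
qed (fact lifted_preimage lifted_affine lifted_degree)+

end

lemma model_of_refines:
  fixes R :: "(nat, nat) metric_graph"
  assumes "refines R k G"
  shows "model_of R k G"
proof -
  have "tropical_curve R" using assms by (simp add: refines_def)
  then show ?thesis
    unfolding model_of_def using assms refines_refl[of R] by (intro conjI exI[of _ R] exI[of _ id]) simp_all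
qed

lemma integral_cycle_imp_cover:
  fixes G :: "('v, 'e) metric_graph"
  assumes G: "tropical_curve G" and l: "0 < l" and "integral_cycle l G u" and u0: "u \<noteq> 0"
  shows "covers_elliptic_curve G"
proof -
  note D = tropical_curveD[OF G]
  let ?E = "loop_graph l"
  have tE: "tropical_curve ?E" by (rule tropical_curve_loop_graph[OF l])
  have u: "u \<in> cycles G" using assms(3) by (simp add: integral_cycle_def)
  obtain F where F: "affine_mod l G F u" by (rule integral_cycle_imp_affine_mod[OF G assms(3)])
  define \<phi> where "\<phi> = (\<lambda>p. circ l (F p))"
  have "finite (\<phi> ` Vertex ` mverts G)" "\<phi> ` Vertex ` mverts G \<subseteq> points ?E"
    using D(1) circ_in_points[OF l] by (auto simp: \<phi>_def)
  from ex_subdivision[OF tE this]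
  obtain N :: "(nat, nat) metric_graph" and k where N: "refines N k ?E"
    and kN: "k ` Vertex ` mverts N = Vertex ` mverts ?E \<union> \<phi> ` Vertex ` mverts G"
    by (elim exE conjE)
  define W where "W = k ` Vertex ` mverts N"
  have finW: "finite W" unfolding W_def kN using D(1) by simp
  define S :: "'e \<Rightarrow> ('v, 'e) point set" where
    "S = (\<lambda>e. {p. \<exists>t. p = Inner e t \<and> 0 < t \<and> t < len G e \<and> \<phi> p \<in> W})"
  define A where "A = (\<Union>e\<in>{e\<in>medges G. Poly_Mapping.lookup u e \<noteq> 0}. S e)"
  have finS: "finite (S e)"
    if e: "e \<in> medges G" "Poly_Mapping.lookup u e \<noteq> 0" for e
  proof -
    let ?c = "F (Vertex (tail (ograph G) e))" and ?u = "of_int (Poly_Mapping.lookup u e) :: real"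
    \<comment> \<open>On an edge with nonzero slope, the points over a given point of the circle
      solve one affine congruence.\<close>
    have sub: "S e \<subseteq>
        Inner e ` (\<Union>q\<in>W. {t\<in>{0..len G e}. [?c + ?u * t = circ_coord q] (rmod l)})"
    proof
      fix p assume "p \<in> S e"
      then obtain t where t: "p = Inner e t" "0 < t" "t < len G e" "\<phi> (Inner e t) \<in> W" by (auto simp: S_def)
      have "[?c + ?u * t = F (Inner e t)] (rmod l)"
        using affine_modD[OF F e(1), of t] t by (simp add: edge_pt_inner rcong_sym_iff)
      then have "[?c + ?u * t = circ_coord (\<phi> (Inner e t))] (rmod l)"
        by (simp add: \<phi>_def circ_coord_circ[OF l])
      then show "p \<in> Inner e ` (\<Union>q\<in>W. {t\<in>{0..len G e}. [?c + ?u * t = circ_coord q] (rmod l)})"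
        unfolding t(1) using t(2-4) by (intro imageI UN_I[of "\<phi> (Inner e t)"]) simp_all
    qed
    have "finite (\<Union>q\<in>W. {t\<in>{0..len G e}. [?c + ?u * t = circ_coord q] (rmod l)})"
      using finW e(2) by (intro finite_UN_I finite_rcong_affine[OF l]) simp_all
    then show ?thesis using sub by (rule finite_surj)
  qed
  have "finite A" unfolding A_def using D(2) finS by (intro finite_UN_I) simp_all
  moreover have "A \<subseteq> points G" by (auto simp: A_def S_def)
  ultimately have "\<exists>(M :: (nat, nat) metric_graph) h. refines M h G \<and> h ` Vertex ` mverts M = Vertex ` mverts G \<union> A"
    by (rule ex_subdivision[OF G])
  then obtain M :: "(nat, nat) metric_graph" and h where M: "refines M h G"
    and hM: "h ` Vertex ` mverts M = Vertex ` mverts G \<union> A"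
    by (elim exE conjE)
  have tM: "tropical_curve M" using M by (simp add: refines_def)
  \<comment> \<open>The slopes on the edges of \<open>M\<close> come from harmonicity, which passes
    to refinements, so there is no need to trace how the edges of \<open>G\<close> are cut and
    reoriented.\<close>
  have harm: "harmonic_mod l M (F \<circ> h)"
    using affine_mod_imp_harmonic[OF G u F] by (simp only: harmonic_mod_refines[OF M G])
  obtain s where s: "affine_mod l M (F \<circ> h) s" by (rule harmonic_mod_imp_affine[OF tM l harm])
  interpret circle_cover G l u F M h s N k
  proof unfold_locales
    fix v assume "v \<in> mverts M"
    then have "h (Vertex v) \<in> Vertex ` mverts G \<union> A" unfolding hM[symmetric] by blast
    then have "\<phi> (h (Vertex v)) \<in> W"
    proof
      assume "h (Vertex v) \<in> Vertex ` mverts G"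
      then show ?thesis unfolding W_def kN by blast
    next
      assume "h (Vertex v) \<in> A"
      then show ?thesis by (auto simp: A_def S_def)
    qed
    then show "circ l (F (h (Vertex v))) \<in> k ` Vertex ` mverts N" by (simp add: \<phi>_def W_def)
  next
    fix e t assume "Inner e t \<in> points G" "Poly_Mapping.lookup u e \<noteq> 0" "circ l (F (Inner e t)) \<in> k ` Vertex ` mverts N"
    then have "Inner e t \<in> A" by (auto simp: A_def S_def W_def \<phi>_def)
    then show "Inner e t \<in> h ` Vertex ` mverts M" unfolding hM by blast
  qed (fact G l u F M s N)+
  have "tropical_cover G ?E \<phi>"
    unfolding tropical_cover_def
  proof (intro conjI exI)
    show "continuous_map (realization G) (realization ?E) \<phi>"
      unfolding \<phi>_def by (rule continuous_circ_map[OF G l F])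
    show "\<phi> ` points G = points ?E"
      unfolding \<phi>_def by (rule circ_map_onto[OF G l F u u0])
    show "model_of M h G" "model_of N k ?E" by (fact model_of_refines[OF M] model_of_refines[OF N])+
    show "\<forall>p\<in>points M. lifted p \<in> points N \<and> k (lifted p) = \<phi> (h p)"
      by (simp add: lifted_in_points k_lifted \<phi>_def)
    show "harmonic_on_models M N lifted" by (rule harmonic_lifted)
  qed (fact G tE)+
  then show ?thesis
    unfolding covers_elliptic_curve_def using tropical_elliptic_curve_loop_graph[OF l] by blast
qed

theorem theorem1:
  fixes \<Gamma> :: "('v, 'e) metric_graph"
  assumes "tropical_curve \<Gamma>" and "genus \<Gamma> = 2"
  shows "jacobian_splits \<Gamma> \<longleftrightarrow> covers_elliptic_curve \<Gamma>"
proof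
  assume "jacobian_splits \<Gamma>"
  then obtain l u where "0 < l" "integral_cycle l \<Gamma> u" "u \<noteq> 0"
    by (rule splits_imp_integral_cycle[OF assms(1)])
  then show "covers_elliptic_curve \<Gamma>" by (rule integral_cycle_imp_cover[OF assms(1)])
next
  assume "covers_elliptic_curve \<Gamma>"
  then obtain l u where "0 < l" "integral_cycle l \<Gamma> u" "u \<noteq> 0"
    by (rule cover_imp_integral_cycle[OF assms(1)])
  then show "jacobian_splits \<Gamma>" by (rule integral_cycle_imp_splits[OF assms])
qed

end
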